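(* Let $s>0$ and let $\{f_n\}_{n=1}^{\infty}$ be an orthonormal sequence in $L^2(\Omega,\mu)$. (1) There exists a positive constant $C$ such that, for every $N\ge 1$, $$\sum_{n=1}^N\left(\||x|^{s}f_n\|_{2,\mu}^{2}+\||\xi|^{s}\mathcal{T}f_n\|_{2,\mu}^{2}\right)\ge C\,N^{1+\frac{s}{2a}}.$$ (2) If $\{f_n\}_{n=1}^{\infty}$ is an orthonormal basis for $L^2(\Omega,\mu)$, then $$\sup_n\left(\||x|^{s}f_n\|_{2,\mu}\,\||\xi|^{s}\mathcal{T}f_n\|_{2,\mu}\right)=\infty.$$
   Context: Setting: $\Omega\subset\mathbb{R}^d$ is a convex cone ($\lambda x\in\Omega$ for all $\lambda>0$, $x\in\Omega$) with non-empty interior, endowed with a Borel measure $\mu$, absolutely continuous with respect to Lebesgue measure, with polar decomposition $d\mu(r\zeta)=r^{2a-1}\,dr\,Q(\zeta)\,d\omega(\zeta)$, where $a>0$, $d\omega$ is the surface measure on the unit sphere $\mathbb{S}^{d-1}$, and $Q\in L^1(\mathbb{S}^{d-1},d\omega)$, $Q\ne 0$ (so $\mu$ is homogeneous of degree $2a$). $\|\cdot\|_{p,\mu}$ is the norm of $L^p(\Omega,\mu)$ and $\langle f,g\rangle_\mu=\int_\Omega f\overline{g}\,d\mu$. The kernel $\mathcal{K}:\Omega\times\Omega\to\mathbb{C}$ is continuous, bounded ($|\mathcal{K}(x,\xi)|\le c_{\mathcal{K}}$) and homogeneous ($\mathcal{K}(\lambda x,\xi)=\mathcal{K}(x,\lambda\xi)$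 for $\lambda>0$). The operator $\mathcal{T}$ is $\mathcal{T}f(\xi)=\int_\Omega f(x)\mathcal{K}(x,\xi)\,d\mu(x)$. It is assumed that (i) (inversion) if $f,\mathcal{T}f\in L^1(\Omega,\mu)$ then $f$ is continuous and $f(x)=\int_\Omega\mathcal{T}f(\xi)\overline{\mathcal{K}(x,\xi)}\,d\mu(\xi)$ for almost every $x$; (ii) (Parseval) $\langle\mathcal{T}f,\mathcal{T}g\rangle_\mu=\langle f,g\rangle_\mu$ for Schwartz functions $f,g$ on $\Omega$; in particular $\mathcal{T}$ extends to a unitary operator of $L^2(\Omega,\mu)$ onto itself, with $\mathcal{T}^{-1}f=\overline{\mathcal{T}\overline{f}}$. Norms such as $\||x|^s f\|_{2,\mu}$ may take the value $+\infty$; $\||\xi|^s\mathcal{T}f\|_{2,\mu}$ is the $L^2(\Omega,\mu)$ norm of $\xi\mapsto|\xi|^s\mathcal{T}f(\xi)$. *)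

theory Defs
  imports "HOL-Analysis.Analysis"
begin

text \<open>
  Surface measure on the unit sphere of a \<open>d\<close>-dimensional Euclidean space, as the cone measure:
  a Borel set \<open>A\<close> of unit vectors has measure \<open>d\<close> times the Lebesgue measure of
  \<open>{r \<zeta> | 0 < r < 1, \<zeta> \<in> A}\<close>. In dimension 1 this is the counting measure on the two unit vectors.
\<close>

definition sphere_measure :: "'a::euclidean_space measure" where
  "sphere_measure =
     scale_measure (ennreal (real DIM('a)))
       (distr (restrict_space lborel (ball 0 1 - {0})) (restrict_space borel (sphere 0 1))
          (\<lambda>x. x /\<^sub>R norm x))"

text \<open>
  Functions in \<open>L\<^sup>2\<close> are represented by actual functions, of which only the values on \<open>space \<mu>\<close> matter.
  The norm is extended-valued, so that it makes sense for weighted functions outside \<open>L\<^sup>2\<close>.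
\<close>

definition L2 :: "'a measure \<Rightarrow> ('a \<Rightarrow> complex) set" where
  "L2 \<mu> = {f \<in> borel_measurable \<mu>. integrable \<mu> (\<lambda>x. (cmod (f x))\<^sup>2)}"

definition norm2 :: "'a measure \<Rightarrow> ('a \<Rightarrow> complex) \<Rightarrow> ennreal" where
  "norm2 \<mu> f =
     (let I = (\<integral>\<^sup>+x. ennreal ((cmod (f x))\<^sup>2) \<partial>\<mu>)
      in if I = \<infinity> then \<infinity> else ennreal (sqrt (enn2real I)))"

definition inner2 :: "'a measure \<Rightarrow> ('a \<Rightarrow> complex) \<Rightarrow> ('a \<Rightarrow> complex) \<Rightarrow> complex" where
  "inner2 \<mu> f g = (\<integral>x. f x * cnj (g x) \<partial>\<mu>)"

definition orthonormal_seq :: "'a measure \<Rightarrow> (nat \<Rightarrow> 'a \<Rightarrow> complex) \<Rightarrow> bool" where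
  "orthonormal_seq \<mu> f \<longleftrightarrow>
     (\<forall>n. f n \<in> L2 \<mu>) \<and> (\<forall>m n. inner2 \<mu> (f m) (f n) = (if m = n then 1 else 0))"

definition orthonormal_basis :: "'a measure \<Rightarrow> (nat \<Rightarrow> 'a \<Rightarrow> complex) \<Rightarrow> bool" where
  "orthonormal_basis \<mu> f \<longleftrightarrow>
     orthonormal_seq \<mu> f \<and>
     (\<forall>g\<in>L2 \<mu>. (\<lambda>N. norm2 \<mu> (\<lambda>x. g x - (\<Sum>k<N. inner2 \<mu> g (f k) * f k x))) \<longlonglongrightarrow> 0)"

fun iterated_partial :: "'a::euclidean_space list \<Rightarrow> ('a \<Rightarrow> complex) \<Rightarrow> 'a \<Rightarrow> complex" where
  "iterated_partial [] f = f"
| "iterated_partial (b # bs) f = (\<lambda>x. frechet_derivative (iterated_partial bs f) (at x) b)"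

text \<open>
  Schwartz functions on the whole space; the Schwartz functions on a subset \<open>\<Omega>\<close> are their
  restrictions to \<open>\<Omega>\<close>. Differentiability of all iterated partial derivatives, along arbitrary lists
  of basis vectors, is smoothness.
\<close>

definition schwartz :: "('a::euclidean_space \<Rightarrow> complex) \<Rightarrow> bool" where
  "schwartz f \<longleftrightarrow>
     (\<forall>bs\<in>lists Basis. iterated_partial bs f differentiable_on UNIV \<and>
        (\<forall>k::nat. bounded (range (\<lambda>x. norm x ^ k *\<^sub>R iterated_partial bs f x))))"

definition kernel_op ::
    "'a measure \<Rightarrow> ('a \<Rightarrow> 'a \<Rightarrow> complex) \<Rightarrow> ('a \<Rightarrow> complex) \<Rightarrow> 'a \<Rightarrow> complex" where
  "kernel_op \<mu> K f \<xi> = (\<integral>x. f x * K x \<xi> \<partial>\<mu>)"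

text \<open>
  Continuous extension of \<^const>\<open>kernel_op\<close> from the Schwartz functions to \<open>L\<^sup>2\<close>. Under the Parseval
  identity below the value is unique up to equality almost everywhere.
\<close>

definition kernel_op_L2 ::
    "'a::euclidean_space measure \<Rightarrow> ('a \<Rightarrow> 'a \<Rightarrow> complex) \<Rightarrow> ('a \<Rightarrow> complex) \<Rightarrow> 'a \<Rightarrow> complex" where
  "kernel_op_L2 \<mu> K f =
     (SOME g. g \<in> L2 \<mu> \<and>
        (\<exists>\<phi>. (\<forall>k::nat. schwartz (\<phi> k)) \<and>
             (\<lambda>k. norm2 \<mu> (\<lambda>x. \<phi> k x - f x)) \<longlonglongrightarrow> 0 \<and>
             (\<lambda>k. norm2 \<mu> (\<lambda>\<xi>. kernel_op \<mu> K (\<phi> k) \<xi> - g \<xi>)) \<longlonglongrightarrow> 0))"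

text \<open>
  The library predicate \<^const>\<open>cone\<close> would force \<open>0 \<in> \<Omega>\<close>, so invariance under positive dilations is
  stated directly. As \<open>\<Omega>\<close> need not be a Borel set, \<open>\<mu>\<close> lives on the trace of the Borel sets on \<open>\<Omega>\<close>.
  Elements of \<open>L\<^sup>1\<close> are classes, so in \<open>inversion\<close> continuity means having a continuous
  representative on \<open>\<Omega>\<close>.
\<close>

locale cone_transform =
  fixes \<Omega> :: "'a::euclidean_space set"
    and \<mu> :: "'a measure"
    and a :: real
    and Q :: "'a \<Rightarrow> real"
    and K :: "'a \<Rightarrow> 'a \<Rightarrow> complex"
  assumes convex: "convex \<Omega>"
    and dilation_closed: "\<And>c x. c > 0 \<Longrightarrow> x \<in> \<Omega> \<Longrightarrow> c *\<^sub>R x \<in> \<Omega>"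
    and interior_nonempty: "interior \<Omega> \<noteq> {}"
    and space_\<mu>: "space \<mu> = \<Omega>"
    and sets_\<mu>: "sets \<mu> = sets (restrict_space borel \<Omega>)"
    and abs_continuous: "absolutely_continuous lborel (distr \<mu> borel (\<lambda>x. x))"
    and a_pos: "a > 0"
    and Q_integrable: "integrable sphere_measure Q"
    and Q_nonneg: "AE \<zeta> in sphere_measure. 0 \<le> Q \<zeta>"
    and Q_nonzero: "\<not> (AE \<zeta> in sphere_measure. Q \<zeta> = 0)"
    and polar: "\<And>A. A \<in> sets \<mu> \<Longrightarrow>
       emeasure \<mu> A =
         (\<integral>\<^sup>+\<zeta>. (\<integral>\<^sup>+r. ennreal (r powr (2 * a - 1)) * indicator {0<..} r * indicator A (r *\<^sub>R \<zeta>) \<partial>lborel)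
                * ennreal (Q \<zeta>) \<partial>sphere_measure)"
    and K_continuous: "continuous_on (\<Omega> \<times> \<Omega>) (\<lambda>(x, \<xi>). K x \<xi>)"
    and K_bounded: "\<exists>c. \<forall>x\<in>\<Omega>. \<forall>\<xi>\<in>\<Omega>. cmod (K x \<xi>) \<le> c"
    and K_homogeneous: "\<And>c x \<xi>. c > 0 \<Longrightarrow> x \<in> \<Omega> \<Longrightarrow> \<xi> \<in> \<Omega> \<Longrightarrow> K (c *\<^sub>R x) \<xi> = K x (c *\<^sub>R \<xi>)"
    and inversion: "\<And>f. integrable \<mu> f \<Longrightarrow> integrable \<mu> (kernel_op \<mu> K f) \<Longrightarrow>
       (\<exists>g. continuous_on \<Omega> g \<and> (AE x in \<mu>. f x = g x)) \<and>
       (AE x in \<mu>. f x = (\<integral>\<xi>. kernel_op \<mu> K f \<xi> * cnj (K x \<xi>) \<partial>\<mu>))"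
    and parseval: "\<And>f g. schwartz f \<Longrightarrow> schwartz g \<Longrightarrow>
       kernel_op \<mu> K f \<in> L2 \<mu> \<and> kernel_op \<mu> K g \<in> L2 \<mu> \<and>
       inner2 \<mu> (kernel_op \<mu> K f) (kernel_op \<mu> K g) = inner2 \<mu> f g"

end

theory Submission
  imports Defs
begin

text \<open>
  If \<open>f\<close> has small dispersion and so does its transform, then \<open>f\<close> is close to its restriction to a
  ball of radius \<open>r\<close>, and the transform of that restriction, given by the integral formula, has most
  of its mass in a ball of radius \<open>R\<close>. Applying Bessel's inequality, for fixed \<open>\<xi>\<close>, to the kernel cut
  off at radius \<open>r\<close>, and integrating over \<open>\<bar>\<xi>\<bar> < R\<close>, shows that an orthonormal sequence contains at
  most \<open>O(\<mu>(B\<^sub>r) \<mu>(B\<^sub>R)) = O((r R)\<^bsup>2a\<^esup>)\<close> such functions. Part (1) follows by counting. For part (2),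
  bounded dispersion products would give a bounded number of basis functions on each dyadic dispersion
  scale \<open>2\<^sup>k\<close>. Against a unit vector supported in \<open>1 \<le> \<bar>x\<bar> < 2\<close>, such a function has coefficient
  decaying exponentially in \<open>\<bar>k\<bar>\<close>: for \<open>k < 0\<close> because it lives near the origin, for \<open>k \<ge> 0\<close>
  because its transform does, whereas the transform of the unit vector is bounded. Hence finitely many
  basis functions carry half of the mass of every such vector, although these vectors span an
  infinite-dimensional space.
\<close>

section \<open>The space of square-integrable functions\<close>

text \<open>The transform of a general square-integrable function is only a limit of transforms of
  Schwartz functions, whereas the count needs values computed from the kernel.
  \<open>transform_pair_local\<close> bridges this gap for functions of bounded support, and it
  dictates the preparations: completeness, so that the limits exist, and density of Schwartz
  functions with control of supports, so that approximants of a localised function stay in one ball,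
  where the bounded kernel is square-integrable.

  Dispersions \<alpha> and \<beta> give the radii (4 \<alpha>)^(1/s) and (4 \<beta>)^(1/s), so the
  count is of order (\<alpha> \<beta>)^(2a/s). It depends on the product \<alpha> \<beta> alone,
  which is why one estimate serves both parts. With \<alpha> = \<beta> of order N^(s/(4a)) it leaves
  at least half of N functions with a large dispersion. With bounded products, the scale \<alpha> =
  2^(k+1) admits \<beta> of order 2^(-k), and the resulting bound is the same for all k.\<close>

definition l2norm :: "'a measure \<Rightarrow> ('a \<Rightarrow> complex) \<Rightarrow> real" where
  "l2norm M f = sqrt (\<integral>x. (cmod (f x))\<^sup>2 \<partial>M)"

lemma l2norm_nonneg [simp]: "0 \<le> l2norm M f"
  by (simp add: l2norm_def)

lemma l2norm_power2: "(l2norm M f)\<^sup>2 = (\<integral>x. (cmod (f x))\<^sup>2 \<partial>M)"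
  by (simp add: l2norm_def)

lemma L2_measurable [measurable_dest]: "f \<in> L2 M \<Longrightarrow> f \<in> borel_measurable M"
  by (simp add: L2_def)

lemma L2_integrable: "f \<in> L2 M \<Longrightarrow> integrable M (\<lambda>x. (cmod (f x))\<^sup>2)"
  by (simp add: L2_def)

lemma L2_nn_integral:
  assumes "f \<in> L2 M"
  shows "(\<integral>\<^sup>+x. ennreal ((cmod (f x))\<^sup>2) \<partial>M) = ennreal ((l2norm M f)\<^sup>2)"
  using assms by (simp add: l2norm_power2 nn_integral_eq_integral L2_integrable)

lemma L2_iff_nn_integral:
  assumes "f \<in> borel_measurable M"
  shows "f \<in> L2 M \<longleftrightarrow> (\<integral>\<^sup>+x. ennreal ((cmod (f x))\<^sup>2) \<partial>M) < \<infinity>"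
  using assms by (simp add: L2_def integrable_iff_bounded)

lemma norm2_power2: "(norm2 M f)\<^sup>2 = (\<integral>\<^sup>+x. ennreal ((cmod (f x))\<^sup>2) \<partial>M)"
proof (cases "(\<integral>\<^sup>+x. ennreal ((cmod (f x))\<^sup>2) \<partial>M) = \<infinity>")
  case False
  then show ?thesis
    by (simp add: norm2_def Let_def ennreal_power less_top[symmetric])
qed (simp add: norm2_def)

text \<open>Outside \<open>L2\<close> the two can disagree: a Bochner integral that does not exist
  is 0, while \<open>norm2\<close> is infinite.\<close>

lemma norm2_eq_l2norm: "f \<in> L2 M \<Longrightarrow> norm2 M f = ennreal (l2norm M f)"
  using L2_nn_integral[of f M] by (simp add: norm2_def Let_def)

lemma norm2_less_top_iff:
  assumes "f \<in> borel_measurable M"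
  shows "norm2 M f < \<infinity> \<longleftrightarrow> f \<in> L2 M"
  unfolding L2_iff_nn_integral[OF assms] by (auto simp: norm2_def Let_def less_top)

lemma cmod_add_power2_le: "(cmod (u + v))\<^sup>2 \<le> 2 * (cmod u)\<^sup>2 + 2 * (cmod v)\<^sup>2"
proof -
  have "(cmod (u + v))\<^sup>2 \<le> (cmod u + cmod v)\<^sup>2"
    by (intro power_mono norm_triangle_ineq) auto
  also have "\<dots> \<le> 2 * (cmod u)\<^sup>2 + 2 * (cmod v)\<^sup>2"
    using sum_squares_bound[of "cmod u" "cmod v"] by (simp add: power2_sum)
  finally show ?thesis .
qed

lemma L2_zero [simp]: "(\<lambda>x. 0) \<in> L2 M"
  by (simp add: L2_def)

lemma L2_add:
  assumes [measurable]: "f \<in> L2 M" "g \<in> L2 M"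
  shows "(\<lambda>x. f x + g x) \<in> L2 M"
proof -
  have "integrable M (\<lambda>x. (cmod (f x + g x))\<^sup>2)"
    by (rule Bochner_Integration.integrable_bound[of _ "\<lambda>x. 2 * (cmod (f x))\<^sup>2 + 2 * (cmod (g x))\<^sup>2"])
       (auto intro!: AE_I2 L2_integrable assms cmod_add_power2_le)
  then show ?thesis by (simp add: L2_def)
qed

lemma L2_cmult:
  assumes [measurable]: "f \<in> L2 M"
  shows "(\<lambda>x. c * f x) \<in> L2 M"
  using L2_integrable[OF assms] by (simp add: L2_def norm_mult power_mult_distrib)

lemma L2_diff:
  assumes "f \<in> L2 M" "g \<in> L2 M"
  shows "(\<lambda>x. f x - g x) \<in> L2 M"
  using L2_add[OF assms(1) L2_cmult[OF assms(2), of "-1"]] by simp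

lemma L2_sum:
  assumes "\<And>i. i \<in> I \<Longrightarrow> f i \<in> L2 M"
  shows "(\<lambda>x. \<Sum>i\<in>I. f i x) \<in> L2 M"
  using assms by (induction I rule: infinite_finite_induct) (auto intro: L2_add)

lemma L2_bound:
  assumes "f \<in> L2 M" and [measurable]: "g \<in> borel_measurable M"
    and "\<And>x. x \<in> space M \<Longrightarrow> cmod (g x) \<le> cmod (f x)"
  shows "g \<in> L2 M"
proof -
  have "integrable M (\<lambda>x. (cmod (g x))\<^sup>2)"
    by (rule Bochner_Integration.integrable_bound[OF L2_integrable[OF assms(1)]])
       (auto intro!: AE_I2 power_mono assms)
  then show ?thesis by (simp add: L2_def)
qed

lemma l2norm_mono:
  assumes "f \<in> L2 M" "g \<in> borel_measurable M"
    and "\<And>x. x \<in> space M \<Longrightarrow> cmod (g x) \<le> cmod (f x)"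
  shows "l2norm M g \<le> l2norm M f"
  unfolding l2norm_def using assms L2_bound[OF assms]
  by (intro real_sqrt_le_mono integral_mono) (auto intro: L2_integrable power_mono)

lemma borel_measurable_cnj [measurable]:
  assumes [measurable]: "f \<in> borel_measurable M"
  shows "(\<lambda>x. cnj (f x)) \<in> borel_measurable M"
  by (rule borel_measurable_continuous_onI[THEN measurable_compose[OF assms]]) (intro continuous_intros)

lemma L2_mult_integrable:
  assumes [measurable]: "f \<in> L2 M" "g \<in> L2 M"
  shows "integrable M (\<lambda>x. f x * cnj (g x))"
proof (rule Bochner_Integration.integrable_bound[of _ "\<lambda>x. (cmod (f x))\<^sup>2 + (cmod (g x))\<^sup>2"])
  show "AE x in M. norm (f x * cnj (g x)) \<le> norm ((cmod (f x))\<^sup>2 + (cmod (g x))\<^sup>2)"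
  proof (rule AE_I2)
    fix x
    have "2 * (cmod (f x) * cmod (g x)) \<le> (cmod (f x))\<^sup>2 + (cmod (g x))\<^sup>2"
      using sum_squares_bound[of "cmod (f x)" "cmod (g x)"] by (simp add: mult.assoc)
    moreover have "0 \<le> cmod (f x) * cmod (g x)" by simp
    ultimately show "norm (f x * cnj (g x)) \<le> norm ((cmod (f x))\<^sup>2 + (cmod (g x))\<^sup>2)"
      unfolding norm_mult complex_mod_cnj real_norm_def by linarith
  qed
qed (auto intro!: L2_integrable assms)

lemma inner2_cmult_left: "inner2 M (\<lambda>x. c * f x) h = c * inner2 M f h"
  by (simp add: inner2_def mult.assoc)

lemma inner2_cnj: "cnj (inner2 M f g) = inner2 M g f"
proof -
  have "cnj (inner2 M f g) = (\<integral>x. cnj (f x * cnj (g x)) \<partial>M)"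
    unfolding inner2_def by (rule Bochner_Integration.integral_cnj[symmetric])
  also have "\<dots> = inner2 M g f"
    by (simp add: inner2_def mult.commute)
  finally show ?thesis .
qed

lemma inner2_diff_left:
  assumes "f \<in> L2 M" "g \<in> L2 M" "h \<in> L2 M"
  shows "inner2 M (\<lambda>x. f x - g x) h = inner2 M f h - inner2 M g h"
  using assms by (simp add: inner2_def ring_distribs L2_mult_integrable)

lemma inner2_diff_right:
  assumes "f \<in> L2 M" "g \<in> L2 M" "h \<in> L2 M"
  shows "inner2 M h (\<lambda>x. f x - g x) = inner2 M h f - inner2 M h g"
  using assms by (simp add: inner2_def ring_distribs L2_mult_integrable)

lemma inner2_sum_left:
  assumes "\<And>i. i \<in> I \<Longrightarrow> f i \<in> L2 M" "h \<in> L2 M"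
  shows "inner2 M (\<lambda>x. \<Sum>i\<in>I. f i x) h = (\<Sum>i\<in>I. inner2 M (f i) h)"
  using assms by (simp add: inner2_def sum_distrib_right L2_mult_integrable)

lemma inner2_self: "inner2 M f f = of_real ((l2norm M f)\<^sup>2)"
proof -
  have "inner2 M f f = (\<integral>x. of_real ((cmod (f x))\<^sup>2) \<partial>M)"
    unfolding inner2_def by (simp add: complex_norm_square[symmetric])
  then show ?thesis
    unfolding l2norm_power2 by (metis integral_complex_of_real)
qed

lemma l2norm_eq_1:
  assumes "inner2 M f f = 1"
  shows "l2norm M f = 1"
proof -
  have "(l2norm M f)\<^sup>2 = 1"
    using assms by (simp only: inner2_self of_real_eq_1_iff)
  then show ?thesis
    by (metis l2norm_nonneg power2_eq_1_iff le_minus_one_simps(3))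
qed

lemma l2norm_diff_power2:
  assumes "f \<in> L2 M" "g \<in> L2 M"
  shows "(l2norm M (\<lambda>x. f x - g x))\<^sup>2 = (l2norm M f)\<^sup>2 + (l2norm M g)\<^sup>2 - 2 * Re (inner2 M f g)"
proof -
  have "complex_of_real ((l2norm M (\<lambda>x. f x - g x))\<^sup>2)
    = inner2 M f f + inner2 M g g - (inner2 M f g + cnj (inner2 M f g))"
    using assms unfolding inner2_self[symmetric] inner2_cnj
    by (simp add: inner2_diff_left inner2_diff_right L2_diff)
  from arg_cong[OF this, of Re] show ?thesis
    by (simp add: inner2_self)
qed

lemma cauchy_schwarz_L2:
  assumes "f \<in> L2 M" "g \<in> L2 M"
  shows "cmod (inner2 M f g) \<le> l2norm M f * l2norm M g"
proof -
  define w where "w = inner2 M f g"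
  \<comment> \<open>The multiplier carries the phase of \<open>w\<close>, which makes the cross term
    \<open>t * (cmod w)\<^sup>2\<close> real; only a real parameter is left to choose.\<close>
  have quad: "2 * t * (cmod w)\<^sup>2 \<le> (l2norm M f)\<^sup>2 + t\<^sup>2 * (cmod w)\<^sup>2 * (l2norm M g)\<^sup>2" for t :: real
  proof -
    have "0 \<le> (l2norm M (\<lambda>x. f x - (of_real t * w) * g x))\<^sup>2" by simp
    also have "\<dots> = (l2norm M f)\<^sup>2 + (l2norm M (\<lambda>x. (of_real t * w) * g x))\<^sup>2
       - 2 * Re (inner2 M f (\<lambda>x. (of_real t * w) * g x))"
      by (intro l2norm_diff_power2 assms L2_cmult)
    also have "inner2 M f (\<lambda>x. (of_real t * w) * g x) = cnj (of_real t * w) * w"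
      by (subst inner2_cnj[symmetric], subst inner2_cmult_left) (simp add: inner2_cnj w_def)
    also have "\<dots> = of_real (t * (cmod w)\<^sup>2)"
      by (simp add: complex_norm_square mult.commute del: of_real_power)
    also have "(l2norm M (\<lambda>x. (of_real t * w) * g x))\<^sup>2 = t\<^sup>2 * (cmod w)\<^sup>2 * (l2norm M g)\<^sup>2"
      by (simp add: l2norm_power2 norm_mult power_mult_distrib)
    finally show ?thesis by simp
  qed
  have "(cmod w)\<^sup>2 \<le> (l2norm M f)\<^sup>2 * (l2norm M g)\<^sup>2"
  proof (cases "l2norm M g = 0")
    case True
    show ?thesis
    proof (cases "w = 0")
      case False
      \<comment> \<open>For null \<open>g\<close> the quadratic term drops out, and this
        \<open>t\<close> makes the left side exceed the right by exactly 1.\<close>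
      have "2 * (((l2norm M f)\<^sup>2 + 1) / (2 * (cmod w)\<^sup>2)) * (cmod w)\<^sup>2 \<le> (l2norm M f)\<^sup>2"
        using quad[of "((l2norm M f)\<^sup>2 + 1) / (2 * (cmod w)\<^sup>2)"] True by simp
      then have False using False by simp
      then show ?thesis ..
    qed simp
  next
    case False
    define G where "G = (l2norm M g)\<^sup>2"
    have G: "G > 0" using False by (simp add: G_def)
    have "2 * (1 / G) * (cmod w)\<^sup>2 \<le> (l2norm M f)\<^sup>2 + (1 / G)\<^sup>2 * (cmod w)\<^sup>2 * G"
      using quad[of "1 / G"] unfolding G_def .
    then have "(cmod w)\<^sup>2 / G \<le> (l2norm M f)\<^sup>2"
      using G by (simp add: power2_eq_square)
    then show ?thesis using G by (simp add: G_def[symmetric] field_simps)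
  qed
  then have "(cmod w)\<^sup>2 \<le> (l2norm M f * l2norm M g)\<^sup>2"
    by (simp add: power_mult_distrib)
  then show ?thesis
    unfolding w_def by (rule power2_le_imp_le) simp
qed

lemma l2norm_minus [simp]: "l2norm M (\<lambda>x. - f x) = l2norm M f"
  by (simp add: l2norm_def)

lemma l2norm_minus_commute: "l2norm M (\<lambda>x. f x - g x) = l2norm M (\<lambda>x. g x - f x)"
  by (simp add: l2norm_def norm_minus_commute)

lemma l2norm_cmult: "l2norm M (\<lambda>x. c * f x) = cmod c * l2norm M f"
  by (simp add: l2norm_def norm_mult power_mult_distrib real_sqrt_mult)

lemma l2norm_triangle_diff:
  assumes "f \<in> L2 M" "g \<in> L2 M"
  shows "l2norm M (\<lambda>x. f x - g x) \<le> l2norm M f + l2norm M g"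
proof (rule power2_le_imp_le)
  have "- Re (inner2 M f g) \<le> l2norm M f * l2norm M g"
    using cauchy_schwarz_L2[OF assms] abs_Re_le_cmod[of "inner2 M f g"] by linarith
  then show "(l2norm M (\<lambda>x. f x - g x))\<^sup>2 \<le> (l2norm M f + l2norm M g)\<^sup>2"
    by (simp add: l2norm_diff_power2[OF assms] power2_sum)
qed simp

lemma l2norm_triangle_add:
  assumes "f \<in> L2 M" "g \<in> L2 M"
  shows "l2norm M (\<lambda>x. f x + g x) \<le> l2norm M f + l2norm M g"
  using l2norm_triangle_diff[OF assms(1) L2_cmult[OF assms(2), of "-1"]] by simp

lemma l2norm_dist_triangle:
  assumes "f \<in> L2 M" "g \<in> L2 M" "h \<in> L2 M"
  shows "l2norm M (\<lambda>x. f x - h x) \<le> l2norm M (\<lambda>x. f x - g x) + l2norm M (\<lambda>x. g x - h x)"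
  using l2norm_triangle_add[OF L2_diff[OF assms(1,2)] L2_diff[OF assms(2,3)]] by simp

lemma l2norm_diff_ge:
  assumes "f \<in> L2 M" "g \<in> L2 M"
  shows "\<bar>l2norm M f - l2norm M g\<bar> \<le> l2norm M (\<lambda>x. f x - g x)"
  using l2norm_triangle_add[OF L2_diff[OF assms] assms(2)]
    l2norm_triangle_add[OF L2_diff[OF assms(2,1)] assms(1)]
    l2norm_minus_commute[of M f g] by simp

lemma tendsto_l2norm:
  assumes "\<And>k. \<phi> k \<in> L2 M" "f \<in> L2 M" "(\<lambda>k. l2norm M (\<lambda>x. \<phi> k x - f x)) \<longlonglongrightarrow> 0"
  shows "(\<lambda>k. l2norm M (\<phi> k)) \<longlonglongrightarrow> l2norm M f"
proof (rule LIM_zero_cancel)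
  show "(\<lambda>k. l2norm M (\<phi> k) - l2norm M f) \<longlonglongrightarrow> 0"
    by (rule Lim_null_comparison[OF always_eventually[OF allI] assms(3)])
       (use l2norm_diff_ge[OF assms(1,2)] in simp)
qed

lemma tendsto_inner2:
  assumes "\<And>k. \<phi> k \<in> L2 M" "f \<in> L2 M" "(\<lambda>k. l2norm M (\<lambda>x. \<phi> k x - f x)) \<longlonglongrightarrow> 0"
    and "\<And>k. \<psi> k \<in> L2 M" "g \<in> L2 M" "(\<lambda>k. l2norm M (\<lambda>x. \<psi> k x - g x)) \<longlonglongrightarrow> 0"
  shows "(\<lambda>k. inner2 M (\<phi> k) (\<psi> k)) \<longlonglongrightarrow> inner2 M f g"
proof -
  have bound: "cmod (inner2 M (\<phi> k) (\<psi> k) - inner2 M f g)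
    \<le> l2norm M (\<lambda>x. \<phi> k x - f x) * l2norm M (\<psi> k) + l2norm M f * l2norm M (\<lambda>x. \<psi> k x - g x)" for k
  proof -
    have "inner2 M (\<phi> k) (\<psi> k) - inner2 M f g
      = inner2 M (\<lambda>x. \<phi> k x - f x) (\<psi> k) + inner2 M f (\<lambda>x. \<psi> k x - g x)"
      unfolding inner2_diff_left[OF assms(1,2,4)] inner2_diff_right[OF assms(4,5,2)] by simp
    also have "cmod \<dots> \<le> cmod (inner2 M (\<lambda>x. \<phi> k x - f x) (\<psi> k)) + cmod (inner2 M f (\<lambda>x. \<psi> k x - g x))"
      by (rule norm_triangle_ineq)
    finally show ?thesis
      using cauchy_schwarz_L2[OF L2_diff[OF assms(1)[of k] assms(2)] assms(4)[of k]]
        cauchy_schwarz_L2[OF assms(2) L2_diff[OF assms(4)[of k] assms(5)]] by linarith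
  qed
  have "(\<lambda>k. l2norm M (\<lambda>x. \<phi> k x - f x) * l2norm M (\<psi> k) + l2norm M f * l2norm M (\<lambda>x. \<psi> k x - g x))
     \<longlonglongrightarrow> 0 * l2norm M g + l2norm M f * 0"
    by (intro tendsto_add tendsto_mult tendsto_const tendsto_l2norm[OF assms(4-6)] assms(3,6))
  then have "(\<lambda>k. inner2 M (\<phi> k) (\<psi> k) - inner2 M f g) \<longlonglongrightarrow> 0"
    using Lim_null_comparison[OF always_eventually[OF allI, OF bound]] by simp
  then show ?thesis by (simp add: LIM_zero_iff)
qed

text \<open>The projection \<open>p\<close> satisfies <p, p> = <h, p> = the sum of the squared
  coefficients. The exact defect is kept because it yields both Bessel's inequality and, when the
  remainders tend to 0, Parseval's identity for a basis.\<close>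

lemma bessel_identity:
  assumes "finite F" "\<And>i. i \<in> F \<Longrightarrow> e i \<in> L2 M" "h \<in> L2 M"
    and on: "\<And>i j. i \<in> F \<Longrightarrow> j \<in> F \<Longrightarrow> inner2 M (e i) (e j) = (if i = j then 1 else 0)"
  shows "(l2norm M (\<lambda>x. h x - (\<Sum>i\<in>F. inner2 M h (e i) * e i x)))\<^sup>2
    = (l2norm M h)\<^sup>2 - (\<Sum>i\<in>F. (cmod (inner2 M h (e i)))\<^sup>2)"
proof -
  define p where "p = (\<lambda>x. \<Sum>i\<in>F. inner2 M h (e i) * e i x)"
  have p: "p \<in> L2 M"
    unfolding p_def using assms by (intro L2_sum L2_cmult)
  have left: "inner2 M p g = (\<Sum>i\<in>F. inner2 M h (e i) * inner2 M (e i) g)" if "g \<in> L2 M" for g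
  proof -
    have "inner2 M p g = (\<Sum>i\<in>F. inner2 M (\<lambda>x. inner2 M h (e i) * e i x) g)"
      unfolding p_def by (rule inner2_sum_left[OF L2_cmult[OF assms(2)] that])
    then show ?thesis by (simp only: inner2_cmult_left)
  qed
  have pe: "inner2 M p (e j) = inner2 M h (e j)" if "j \<in> F" for j
    using that assms by (simp add: left on if_distrib cong: if_cong)
  have ph: "inner2 M p h = of_real (\<Sum>i\<in>F. (cmod (inner2 M h (e i)))\<^sup>2)"
    using assms by (simp add: left complex_norm_square inner2_cnj del: of_real_power)
  have "inner2 M p p = (\<Sum>i\<in>F. inner2 M h (e i) * cnj (inner2 M p (e i)))"
    using left[OF p] by (simp add: inner2_cnj)
  also have "\<dots> = of_real (\<Sum>i\<in>F. (cmod (inner2 M h (e i)))\<^sup>2)"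
    by (simp add: pe complex_norm_square del: of_real_power)
  finally have pp: "(l2norm M p)\<^sup>2 = (\<Sum>i\<in>F. (cmod (inner2 M h (e i)))\<^sup>2)"
    unfolding inner2_self of_real_eq_iff .
  have "Re (inner2 M h p) = (\<Sum>i\<in>F. (cmod (inner2 M h (e i)))\<^sup>2)"
    using arg_cong[OF ph, of Re] arg_cong[OF inner2_cnj[of M p h], of Re] by simp
  then show ?thesis
    using l2norm_diff_power2[OF assms(3) p] pp unfolding p_def by simp
qed

lemma bessel_inequality:
  assumes "finite F" "\<And>i. i \<in> F \<Longrightarrow> e i \<in> L2 M" "h \<in> L2 M"
    and "\<And>i j. i \<in> F \<Longrightarrow> j \<in> F \<Longrightarrow> inner2 M (e i) (e j) = (if i = j then 1 else 0)"
  shows "(\<Sum>i\<in>F. (cmod (inner2 M h (e i)))\<^sup>2) \<le> (l2norm M h)\<^sup>2"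
  using bessel_identity[of F e M h, OF assms]
    zero_le_power2[of "l2norm M (\<lambda>x. h x - (\<Sum>i\<in>F. inner2 M h (e i) * e i x))"]
  by linarith

lemma orthonormal_basis_parseval:
  assumes "orthonormal_basis M f" "h \<in> L2 M"
  shows "(\<lambda>n. (cmod (inner2 M h (f n)))\<^sup>2) sums (l2norm M h)\<^sup>2"
proof -
  have f: "f n \<in> L2 M" and on: "inner2 M (f m) (f n) = (if m = n then 1 else 0)" for m n
    using assms by (auto simp: orthonormal_basis_def orthonormal_seq_def)
  define R where "R = (\<lambda>N. l2norm M (\<lambda>x. h x - (\<Sum>k<N. inner2 M h (f k) * f k x)))"
  have "(\<lambda>x. h x - (\<Sum>k<N. inner2 M h (f k) * f k x)) \<in> L2 M" for N
    by (intro L2_diff[OF assms(2)] L2_sum L2_cmult[OF f])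
  note eq = norm2_eq_l2norm[OF this]
  have "(\<lambda>N. norm2 M (\<lambda>x. h x - (\<Sum>k<N. inner2 M h (f k) * f k x))) \<longlonglongrightarrow> 0"
    using assms unfolding orthonormal_basis_def by blast
  then have "(\<lambda>N. ennreal (R N)) \<longlonglongrightarrow> ennreal 0"
    unfolding eq R_def by simp
  then have "R \<longlonglongrightarrow> 0"
    by (subst (asm) tendsto_ennreal_iff) (auto simp: R_def)
  then have "(\<lambda>N. (l2norm M h)\<^sup>2 - (R N)\<^sup>2) \<longlonglongrightarrow> (l2norm M h)\<^sup>2 - 0\<^sup>2"
    by (intro tendsto_intros)
  moreover have "(l2norm M h)\<^sup>2 - (R N)\<^sup>2 = (\<Sum>n<N. (cmod (inner2 M h (f n)))\<^sup>2)" for N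
    unfolding R_def using bessel_identity[of "{..<N}" f M h, OF _ f assms(2) on] by simp
  ultimately show ?thesis by (simp add: sums_def)
qed

section \<open>Completeness along geometrically convergent sequences\<close>

lemma geometric_steps_tail:
  fixes u :: "nat \<Rightarrow> 'b::real_normed_vector"
  assumes step: "\<And>k. norm (u (Suc k) - u k) \<le> c * (1/2) ^ k"
  shows "norm (u (m + n) - u m) \<le> 2 * c * (1/2) ^ m"
proof -
  \<comment> \<open>The final factor comes from the partial sum of the geometric series; without it
    the bound would not be inductive.\<close>
  have "norm (u (m + n) - u m) \<le> 2 * c * (1/2) ^ m * (1 - (1/2) ^ n)"
  proof (induction n)
    case (Suc n)
    have "norm (u (m + Suc n) - u m) \<le> norm (u (Suc (m + n)) - u (m + n)) + norm (u (m + n) - u m)"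
      using norm_triangle_ineq[of "u (Suc (m + n)) - u (m + n)" "u (m + n) - u m"] by simp
    also have "\<dots> \<le> c * (1/2) ^ (m + n) + 2 * c * (1/2) ^ m * (1 - (1/2) ^ n)"
      by (intro add_mono step Suc)
    also have "\<dots> = 2 * c * (1/2) ^ m * (1 - (1/2) ^ Suc n)"
      by (simp add: algebra_simps power_add)
    finally show ?case .
  qed simp
  moreover have "0 \<le> c"
    using order_trans[OF norm_ge_zero step[of 0]] by simp
  then have "2 * c * (1/2) ^ m * (1 - (1/2) ^ n) \<le> 2 * c * (1/2) ^ m * 1"
    by (intro mult_left_mono) auto
  ultimately show ?thesis by simp
qed

lemma geometric_steps_limit:
  fixes u :: "nat \<Rightarrow> 'b::banach"
  assumes step: "\<And>k. norm (u (Suc k) - u k) \<le> c * (1/2) ^ k"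
  shows "norm (lim u - u m) \<le> 2 * c * (1/2) ^ m"
proof -
  note tail = geometric_steps_tail[of u c, OF step]
  have c: "0 \<le> c"
    using order_trans[OF norm_ge_zero step[of 0]] by simp
  have lim0: "(\<lambda>m. 2 * c * (1/2) ^ m) \<longlonglongrightarrow> 2 * c * 0"
    by (intro tendsto_mult tendsto_const LIMSEQ_power_zero) simp
  have "Cauchy u"
  proof (rule CauchyI)
    fix e :: real assume "e > 0"
    then have "eventually (\<lambda>m. 2 * c * (1/2) ^ m < e / 2) sequentially"
      using order_tendstoD(2)[OF lim0, of "e / 2"] by simp
    then obtain M where M: "2 * c * (1/2) ^ M < e / 2"
      using eventually_sequentially by auto
    have near: "norm (u m - u M) < e / 2" if "m \<ge> M" for m
      using tail[of M "m - M"] M that by simp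
    have "norm (u m - u n) < e" if "m \<ge> M" "n \<ge> M" for m n
      using norm_triangle_ineq4[of "u m - u M" "u n - u M"] near[OF that(1)] near[OF that(2)] by simp
    then show "\<exists>M. \<forall>m\<ge>M. \<forall>n\<ge>M. norm (u m - u n) < e" by blast
  qed
  then have "u \<longlonglongrightarrow> lim u"
    using Cauchy_convergent convergent_LIMSEQ_iff by blast
  then have "(\<lambda>n. norm (u (m + n) - u m)) \<longlonglongrightarrow> norm (lim u - u m)"
    by (intro tendsto_intros LIMSEQ_ignore_initial_segment[of u _ m, unfolded add.commute[of _ m]])
  then show ?thesis
    by (rule LIMSEQ_le_const2) (use tail in auto)
qed

text \<open>Riesz-Fischer with an explicit rate. The series \<open>H\<close> of squared increments,
  weighted by 4^k, has finite integral because 4^k (B 4^(-k))^2 = B^2 4^(-k). Wherever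
  \<open>H\<close> is finite, the k-th increment is at most sqrt(H) 2^(-k), which gives a pointwise
  limit \<open>g\<close> with |u m - g|^2 \<le> 4 * 4^(-m) H. Integrating this one inequality proves
  convergence in norm.\<close>

lemma L2_complete_geometric:
  assumes u: "\<And>k. u k \<in> L2 M"
    and step: "\<And>k. l2norm M (\<lambda>x. u (Suc k) x - u k x) \<le> B * (1/4) ^ k"
  shows "\<exists>g\<in>L2 M. (\<lambda>k. l2norm M (\<lambda>x. u k x - g x)) \<longlonglongrightarrow> 0"
proof -
  have [measurable]: "u k \<in> borel_measurable M" for k
    using u by (rule L2_measurable)
  define H where "H = (\<lambda>x. \<Sum>k. ennreal (4 ^ k * (cmod (u (Suc k) x - u k x))\<^sup>2))"
  \<comment> \<open>Where the sequence diverges, \<open>lim\<close> has an unspecified value; this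
    can happen only on the null set where \<open>H\<close> is infinite.\<close>
  define g where "g = (\<lambda>x. lim (\<lambda>k. u k x))"
  have [measurable]: "H \<in> borel_measurable M" "g \<in> borel_measurable M"
    unfolding H_def g_def by measurable
  have "(\<integral>\<^sup>+x. H x \<partial>M) = (\<Sum>k. \<integral>\<^sup>+x. ennreal (4 ^ k * (cmod (u (Suc k) x - u k x))\<^sup>2) \<partial>M)"
    unfolding H_def by (intro nn_integral_suminf) measurable
  also have "\<dots> \<le> (\<Sum>k. ennreal (B\<^sup>2 * (1/4) ^ k))"
  proof (intro suminf_le summableI)
    fix k
    have "(\<integral>\<^sup>+x. ennreal (4 ^ k * (cmod (u (Suc k) x - u k x))\<^sup>2) \<partial>M)
      = ennreal (4 ^ k) * (\<integral>\<^sup>+x. ennreal ((cmod (u (Suc k) x - u k x))\<^sup>2) \<partial>M)"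
      by (simp add: ennreal_mult nn_integral_cmult del: ennreal_power)
    also have "\<dots> = ennreal (4 ^ k * (l2norm M (\<lambda>x. u (Suc k) x - u k x))\<^sup>2)"
      by (simp only: L2_nn_integral[OF L2_diff[OF u u]] ennreal_mult zero_le_power2 zero_le_power zero_le_numeral)
    also have "\<dots> \<le> ennreal (4 ^ k * (B * (1/4) ^ k)\<^sup>2)"
      by (intro ennreal_leI mult_left_mono power_mono step) auto
    also have "4 ^ k * (B * (1/4) ^ k)\<^sup>2 = B\<^sup>2 * (1/4) ^ k"
      by (simp add: power_mult_distrib power2_eq_square power_divide)
    finally show "(\<integral>\<^sup>+x. ennreal (4 ^ k * (cmod (u (Suc k) x - u k x))\<^sup>2) \<partial>M) \<le> ennreal (B\<^sup>2 * (1/4) ^ k)" .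
  qed
  also have "\<dots> = ennreal (\<Sum>k. B\<^sup>2 * (1/4) ^ k)"
    by (rule suminf_ennreal2) (auto intro!: summable_mult summable_geometric)
  finally have Hfin: "(\<integral>\<^sup>+x. H x \<partial>M) < \<infinity>"
    by (rule order_le_less_trans) simp
  then have "AE x in M. H x \<noteq> \<infinity>"
    by (intro nn_integral_PInf_AE) auto
  then have ae: "AE x in M. ennreal ((cmod (u m x - g x))\<^sup>2) \<le> ennreal (4 * (1/4) ^ m) * H x" for m
  proof eventually_elim
    fix x assume fin: "H x \<noteq> \<infinity>"
    define c where "c = enn2real (H x)"
    have c: "0 \<le> c" "H x = ennreal c"
      using fin by (auto simp: c_def less_top)
    have "norm (u (Suc k) x - u k x) \<le> sqrt c * (1/2) ^ k" for k
    proof (rule power2_le_imp_le)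
      have "ennreal (4 ^ k * (cmod (u (Suc k) x - u k x))\<^sup>2) \<le> H x"
        unfolding H_def
        using sum_le_suminf[OF summableI, of "{k}" "\<lambda>k. ennreal (4 ^ k * (cmod (u (Suc k) x - u k x))\<^sup>2)"]
        by (simp only: finite.intros sum.insert sum.empty zero_le add_0_right empty_iff if_False not_False_eq_True simp_thms)
      then have "4 ^ k * (cmod (u (Suc k) x - u k x))\<^sup>2 \<le> c"
        using c by simp
      then have "(cmod (u (Suc k) x - u k x))\<^sup>2 \<le> c * (1/4) ^ k"
        by (simp add: power_divide field_simps)
      also have "(1/4) ^ k = ((1/2::real) ^ k)\<^sup>2"
        by (simp add: power2_eq_square flip: power_mult_distrib)
      finally show "(norm (u (Suc k) x - u k x))\<^sup>2 \<le> (sqrt c * (1/2) ^ k)\<^sup>2"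
        using c by (simp add: power_mult_distrib)
    qed (use c in simp)
    from geometric_steps_limit[of "\<lambda>k. u k x", OF this, of m]
    have "(cmod (u m x - g x))\<^sup>2 \<le> (2 * sqrt c * (1/2) ^ m)\<^sup>2"
      unfolding g_def by (intro power_mono) (auto simp: norm_minus_commute)
    also have "\<dots> = 4 * ((1/2) ^ m)\<^sup>2 * c"
      using c by (simp add: power_mult_distrib)
    also have "((1/2::real) ^ m)\<^sup>2 = (1/4) ^ m"
      by (simp add: power2_eq_square flip: power_mult_distrib)
    finally show "ennreal ((cmod (u m x - g x))\<^sup>2) \<le> ennreal (4 * (1/4) ^ m) * H x"
      using c by (simp add: ennreal_mult[symmetric] ennreal_leI)
  qed
  obtain h where h: "0 \<le> h" "(\<integral>\<^sup>+x. H x \<partial>M) = ennreal h"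
    using Hfin by (cases "\<integral>\<^sup>+x. H x \<partial>M") auto
  have bound: "(\<integral>\<^sup>+x. ennreal ((cmod (u m x - g x))\<^sup>2) \<partial>M) \<le> ennreal (4 * (1/4) ^ m * h)" for m
  proof -
    have "(\<integral>\<^sup>+x. ennreal ((cmod (u m x - g x))\<^sup>2) \<partial>M) \<le> (\<integral>\<^sup>+x. ennreal (4 * (1/4) ^ m) * H x \<partial>M)"
      by (rule nn_integral_mono_AE[OF ae])
    also have "\<dots> = ennreal (4 * (1/4) ^ m * h)"
      using h by (simp add: nn_integral_cmult ennreal_mult)
    finally show ?thesis .
  qed
  have diff: "(\<lambda>x. u m x - g x) \<in> L2 M" for m
    by (subst L2_iff_nn_integral) (auto intro: order_le_less_trans[OF bound])
  have "g \<in> L2 M"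
    using L2_diff[OF u[of 0] diff[of 0]] by simp
  moreover have "(\<lambda>k. l2norm M (\<lambda>x. u k x - g x)) \<longlonglongrightarrow> 0"
  proof (rule Lim_null_comparison[OF always_eventually[OF allI]])
    fix k
    have "(l2norm M (\<lambda>x. u k x - g x))\<^sup>2 \<le> 4 * (1/4) ^ k * h"
      using bound[of k] h L2_nn_integral[OF diff[of k]] by simp
    then have "l2norm M (\<lambda>x. u k x - g x) \<le> sqrt (4 * (1/4) ^ k * h)"
      by (rule real_le_rsqrt)
    then show "norm (l2norm M (\<lambda>x. u k x - g x)) \<le> sqrt (4 * (1/4) ^ k * h)" by simp
    have "(\<lambda>k. sqrt (4 * (1/4) ^ k * h)) \<longlonglongrightarrow> sqrt (4 * 0 * h)"
      by (intro tendsto_real_sqrt tendsto_mult tendsto_const LIMSEQ_power_zero) simp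
    then show "(\<lambda>k. sqrt (4 * (1/4) ^ k * h)) \<longlonglongrightarrow> 0" by simp
  qed
  ultimately show ?thesis by blast
qed

section \<open>Smooth functions of bounded support\<close>

text \<open>The classical smooth cutoff exp(-1/t) with two parameters. The power of t makes the
  family closed under differentiation up to linear combinations; letting \<open>c\<close> tend to 0
  with \<open>n = 0\<close> approximates the indicator of the positive reals.\<close>

definition flat_exp :: "real \<Rightarrow> nat \<Rightarrow> real \<Rightarrow> real" where
  "flat_exp c n t = (if t > 0 then exp (- c / t) / t ^ n else 0)"

text \<open>A single term of the exponential series, (c/t)^(n+1) / (n+1)!, bounds exp(c/t) from
  below. The spare power leaves a factor |t|, which is what differentiability at 0 needs.\<close>

lemma flat_exp_bound:
  assumes "c > 0"
  shows "\<bar>flat_exp c n t\<bar> \<le> fact (Suc n) / c ^ Suc n * \<bar>t\<bar>"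
proof (cases "t > 0")
  case True
  have "(c / t) ^ Suc n / fact (Suc n) \<le> exp (c / t)"
  proof -
    have "(\<Sum>k\<in>{Suc n}. (c / t) ^ k /\<^sub>R fact k) \<le> (\<Sum>k. (c / t) ^ k /\<^sub>R fact k)"
      using assms True by (intro sum_le_suminf summable_exp_generic) auto
    then show ?thesis by (simp add: exp_def divide_inverse mult.commute)
  qed
  then have "exp (- (c / t)) \<le> fact (Suc n) / (c / t) ^ Suc n"
    using assms True unfolding exp_minus by (simp add: field_simps del: fact_Suc power_Suc)
  then have "exp (- c / t) / t ^ n \<le> fact (Suc n) / (c / t) ^ Suc n / t ^ n"
    using True by (intro divide_right_mono) auto
  also have "\<dots> = fact (Suc n) / c ^ Suc n * t"
    using True assms by (simp add: field_simps del: fact_Suc)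
  finally show ?thesis using True by (simp add: flat_exp_def del: fact_Suc)
next
  case False
  have "0 \<le> fact (Suc n) / c ^ Suc n * \<bar>t\<bar>"
    using assms by (intro mult_nonneg_nonneg divide_nonneg_nonneg) auto
  with False show ?thesis by (simp only: flat_exp_def if_False abs_zero)
qed

lemma has_real_derivative_flat_exp:
  assumes c: "c > 0"
  shows "(flat_exp c n has_real_derivative
    c * flat_exp c (n + 2) t - real n * flat_exp c (n + 1) t) (at t)"
proof -
  consider "t > 0" | "t < 0" | "t = 0" by linarith
  then show ?thesis
  proof cases
    case 1
    have "((\<lambda>t. exp (- c / t) * inverse t ^ n) has_real_derivative
      c * flat_exp c (n + 2) t - real n * flat_exp c (n + 1) t) (at t)"
    proof (cases n)
      case 0
      then show ?thesis using 1
        by (auto intro!: derivative_eq_intros simp: flat_exp_def power2_eq_square)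
    next
      case (Suc m)
      have "((\<lambda>t. exp (- c / t)) has_real_derivative exp (- c / t) * (c / t\<^sup>2)) (at t)"
        using 1 by (auto intro!: derivative_eq_intros simp: power2_eq_square)
      moreover have "t \<noteq> 0" using 1 by simp
      ultimately have "((\<lambda>t. exp (- c / t) * inverse t ^ Suc m) has_real_derivative
        exp (- c / t) * (c / t\<^sup>2) * inverse t ^ Suc m
        + (1 + real m) * (- (inverse t ^ Suc (Suc 0)) * inverse t ^ m) * exp (- c / t)) (at t)"
        by (intro DERIV_mult DERIV_power_Suc DERIV_inverse)
      then show ?thesis
        unfolding Suc by (rule DERIV_cong) (use 1 Suc in \<open>auto simp: flat_exp_def field_simps power2_eq_square\<close>)
    qed
    then show ?thesis
      by (rule has_field_derivative_transform_within_open[of _ _ _ "{0<..}"])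
         (use 1 in \<open>auto simp: flat_exp_def field_simps\<close>)
  next
    case 2
    have "((\<lambda>t. 0) has_real_derivative 0) (at t)" by simp
    then have "(flat_exp c n has_real_derivative 0) (at t)"
      by (rule has_field_derivative_transform_within_open[of _ _ _ "{..<0}"])
         (use 2 in \<open>auto simp: flat_exp_def\<close>)
    then show ?thesis using 2 by (simp add: flat_exp_def)
  next
    case 3
    \<comment> \<open>Dividing by \<open>h\<close> raises the index by one and stays within the
      family, so the linear bound applies to the difference quotient itself.\<close>
    have quot: "\<bar>(flat_exp c n h - flat_exp c n 0) / h\<bar> \<le> fact (Suc (Suc n)) / c ^ Suc (Suc n) * \<bar>h\<bar>" for h
    proof -
      have "(flat_exp c n h - flat_exp c n 0) / h = flat_exp c (Suc n) h"
        by (simp add: flat_exp_def)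
      then show ?thesis using flat_exp_bound[OF c, of "Suc n" h] by simp
    qed
    have "((\<lambda>h. fact (Suc (Suc n)) / c ^ Suc (Suc n) * \<bar>h\<bar>) \<longlongrightarrow> fact (Suc (Suc n)) / c ^ Suc (Suc n) * \<bar>0\<bar>) (at (0::real))"
      by (intro tendsto_intros)
    then have "((\<lambda>h. fact (Suc (Suc n)) / c ^ Suc (Suc n) * \<bar>h\<bar>) \<longlongrightarrow> 0) (at (0::real))"
      by simp
    then have "((\<lambda>h. (flat_exp c n h - flat_exp c n 0) / h) \<longlongrightarrow> 0) (at 0)"
      by (rule Lim_null_comparison[OF always_eventually[OF allI], rotated])
         (use quot in \<open>simp only: real_norm_def\<close>)
    then have "(flat_exp c n has_real_derivative 0) (at 0)"
      unfolding has_field_derivative_iff by simp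
    then show ?thesis using 3 by (simp add: flat_exp_def)
  qed
qed

text \<open>A syntactic class closed under directional derivatives: one differentiation lemma,
  proved by induction on the formation of the function, then covers the iterated partials of all
  orders. Ridge functions suffice because products of them cut out boxes.\<close>

inductive flat_fun :: "('a::euclidean_space \<Rightarrow> complex) \<Rightarrow> bool" where
  const: "flat_fun (\<lambda>x. k)"
| ridge: "c > 0 \<Longrightarrow> flat_fun (\<lambda>x. of_real (flat_exp c n (x \<bullet> v + l)))"
| add: "flat_fun f \<Longrightarrow> flat_fun g \<Longrightarrow> flat_fun (\<lambda>x. f x + g x)"
| mult: "flat_fun f \<Longrightarrow> flat_fun g \<Longrightarrow> flat_fun (\<lambda>x. f x * g x)"

lemma flat_fun_prod: "(\<And>i. i \<in> I \<Longrightarrow> flat_fun (f i)) \<Longrightarrow> flat_fun (\<lambda>x. \<Prod>i\<in>I. f i x)"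
  by (induction I rule: infinite_finite_induct) (auto intro: flat_fun.intros)

lemma flat_fun_derivative:
  assumes "flat_fun f"
  shows "\<exists>f'. (\<forall>x. (f has_derivative f' x) (at x)) \<and> (\<forall>b. flat_fun (\<lambda>x. f' x b))"
  using assms
proof induction
  case (const k)
  then show ?case
    by (intro exI[of _ "\<lambda>x b. 0"]) (auto intro: flat_fun.const)
next
  case (ridge c n v l)
  define D where "D = (\<lambda>x b. complex_of_real ((c * flat_exp c (n + 2) (x \<bullet> v + l) - real n * flat_exp c (n + 1) (x \<bullet> v + l)) * (b \<bullet> v)))"
  have "((\<lambda>x. complex_of_real (flat_exp c n (x \<bullet> v + l))) has_derivative D x) (at x)" for x
  proof -
    have "((\<lambda>x. x \<bullet> v + l) has_derivative (\<lambda>b. b \<bullet> v)) (at x)"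
      by (auto intro!: derivative_eq_intros)
    from has_derivative_compose[OF this has_field_derivative_imp_has_derivative[OF has_real_derivative_flat_exp[OF ridge]]]
    have "((\<lambda>x. flat_exp c n (x \<bullet> v + l)) has_derivative
      (\<lambda>b. (c * flat_exp c (n + 2) (x \<bullet> v + l) - real n * flat_exp c (n + 1) (x \<bullet> v + l)) * (b \<bullet> v))) (at x)" .
    then show ?thesis unfolding D_def by (rule has_derivative_of_real)
  qed
  moreover have "flat_fun (\<lambda>x. D x b)" for b
  proof -
    have "(\<lambda>x. D x b) = (\<lambda>x. (of_real c * of_real (flat_exp c (n + 2) (x \<bullet> v + l))
      + - of_nat n * of_real (flat_exp c (n + 1) (x \<bullet> v + l))) * of_real (b \<bullet> v))"
      by (simp add: D_def)
    then show ?thesis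
      by (simp only:) (intro flat_fun.intros ridge)
  qed
  ultimately show ?case by blast
next
  case (add f g)
  then obtain f' g' where *: "\<And>x. (f has_derivative f' x) (at x)" "\<And>b. flat_fun (\<lambda>x. f' x b)"
    "\<And>x. (g has_derivative g' x) (at x)" "\<And>b. flat_fun (\<lambda>x. g' x b)"
    by metis
  show ?case
    by (intro exI[of _ "\<lambda>x b. f' x b + g' x b"] conjI allI has_derivative_add flat_fun.add *)
next
  case (mult f g)
  then obtain f' g' where *: "\<And>x. (f has_derivative f' x) (at x)" "\<And>b. flat_fun (\<lambda>x. f' x b)"
    "\<And>x. (g has_derivative g' x) (at x)" "\<And>b. flat_fun (\<lambda>x. g' x b)"
    by metis
  show ?case
    by (intro exI[of _ "\<lambda>x b. f x * g' x b + f' x b * g x"] conjI allI has_derivative_mult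
        flat_fun.add flat_fun.mult mult.hyps *)
qed

lemma flat_fun_differentiable: "flat_fun f \<Longrightarrow> f differentiable (at x)"
  using flat_fun_derivative differentiable_def by blast

lemma flat_fun_continuous: "flat_fun f \<Longrightarrow> continuous_on S f"
  by (intro continuous_at_imp_continuous_on ballI differentiable_imp_continuous_within flat_fun_differentiable)

lemma flat_fun_iterated_partial:
  "flat_fun f \<Longrightarrow> flat_fun (iterated_partial bs f)"
proof (induction bs)
  case (Cons b bs)
  from flat_fun_derivative[OF Cons.IH[OF Cons.prems]] obtain f'
    where f': "\<And>x. (iterated_partial bs f has_derivative f' x) (at x)" "\<And>b. flat_fun (\<lambda>x. f' x b)"
    by auto
  have "frechet_derivative (iterated_partial bs f) (at x) = f' x" for x
    by (rule frechet_derivative_at[OF f'(1), symmetric])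
  then show ?case using f'(2) by simp
qed simp

lemma iterated_partial_eq_0_outside:
  assumes "closed S" "\<And>x. x \<notin> S \<Longrightarrow> f x = 0" "x \<notin> S"
  shows "iterated_partial bs f x = 0"
  using assms(3)
proof (induction bs arbitrary: x)
  case (Cons b bs)
  have "((\<lambda>x. 0) has_derivative (\<lambda>x. 0)) (at x)" by simp
  then have "(iterated_partial bs f has_derivative (\<lambda>x. 0)) (at x)"
    by (rule has_derivative_transform_within_open[of _ _ _ _ "- S"]) (use assms Cons in auto)
  then show ?case
    by (simp add: frechet_derivative_at[symmetric])
qed (use assms in simp)

lemma flat_fun_schwartz:
  assumes "flat_fun f" "compact S" "\<And>x. x \<notin> S \<Longrightarrow> f x = 0"
  shows "schwartz f"
  unfolding schwartz_def
proof (intro ballI conjI allI)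
  fix bs :: "'a list" and k :: nat
  let ?g = "iterated_partial bs f"
  have g: "flat_fun ?g"
    by (rule flat_fun_iterated_partial[OF assms(1)])
  show "?g differentiable_on UNIV"
    using flat_fun_differentiable[OF g] by (simp add: differentiable_on_def)
  have "compact ((\<lambda>x. norm x ^ k *\<^sub>R ?g x) ` S)"
    by (intro compact_continuous_image continuous_intros flat_fun_continuous g assms)
  \<comment> \<open>All iterated partials vanish outside \<open>S\<close>, so the inserted 0
    accounts for the points there.\<close>
  then have "bounded (insert 0 ((\<lambda>x. norm x ^ k *\<^sub>R ?g x) ` S))"
    by (simp add: compact_imp_bounded)
  then show "bounded (range (\<lambda>x. norm x ^ k *\<^sub>R ?g x))"
  proof (rule bounded_subset, safe)
    fix x assume "norm x ^ k *\<^sub>R ?g x \<notin> (\<lambda>x. norm x ^ k *\<^sub>R ?g x) ` S"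
    then have "x \<notin> S" by blast
    then show "norm x ^ k *\<^sub>R ?g x = 0"
      using iterated_partial_eq_0_outside[OF compact_imp_closed[OF assms(2)] assms(3)] by simp
  qed
qed

text \<open>Two one-sided cutoffs per coordinate, one for each face. They vanish on the faces as
  well, so the limit is the indicator of the open box at every point, and no information on the
  measure of the boundary is called for.\<close>

definition box_approx :: "'a::euclidean_space \<Rightarrow> 'a \<Rightarrow> nat \<Rightarrow> 'a \<Rightarrow> complex" where
  "box_approx p q k x = (\<Prod>i\<in>Basis. of_real (flat_exp (1 / real (Suc k)) 0 (x \<bullet> i - p \<bullet> i))
     * of_real (flat_exp (1 / real (Suc k)) 0 (q \<bullet> i - x \<bullet> i)))"

lemma flat_fun_box_approx: "flat_fun (box_approx p q k)"
proof -
  have "flat_fun (\<lambda>x. \<Prod>i\<in>Basis. of_real (flat_exp (1 / real (Suc k)) 0 (x \<bullet> i + - (p \<bullet> i)))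
     * of_real (flat_exp (1 / real (Suc k)) 0 (x \<bullet> (- i) + q \<bullet> i)))"
    by (intro flat_fun_prod flat_fun.mult flat_fun.ridge) auto
  then show ?thesis
    by (simp add: box_approx_def[abs_def])
qed

lemma box_approx_outside: "x \<notin> box p q \<Longrightarrow> box_approx p q k x = 0"
  by (force simp: box_approx_def mem_box flat_exp_def)

lemma box_approx_le_1: "cmod (box_approx p q k x) \<le> 1"
  unfolding box_approx_def prod_norm[symmetric]
  by (rule prod_le_1) (auto simp: norm_mult flat_exp_def intro!: mult_le_one divide_nonneg_nonneg)

lemma box_approx_tendsto: "(\<lambda>k. box_approx p q k x) \<longlonglongrightarrow> indicator (box p q) x"
proof (cases "x \<in> box p q")
  case True
  have lim: "(\<lambda>k. flat_exp (1 / real (Suc k)) 0 t) \<longlonglongrightarrow> 1" if "t > 0" for t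
  proof -
    have "(\<lambda>k. exp (- (inverse (real (Suc k)) / t))) \<longlonglongrightarrow> exp (- (0 / t))"
      by (intro tendsto_intros LIMSEQ_inverse_real_of_nat) (use that in auto)
    then show ?thesis using that by (simp add: flat_exp_def inverse_eq_divide)
  qed
  have "(\<lambda>k. box_approx p q k x) \<longlonglongrightarrow> (\<Prod>i\<in>(Basis::'a set). of_real 1 * of_real 1)"
    unfolding box_approx_def
    by (intro tendsto_prod tendsto_mult tendsto_of_real lim) (use True in \<open>auto simp: mem_box\<close>)
  then show ?thesis using True by simp
next
  case False
  then show ?thesis by (simp add: box_approx_outside)
qed

section \<open>Density of the Schwartz functions\<close>

lemma L2_dominated_convergence:
  assumes [measurable]: "\<And>k. s k \<in> borel_measurable M" "f \<in> borel_measurable M" and w: "w \<in> L2 M"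
    and dom: "\<And>k x. x \<in> space M \<Longrightarrow> cmod (s k x) \<le> cmod (w x)"
    and lim: "\<And>x. x \<in> space M \<Longrightarrow> (\<lambda>k. s k x) \<longlonglongrightarrow> f x"
  shows "f \<in> L2 M" "\<And>k. s k \<in> L2 M" "(\<lambda>k. l2norm M (\<lambda>x. s k x - f x)) \<longlonglongrightarrow> 0"
proof -
  have fw: "cmod (f x) \<le> cmod (w x)" if "x \<in> space M" for x
    by (rule LIMSEQ_le_const2[OF tendsto_norm[OF lim[OF that]]]) (use dom that in blast)
  show "f \<in> L2 M"
    by (rule L2_bound[OF w]) (use fw in auto)
  show "s k \<in> L2 M" for k
    by (rule L2_bound[OF w]) (use dom in auto)
  have [measurable]: "w \<in> borel_measurable M"
    using w by (rule L2_measurable)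
  have "(\<lambda>k. \<integral>x. (cmod (s k x - f x))\<^sup>2 \<partial>M) \<longlonglongrightarrow> (\<integral>x. 0 \<partial>M)"
  proof (rule integral_dominated_convergence[where w = "\<lambda>x. 4 * (cmod (w x))\<^sup>2"])
    show "integrable M (\<lambda>x. 4 * (cmod (w x))\<^sup>2)"
      using L2_integrable[OF w] by simp
    show "AE x in M. (\<lambda>k. (cmod (s k x - f x))\<^sup>2) \<longlonglongrightarrow> 0"
    proof (rule AE_I2)
      fix x assume "x \<in> space M"
      then have "(\<lambda>k. (cmod (s k x - f x))\<^sup>2) \<longlonglongrightarrow> (cmod (f x - f x))\<^sup>2"
        by (intro tendsto_intros lim)
      then show "(\<lambda>k. (cmod (s k x - f x))\<^sup>2) \<longlonglongrightarrow> 0" by simp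
    qed
    show "AE x in M. norm ((cmod (s k x - f x))\<^sup>2) \<le> 4 * (cmod (w x))\<^sup>2" for k
    proof (rule AE_I2)
      fix x assume x: "x \<in> space M"
      have "cmod (s k x - f x) \<le> 2 * cmod (w x)"
        using norm_triangle_ineq4[of "s k x" "f x"] dom[OF x, of k] fw[OF x] by linarith
      then have "(cmod (s k x - f x))\<^sup>2 \<le> (2 * cmod (w x))\<^sup>2"
        by (intro power_mono) auto
      then show "norm ((cmod (s k x - f x))\<^sup>2) \<le> 4 * (cmod (w x))\<^sup>2"
        by (simp add: power_mult_distrib)
    qed
  qed auto
  then have "(\<lambda>k. sqrt (\<integral>x. (cmod (s k x - f x))\<^sup>2 \<partial>M)) \<longlonglongrightarrow> sqrt 0"
    by (intro tendsto_real_sqrt) simp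
  then show "(\<lambda>k. l2norm M (\<lambda>x. s k x - f x)) \<longlonglongrightarrow> 0"
    by (simp add: l2norm_def)
qed

text \<open>Density holds for any measure on a trace of the Borel sets that is finite on balls. The
  cone measure becomes an instance once the polar formula has bounded its balls.\<close>

locale locally_finite_trace =
  fixes \<Omega> :: "'a::euclidean_space set" and \<mu> :: "'a measure"
  assumes space_trace: "space \<mu> = \<Omega>"
    and sets_trace: "sets \<mu> = sets (restrict_space borel \<Omega>)"
    and finite_ball: "\<And>r. emeasure \<mu> (\<Omega> \<inter> ball 0 r) < \<infinity>"
begin

lemma trace_measurable: "f \<in> borel_measurable borel \<Longrightarrow> f \<in> borel_measurable \<mu>"
  using measurable_restrict_space1 measurable_cong_sets[OF sets_trace refl] by blast

lemma trace_sets: "B \<in> sets borel \<Longrightarrow> \<Omega> \<inter> B \<in> sets \<mu>"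
  by (auto simp: sets_trace sets_restrict_space)

lemma trace_setsE:
  assumes "A \<in> sets \<mu>" obtains B where "B \<in> sets borel" "A = \<Omega> \<inter> B"
  using assms by (auto simp: sets_trace sets_restrict_space)

lemma bounded_indicator_L2:
  assumes "bounded S" "S \<in> sets borel"
  shows "indicator S \<in> L2 \<mu>"
proof -
  have [measurable]: "(indicator S :: 'a \<Rightarrow> complex) \<in> borel_measurable \<mu>"
    using assms by (intro trace_measurable) auto
  obtain r where r: "S \<subseteq> ball 0 r"
    using assms(1) bounded_subset_ballD by blast
  have "(\<integral>\<^sup>+x. ennreal ((cmod (indicator S x))\<^sup>2) \<partial>\<mu>) \<le> (\<integral>\<^sup>+x. indicator (\<Omega> \<inter> ball 0 r) x \<partial>\<mu>)"
    using r by (intro nn_integral_mono) (auto simp: space_trace split: split_indicator)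
  also have "\<dots> = emeasure \<mu> (\<Omega> \<inter> ball 0 r)"
    using trace_sets by simp
  finally show ?thesis
    using finite_ball by (subst L2_iff_nn_integral) (auto intro: order_le_less_trans)
qed

lemma flat_fun_L2:
  assumes "flat_fun \<phi>" "bounded S" "\<And>x. x \<notin> S \<Longrightarrow> \<phi> x = 0"
  shows "\<phi> \<in> L2 \<mu>"
proof -
  have "compact (\<phi> ` closure S)"
    by (intro compact_continuous_image flat_fun_continuous assms(1)) (use assms(2) in simp)
  then have "bounded (\<phi> ` closure S)"
    by (rule compact_imp_bounded)
  then obtain b where b: "\<And>x. x \<in> closure S \<Longrightarrow> cmod (\<phi> x) \<le> b"
    unfolding bounded_iff by blast
  have bound: "cmod (\<phi> x) \<le> cmod (of_real b * indicator (closure S) x)" for x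
  proof (cases "x \<in> closure S")
    case False
    then have "x \<notin> S" using closure_subset by blast
    then show ?thesis using assms(3) by simp
  qed (use b in force)
  show ?thesis
  proof (rule L2_bound)
    show "(\<lambda>x. of_real b * indicator (closure S) x) \<in> L2 \<mu>"
      using assms by (intro L2_cmult bounded_indicator_L2) auto
    show "\<phi> \<in> borel_measurable \<mu>"
      by (intro trace_measurable borel_measurable_continuous_onI flat_fun_continuous assms)
  qed (use bound in blast)
qed

text \<open>Plain density would not require the approximants to vanish outside \<open>U\<close>. The
  condition is what later lets one square-integrable piece of the kernel act on all approximants of
  a localised function.\<close>

definition approximable :: "'a set \<Rightarrow> ('a \<Rightarrow> complex) \<Rightarrow> bool" where
  "approximable U f \<longleftrightarrow> f \<in> L2 \<mu> \<and>
     (\<forall>\<epsilon>>0. \<exists>\<phi>. flat_fun \<phi> \<and> (\<forall>x. x \<notin> U \<longrightarrow> \<phi> x = 0) \<and> l2norm \<mu> (\<lambda>x. \<phi> x - f x) < \<epsilon>)"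

lemma approximable_limit:
  assumes U: "bounded U" and s: "\<And>k. approximable U (s k)" and f: "f \<in> L2 \<mu>"
    and lim: "(\<lambda>k. l2norm \<mu> (\<lambda>x. s k x - f x)) \<longlonglongrightarrow> 0"
  shows "approximable U f"
  unfolding approximable_def
proof (intro conjI allI impI f)
  fix \<epsilon> :: real assume "\<epsilon> > 0"
  then have "eventually (\<lambda>k. l2norm \<mu> (\<lambda>x. s k x - f x) < \<epsilon> / 2) sequentially"
    by (intro order_tendstoD(2)[OF lim]) simp
  then obtain k where k: "l2norm \<mu> (\<lambda>x. s k x - f x) < \<epsilon> / 2"
    using eventually_sequentially by auto
  obtain \<phi> where \<phi>: "flat_fun \<phi>" "\<forall>x. x \<notin> U \<longrightarrow> \<phi> x = 0" "l2norm \<mu> (\<lambda>x. \<phi> x - s k x) < \<epsilon> / 2"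
    using s[of k] \<open>\<epsilon> > 0\<close> unfolding approximable_def by (meson half_gt_zero)
  have "l2norm \<mu> (\<lambda>x. \<phi> x - f x) \<le> l2norm \<mu> (\<lambda>x. \<phi> x - s k x) + l2norm \<mu> (\<lambda>x. s k x - f x)"
    using flat_fun_L2[OF \<phi>(1) U] \<phi>(2) s f by (intro l2norm_dist_triangle) (simp_all add: approximable_def)
  with k \<phi> show "\<exists>\<phi>. flat_fun \<phi> \<and> (\<forall>x. x \<notin> U \<longrightarrow> \<phi> x = 0) \<and> l2norm \<mu> (\<lambda>x. \<phi> x - f x) < \<epsilon>"
    by (intro exI[of _ \<phi>]) auto
qed

lemma approximable_flat: "bounded U \<Longrightarrow> flat_fun \<phi> \<Longrightarrow> (\<And>x. x \<notin> U \<Longrightarrow> \<phi> x = 0) \<Longrightarrow> approximable U \<phi>"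
  unfolding approximable_def by (auto intro!: flat_fun_L2 exI[of _ \<phi>] simp: l2norm_def)

lemma approximable_add:
  assumes U: "bounded U" and f: "approximable U f" and g: "approximable U g"
  shows "approximable U (\<lambda>x. f x + g x)"
  unfolding approximable_def
proof (intro conjI allI impI)
  show "(\<lambda>x. f x + g x) \<in> L2 \<mu>"
    using f g by (intro L2_add) (auto simp: approximable_def)
  fix \<epsilon> :: real assume "\<epsilon> > 0"
  obtain \<phi> where \<phi>: "flat_fun \<phi>" "\<forall>x. x \<notin> U \<longrightarrow> \<phi> x = 0" "l2norm \<mu> (\<lambda>x. \<phi> x - f x) < \<epsilon> / 2"
    using f \<open>\<epsilon> > 0\<close> unfolding approximable_def by (meson half_gt_zero)
  obtain \<psi> where \<psi>: "flat_fun \<psi>" "\<forall>x. x \<notin> U \<longrightarrow> \<psi> x = 0" "l2norm \<mu> (\<lambda>x. \<psi> x - g x) < \<epsilon> / 2"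
    using g \<open>\<epsilon> > 0\<close> unfolding approximable_def by (meson half_gt_zero)
  have "l2norm \<mu> (\<lambda>x. (\<phi> x - f x) + (\<psi> x - g x)) \<le> l2norm \<mu> (\<lambda>x. \<phi> x - f x) + l2norm \<mu> (\<lambda>x. \<psi> x - g x)"
    using flat_fun_L2[OF \<phi>(1) U] \<phi>(2) flat_fun_L2[OF \<psi>(1) U] \<psi>(2) f g
    by (intro l2norm_triangle_add L2_diff) (simp_all add: approximable_def)
  then have "l2norm \<mu> (\<lambda>x. (\<phi> x + \<psi> x) - (f x + g x)) < \<epsilon>"
    using \<phi> \<psi> by (simp add: algebra_simps)
  with \<phi> \<psi> show "\<exists>\<phi>. flat_fun \<phi> \<and> (\<forall>x. x \<notin> U \<longrightarrow> \<phi> x = 0) \<and> l2norm \<mu> (\<lambda>x. \<phi> x - (f x + g x)) < \<epsilon>"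
    by (intro exI[of _ "\<lambda>x. \<phi> x + \<psi> x"]) (auto intro: flat_fun.add)
qed

lemma approximable_cmult:
  assumes U: "bounded U" and f: "approximable U f"
  shows "approximable U (\<lambda>x. c * f x)"
  unfolding approximable_def
proof (intro conjI allI impI)
  show "(\<lambda>x. c * f x) \<in> L2 \<mu>"
    using f by (intro L2_cmult) (auto simp: approximable_def)
  fix \<epsilon> :: real assume \<epsilon>: "\<epsilon> > 0"
  have "\<epsilon> / (cmod c + 1) > 0"
    using \<epsilon> by (intro divide_pos_pos) (auto intro: add_nonneg_pos)
  then obtain \<phi> where \<phi>: "flat_fun \<phi>" "\<forall>x. x \<notin> U \<longrightarrow> \<phi> x = 0" "l2norm \<mu> (\<lambda>x. \<phi> x - f x) < \<epsilon> / (cmod c + 1)"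
    using f unfolding approximable_def by meson
  have "l2norm \<mu> (\<lambda>x. c * \<phi> x - c * f x) = cmod c * l2norm \<mu> (\<lambda>x. \<phi> x - f x)"
    by (simp add: l2norm_cmult flip: right_diff_distrib)
  also have "\<dots> \<le> (cmod c + 1) * l2norm \<mu> (\<lambda>x. \<phi> x - f x)"
    by (intro mult_right_mono) auto
  also have "\<dots> < (cmod c + 1) * (\<epsilon> / (cmod c + 1))"
    using \<phi> by (intro mult_strict_left_mono) (auto intro: add_nonneg_pos)
  also have "\<dots> = \<epsilon>"
    using add_nonneg_pos[OF norm_ge_zero[of c] zero_less_one] by simp
  finally show "\<exists>\<phi>. flat_fun \<phi> \<and> (\<forall>x. x \<notin> U \<longrightarrow> \<phi> x = 0) \<and> l2norm \<mu> (\<lambda>x. \<phi> x - c * f x) < \<epsilon>"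
    using \<phi> by (intro exI[of _ "\<lambda>x. c * \<phi> x"]) (auto intro: flat_fun.mult flat_fun.const)
qed

lemma approximable_sum:
  assumes "bounded U" "\<And>i. i \<in> I \<Longrightarrow> approximable U (f i)"
  shows "approximable U (\<lambda>x. \<Sum>i\<in>I. f i x)"
  using assms(2)
  by (induction I rule: infinite_finite_induct)
     (auto intro: approximable_add assms(1) approximable_flat flat_fun.const)

text \<open>Sets of \<open>\<mu>\<close> are traces \<open>\<Omega> \<inter> B\<close>, while the
  approximation is done for the Borel set \<open>B\<close>; this lemma passes from one to the
  other.\<close>

lemma approximable_cong:
  assumes f: "approximable U f" and eq: "\<And>x. x \<in> \<Omega> \<Longrightarrow> g x = f x"
  shows "approximable U g"
proof -
  have "g \<in> borel_measurable \<mu> \<longleftrightarrow> f \<in> borel_measurable \<mu>"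
    using eq by (intro measurable_cong) (simp add: space_trace)
  moreover have "integrable \<mu> (\<lambda>x. (cmod (g x))\<^sup>2) \<longleftrightarrow> integrable \<mu> (\<lambda>x. (cmod (f x))\<^sup>2)"
    using eq by (intro Bochner_Integration.integrable_cong) (auto simp: space_trace)
  moreover have "l2norm \<mu> (\<lambda>x. \<phi> x - g x) = l2norm \<mu> (\<lambda>x. \<phi> x - f x)" for \<phi>
    unfolding l2norm_def using eq
    by (intro arg_cong[of _ _ sqrt] Bochner_Integration.integral_cong) (auto simp: space_trace)
  ultimately show ?thesis
    using f by (simp add: approximable_def L2_def)
qed

lemma approximable_indicator_box: "approximable (box a b) (indicator (box p q \<inter> box a b))"
proof -
  obtain p' q' where pq: "box p q \<inter> box a b = box p' q'"
    unfolding box_Int_box by blast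
  let ?s = "box_approx p' q'"
  have s: "approximable (box a b) (?s k)" for k
    by (intro approximable_flat flat_fun_box_approx bounded_box) (use box_approx_outside[of _ p' q'] pq in blast)
  have dom: "cmod (?s k x) \<le> cmod (indicator (box a b) x)" for k x
  proof (cases "x \<in> box a b")
    case False
    then have "x \<notin> box p' q'" using pq by blast
    then show ?thesis by (simp add: box_approx_outside)
  qed (use box_approx_le_1 in simp)
  have sm: "?s k \<in> borel_measurable \<mu>" for k
    using s[of k] by (simp add: approximable_def L2_def)
  have fm: "(indicator (box p' q') :: 'a \<Rightarrow> complex) \<in> borel_measurable \<mu>"
    by (intro trace_measurable) measurable
  have w: "indicator (box a b) \<in> L2 \<mu>"
    by (intro bounded_indicator_L2) auto
  note conv = L2_dominated_convergence[of ?s \<mu> "indicator (box p' q')" "indicator (box a b)",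
      OF sm fm w dom box_approx_tendsto]
  show ?thesis
    unfolding pq by (rule approximable_limit[OF bounded_box s conv(1) conv(3)])
qed

text \<open>Dynkin's argument over the intersection-stable generator of open boxes. Intersecting
  with one fixed box keeps all indicators in \<open>L2\<close>, turns complements into differences,
  and provides the dominating function for disjoint unions.\<close>

lemma approximable_indicator:
  assumes "A \<in> sets borel"
  shows "approximable (box a b) (indicator (A \<inter> box a b))"
proof -
  have "Int_stable (range (\<lambda>(a, b). box a b :: 'a set))"
    by (auto simp: Int_stable_def box_Int_box)
  moreover have "range (\<lambda>(a, b). box a b :: 'a set) \<subseteq> Pow UNIV"
    by auto
  moreover have "A \<in> sigma_sets UNIV (range (\<lambda>(a, b). box a b))"
    using assms unfolding borel_eq_box by simp
  ultimately show ?thesis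
  proof (induction rule: sigma_sets_induct_disjoint)
    case (basic A)
    then show ?case using approximable_indicator_box by auto
  next
    case empty
    then show ?case by (auto intro: approximable_flat flat_fun.const simp: indicator_def)
  next
    case (compl A)
    have "approximable (box a b) (\<lambda>x. indicator (box a b \<inter> box a b) x + (-1) * indicator (A \<inter> box a b) x)"
      by (intro approximable_add approximable_cmult approximable_indicator_box compl bounded_box)
    then show ?case
      by (rule approximable_cong) (auto split: split_indicator)
  next
    case (union A)
    then have [measurable]: "A i \<in> sets borel" for i
      by (auto simp: borel_eq_box)
    let ?s = "\<lambda>k x. \<Sum>i<k. indicator (A i \<inter> box a b) x :: complex"
    have s: "approximable (box a b) (?s k)" for k
      by (intro approximable_sum union bounded_box)
    have eq: "?s k x = indicator ((\<Union>i<k. A i) \<inter> box a b) x" for k x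
    proof -
      have "indicator ((\<Union>i<k. A i) \<inter> box a b) x = (indicator (\<Union>i<k. A i \<inter> box a b) x :: complex)"
        by (rule arg_cong[of _ _ "\<lambda>S. indicator S x"]) auto
      also have "\<dots> = ?s k x"
        using union(1) by (intro indicator_UN_disjoint) (auto simp: disjoint_family_on_def)
      finally show ?thesis ..
    qed
    have lim: "(\<lambda>k. ?s k x) \<longlonglongrightarrow> indicator ((\<Union>i. A i) \<inter> box a b) x" for x
    proof -
      have "(\<lambda>k. indicator (\<Union>i<k. A i) x * indicator (box a b) x) \<longlonglongrightarrow> indicator (\<Union>i. A i) x * (indicator (box a b) x :: complex)"
        by (intro tendsto_mult LIMSEQ_indicator_UN tendsto_const)
      then show ?thesis
        unfolding eq by (simp only: indicator_inter_arith)
    qed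
    have dom: "cmod (?s k x) \<le> cmod (indicator (box a b) x)" for k x
      unfolding eq by (auto split: split_indicator)
    have sm: "?s k \<in> borel_measurable \<mu>" for k
      using s[of k] by (auto simp: approximable_def L2_def)
    have fm: "(indicator ((\<Union>i. A i) \<inter> box a b) :: 'a \<Rightarrow> complex) \<in> borel_measurable \<mu>"
      by (intro trace_measurable) measurable
    have w: "indicator (box a b) \<in> L2 \<mu>"
      by (intro bounded_indicator_L2) auto
    note conv = L2_dominated_convergence[of ?s \<mu> "indicator ((\<Union>i. A i) \<inter> box a b)" "indicator (box a b)", OF sm fm w dom lim]
    show ?case
      by (rule approximable_limit[OF bounded_box s conv(1) conv(3)])
  qed
qed

lemma L2_approximable:
  assumes f: "f \<in> L2 \<mu>" and out: "\<And>x. x \<in> \<Omega> \<Longrightarrow> x \<notin> box a b \<Longrightarrow> f x = 0"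
  shows "approximable (box a b) f"
proof -
  have "\<exists>F. (\<forall>i. simple_function \<mu> (F i)) \<and> (\<forall>x\<in>\<Omega>. (\<lambda>i. F i x) \<longlonglongrightarrow> f x) \<and>
    (\<forall>i. \<forall>x\<in>\<Omega>. cmod (F i x) \<le> 2 * cmod (f x))"
    using borel_measurable_implies_sequence_metric[OF L2_measurable[OF f], of 0]
    by (simp add: space_trace)
  then obtain F where F: "\<And>i. simple_function \<mu> (F i)" "\<And>x. x \<in> \<Omega> \<Longrightarrow> (\<lambda>i. F i x) \<longlonglongrightarrow> f x"
    "\<And>i x. x \<in> \<Omega> \<Longrightarrow> cmod (F i x) \<le> 2 * cmod (f x)"
    by blast
  have F_app: "approximable (box a b) (F i)" for i
  proof -
    have "approximable (box a b) (\<lambda>x. \<Sum>y\<in>F i ` \<Omega>. y * indicator (F i -` {y} \<inter> \<Omega>) x)"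
    proof (intro approximable_sum bounded_box)
      fix y assume "y \<in> F i ` \<Omega>"
      have "F i -` {y} \<inter> \<Omega> \<in> sets \<mu>"
        using simple_functionD(2)[OF F(1), of i "{y}"] by (simp add: space_trace)
      then obtain B where B: "B \<in> sets borel" "F i -` {y} \<inter> \<Omega> = \<Omega> \<inter> B"
        by (rule trace_setsE)
      have "approximable (box a b) (\<lambda>x. y * indicator (B \<inter> box a b) x)"
        by (intro approximable_cmult approximable_indicator bounded_box B)
      then show "approximable (box a b) (\<lambda>x. y * indicator (F i -` {y} \<inter> \<Omega>) x)"
      proof (rule approximable_cong)
        fix x assume x: "x \<in> \<Omega>"
        show "y * indicator (F i -` {y} \<inter> \<Omega>) x = y * indicator (B \<inter> box a b) x"
        proof (cases "x \<in> box a b")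
          case False
          \<comment> \<open>The bound by \<open>2 * cmod (f x)\<close> makes \<open>F i\<close>
            vanish off the box, so the two indicators can differ there only for
            \<open>y = 0\<close>, where the coefficient removes the term.\<close>
          then have "F i x = 0" using F(3)[OF x, of i] out[OF x] by simp
          then show ?thesis using False by (auto split: split_indicator)
        qed (use B(2) x in \<open>auto split: split_indicator\<close>)
      qed
    qed
    then show ?thesis
    proof (rule approximable_cong)
      fix x assume x: "x \<in> \<Omega>"
      have fin: "finite (F i ` \<Omega>)"
        using simple_functionD(1)[OF F(1), of i] by (simp add: space_trace)
      have "(\<Sum>y\<in>F i ` \<Omega>. y * indicator (F i -` {y} \<inter> \<Omega>) x) = (\<Sum>y\<in>F i ` \<Omega>. if y = F i x then y else 0)"
        using x by (intro sum.cong) (auto split: split_indicator)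
      then show "F i x = (\<Sum>y\<in>F i ` \<Omega>. y * indicator (F i -` {y} \<inter> \<Omega>) x)"
        using fin x by simp
    qed
  qed
  have w: "(\<lambda>x. 2 * f x) \<in> L2 \<mu>"
    by (intro L2_cmult f)
  have Fm: "F i \<in> borel_measurable \<mu>" for i
    by (rule borel_measurable_simple_function[OF F(1)])
  have "(\<lambda>k. l2norm \<mu> (\<lambda>x. F k x - f x)) \<longlonglongrightarrow> 0"
    by (rule L2_dominated_convergence(3)[OF Fm L2_measurable[OF f] w])
       (use F in \<open>auto simp: space_trace norm_mult\<close>)
  then show ?thesis
    by (rule approximable_limit[OF bounded_box F_app f])
qed

lemma schwartz_dense_L2:
  assumes f: "f \<in> L2 \<mu>" and "\<epsilon> > 0"
  shows "\<exists>\<phi>. schwartz \<phi> \<and> \<phi> \<in> L2 \<mu> \<and> l2norm \<mu> (\<lambda>x. \<phi> x - f x) < \<epsilon>"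
proof -
  define U :: "nat \<Rightarrow> 'a set" where "U = (\<lambda>m. box (- (real m *\<^sub>R One)) (real m *\<^sub>R One))"
  define s where "s = (\<lambda>m x. indicator (U m) x * f x)"
  have sm: "s m \<in> borel_measurable \<mu>" for m
  proof -
    have "(indicator (U m) :: 'a \<Rightarrow> complex) \<in> borel_measurable \<mu>"
      by (intro trace_measurable) (simp add: U_def)
    then show ?thesis
      unfolding s_def using L2_measurable[OF f] by simp
  qed
  have lim: "(\<lambda>m. s m x) \<longlonglongrightarrow> f x" for x
  proof (rule tendsto_eventually)
    obtain M :: nat where M: "norm x < real M"
      using reals_Archimedean2 by blast
    have "x \<in> U m" if "m \<ge> M" for m
    proof -
      have "\<bar>x \<bullet> i\<bar> < real m" if "i \<in> Basis" for i
        using Basis_le_norm[OF that, of x] M \<open>m \<ge> M\<close> by linarith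
      then show ?thesis
        unfolding U_def mem_box by (auto simp: abs_less_iff minus_less_iff)
    qed
    then show "eventually (\<lambda>m. s m x = f x) sequentially"
      unfolding eventually_sequentially by (intro exI[of _ M]) (auto simp: s_def)
  qed
  have dom: "cmod (s m x) \<le> cmod (f x)" for m x
    by (auto simp: s_def split: split_indicator)
  note conv = L2_dominated_convergence[of s \<mu> f f, OF sm L2_measurable[OF f] f dom lim]
  have "eventually (\<lambda>m. l2norm \<mu> (\<lambda>x. s m x - f x) < \<epsilon> / 2) sequentially"
    using \<open>\<epsilon> > 0\<close> by (intro order_tendstoD(2)[OF conv(3)]) simp
  then obtain m where m: "l2norm \<mu> (\<lambda>x. s m x - f x) < \<epsilon> / 2"
    using eventually_sequentially by auto
  have "approximable (U m) (s m)"
    unfolding U_def by (intro L2_approximable conv) (auto simp: s_def U_def)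
  then obtain \<phi> where \<phi>: "flat_fun \<phi>" "\<And>x. x \<notin> U m \<Longrightarrow> \<phi> x = 0" "l2norm \<mu> (\<lambda>x. \<phi> x - s m x) < \<epsilon> / 2"
    using \<open>\<epsilon> > 0\<close> unfolding approximable_def by (meson half_gt_zero)
  have "schwartz \<phi>"
  proof (rule flat_fun_schwartz[OF \<phi>(1)])
    show "compact (closure (U m))" by (simp add: U_def)
    show "\<phi> x = 0" if "x \<notin> closure (U m)" for x
      using \<phi>(2) that closure_subset by blast
  qed
  moreover have "\<phi> \<in> L2 \<mu>"
    by (rule flat_fun_L2[OF \<phi>(1) _ \<phi>(2)]) (auto simp: U_def)
  moreover from this have "l2norm \<mu> (\<lambda>x. \<phi> x - f x) < \<epsilon>"
    using l2norm_dist_triangle[OF _ conv(2) f, of \<phi> m] m \<phi>(3) by simp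
  ultimately show ?thesis by blast
qed

end

section \<open>The homogeneous measure\<close>

lemma space_sphere_measure: "space (sphere_measure :: 'a::euclidean_space measure) = sphere 0 1"
  by (simp add: sphere_measure_def space_scale_measure space_restrict_space)

lemma nn_integral_scale_eq_0:
  fixes h :: "'a \<Rightarrow> ennreal"
  assumes "integral\<^sup>N M h = 0"
  shows "(\<integral>\<^sup>+x. ennreal c * h x \<partial>M) = 0"
proof (cases "c > 0")
  case True
  have "integral\<^sup>S M g = 0" if g: "simple_function M g" "g \<le> (\<lambda>x. ennreal c * h x)" for g
  proof -
    have le: "ennreal (1 / c) * g x \<le> h x" for x
    proof -
      have "ennreal (1 / c) * g x \<le> ennreal (1 / c) * (ennreal c * h x)"
        using g(2) by (intro mult_left_mono) (auto simp: le_fun_def)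
      also have "\<dots> = h x"
        using True by (simp add: mult.assoc[symmetric] ennreal_mult[symmetric])
      finally show ?thesis .
    qed
    have "ennreal (1 / c) * integral\<^sup>N M g = (\<integral>\<^sup>+x. ennreal (1 / c) * g x \<partial>M)"
      using g by (intro nn_integral_cmult[symmetric] borel_measurable_simple_function)
    also have "\<dots> \<le> integral\<^sup>N M h"
      by (intro nn_integral_mono le)
    finally have "integral\<^sup>N M g = 0"
      using assms True by simp
    then show ?thesis
      using nn_integral_eq_simple_integral[OF g(1)] by simp
  qed
  then have "(\<integral>\<^sup>+x. ennreal c * h x \<partial>M) \<le> 0"
    unfolding nn_integral_def by (intro SUP_least) auto
  then show ?thesis by simp
next
  case False
  then show ?thesis by (simp add: ennreal_neg)
qed

definition radial_weight :: "real \<Rightarrow> real \<Rightarrow> real \<Rightarrow> ennreal" where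
  "radial_weight a p q = (\<integral>\<^sup>+r. ennreal (r powr (2 * a - 1)) * indicator {0<..} r * indicator {p..<q} r \<partial>lborel)"

lemma radial_weight_le:
  assumes "a > 0" "q \<ge> 0"
  shows "radial_weight a p q \<le> ennreal (q powr (2 * a) / (2 * a))"
proof -
  let ?f = "\<lambda>r. if r \<in> {0..q} then r powr (2 * a - 1) else 0 :: real"
  have "(?f has_integral q powr (2 * a) / (2 * a)) UNIV"
    unfolding has_integral_restrict_UNIV
    using has_integral_powr_from_0[of "2 * a - 1" q] assms by simp
  then have "(\<integral>\<^sup>+r. ennreal (?f r) \<partial>lborel) = ennreal (q powr (2 * a) / (2 * a))"
    by (intro nn_integral_has_integral_lborel) auto
  moreover have "radial_weight a p q \<le> (\<integral>\<^sup>+r. ennreal (?f r) \<partial>lborel)"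
    unfolding radial_weight_def by (intro nn_integral_mono) (auto split: split_indicator)
  ultimately show ?thesis by simp
qed

lemma radial_weight_pos:
  assumes "0 < p" "p < q"
  shows "radial_weight a p q > 0"
proof -
  \<comment> \<open>A power of r is monotone, in a direction that depends on the sign of
    \<open>2 * a - 1\<close>, so its minimum over the interval sits at one of the two ends.\<close>
  define m where "m = min (p powr (2 * a - 1)) (q powr (2 * a - 1))"
  have m: "m > 0" using assms by (simp add: m_def)
  have "m \<le> r powr (2 * a - 1)" if "r \<in> {p..<q}" for r
  proof (cases "2 * a - 1 \<ge> 0")
    case True
    then have "p powr (2 * a - 1) \<le> r powr (2 * a - 1)"
      using that assms by (intro powr_mono2) auto
    then show ?thesis by (simp add: m_def)
  next
    case False
    then have "q powr (2 * a - 1) \<le> r powr (2 * a - 1)"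
      using that assms by (intro powr_mono2') auto
    then show ?thesis by (simp add: m_def)
  qed
  then have "(\<integral>\<^sup>+r. ennreal m * indicator {p..<q} r \<partial>lborel) \<le> radial_weight a p q"
    unfolding radial_weight_def using assms
    by (intro nn_integral_mono) (auto split: split_indicator intro!: ennreal_leI)
  moreover have "(\<integral>\<^sup>+r. ennreal m * indicator {p..<q} r \<partial>lborel) = ennreal (m * (q - p))"
    using m assms by (simp add: nn_integral_cmult_indicator ennreal_mult)
  moreover have "0 < m * (q - p)" using m assms by simp
  ultimately show ?thesis
    by (metis ennreal_less_zero_iff less_le_trans)
qed

context cone_transform
begin

lemma borel_trace_sets: "B \<in> sets borel \<Longrightarrow> \<Omega> \<inter> B \<in> sets \<mu>"
  by (auto simp: sets_\<mu> sets_restrict_space)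

lemma dilation_iff: "c > 0 \<Longrightarrow> c *\<^sub>R x \<in> \<Omega> \<longleftrightarrow> x \<in> \<Omega>"
  using dilation_closed[of c x] dilation_closed[of "1 / c" "c *\<^sub>R x"] by auto

abbreviation annulus :: "real \<Rightarrow> real \<Rightarrow> 'a set" where
  "annulus p q \<equiv> {x. norm x \<in> {p..<q}}"

lemma annulus_borel [measurable]: "annulus p q \<in> sets borel"
  by measurable

text \<open>Invariance of \<Omega> under dilations makes membership of
  \<open>r *\<^sub>R \<zeta>\<close> independent of \<open>r > 0\<close>, so the radial and the
  angular integrals separate.\<close>

lemma emeasure_annulus:
  "emeasure \<mu> (\<Omega> \<inter> annulus p q)
    = (\<integral>\<^sup>+\<zeta>. radial_weight a p q * indicator \<Omega> \<zeta> * ennreal (Q \<zeta>) \<partial>sphere_measure)"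
  unfolding polar[OF borel_trace_sets[OF annulus_borel]]
proof (rule nn_integral_cong)
  fix \<zeta> :: 'a assume "\<zeta> \<in> space sphere_measure"
  then have \<zeta>: "norm \<zeta> = 1" by (simp add: space_sphere_measure)
  have "(\<integral>\<^sup>+r. ennreal (r powr (2 * a - 1)) * indicator {0<..} r * indicator (\<Omega> \<inter> annulus p q) (r *\<^sub>R \<zeta>) \<partial>lborel)
    = (\<integral>\<^sup>+r. ennreal (r powr (2 * a - 1)) * indicator {0<..} r * indicator {p..<q} r * indicator \<Omega> \<zeta> \<partial>lborel)"
    using \<zeta> by (intro nn_integral_cong) (auto simp: dilation_iff split: split_indicator)
  also have "\<dots> = radial_weight a p q * indicator \<Omega> \<zeta>"
    unfolding radial_weight_def by (rule nn_integral_multc) measurable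
  finally show "(\<integral>\<^sup>+r. ennreal (r powr (2 * a - 1)) * indicator {0<..} r * indicator (\<Omega> \<inter> annulus p q) (r *\<^sub>R \<zeta>) \<partial>lborel) * ennreal (Q \<zeta>)
    = radial_weight a p q * indicator \<Omega> \<zeta> * ennreal (Q \<zeta>)" by simp
qed

text \<open>The radial density integrates to r^(2a) / (2a), whence the denominator. The angular
  integral runs over the whole sphere and not only over directions in \<Omega>, so this is an upper
  bound for the coefficient.\<close>

definition ball_const :: real where
  "ball_const = enn2real (\<integral>\<^sup>+\<zeta>. ennreal (Q \<zeta>) \<partial>sphere_measure) / (2 * a)"

lemma ball_const_nonneg: "0 \<le> ball_const"
  using a_pos by (simp add: ball_const_def)

lemma annulus_0: "annulus 0 r = ball 0 r"
  by auto

lemma emeasure_ball_le: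
  assumes "r \<ge> 0"
  shows "emeasure \<mu> (\<Omega> \<inter> ball 0 r) \<le> ennreal (ball_const * r powr (2 * a))"
proof -
  have [measurable]: "Q \<in> borel_measurable sphere_measure"
    using Q_integrable by simp
  have "(\<integral>\<^sup>+\<zeta>. ennreal (Q \<zeta>) \<partial>sphere_measure) \<le> (\<integral>\<^sup>+\<zeta>. ennreal (norm (Q \<zeta>)) \<partial>sphere_measure)"
    by (intro nn_integral_mono ennreal_leI) auto
  also have "\<dots> < \<infinity>"
    using Q_integrable by (simp add: integrable_iff_bounded)
  finally have fin: "(\<integral>\<^sup>+\<zeta>. ennreal (Q \<zeta>) \<partial>sphere_measure) \<noteq> \<infinity>" by simp
  have "emeasure \<mu> (\<Omega> \<inter> annulus 0 r) \<le> (\<integral>\<^sup>+\<zeta>. ennreal (r powr (2 * a) / (2 * a)) * ennreal (Q \<zeta>) \<partial>sphere_measure)"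
    unfolding emeasure_annulus using radial_weight_le[OF a_pos assms, of 0]
    by (intro nn_integral_mono mult_right_mono) (auto split: split_indicator)
  also have "\<dots> = ennreal (r powr (2 * a) / (2 * a)) * (\<integral>\<^sup>+\<zeta>. ennreal (Q \<zeta>) \<partial>sphere_measure)"
    by (rule nn_integral_cmult) measurable
  also have "\<dots> = ennreal (r powr (2 * a) / (2 * a)) * ennreal (enn2real (\<integral>\<^sup>+\<zeta>. ennreal (Q \<zeta>) \<partial>sphere_measure))"
    using fin by (simp add: less_top)
  also have "\<dots> = ennreal (ball_const * r powr (2 * a))"
    using a_pos by (simp add: ball_const_def ennreal_mult[symmetric] mult.commute)
  finally show ?thesis by (simp only: annulus_0)
qed

lemma emeasure_ball_finite: "emeasure \<mu> (\<Omega> \<inter> ball 0 r) < \<infinity>"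
proof (cases "r \<ge> 0")
  case True
  show ?thesis
    by (rule order_le_less_trans[OF emeasure_ball_le[OF True]]) simp
qed (simp add: ball_empty)

sublocale locally_finite_trace \<Omega> \<mu>
  by unfold_locales (fact space_\<mu> sets_\<mu> emeasure_ball_finite)+

lemma measure_ball_le:
  assumes "r \<ge> 0"
  shows "measure \<mu> (\<Omega> \<inter> ball 0 r) \<le> ball_const * r powr (2 * a)"
  unfolding measure_def using emeasure_ball_le[OF assms] ball_const_nonneg
  by (intro enn2real_leI) auto

text \<open>All annuli share the same angular integrand up to a constant factor, the ratio
  \<open>J / j\<close> of radial weights below. One null annulus would therefore make every ball
  null, and with the balls all of \<Omega>.\<close>

lemma emeasure_annulus_pos:
  assumes "emeasure \<mu> \<Omega> \<noteq> 0" "0 < p" "p < q"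
  shows "emeasure \<mu> (\<Omega> \<inter> annulus p q) > 0"
proof (rule ccontr)
  assume "\<not> emeasure \<mu> (\<Omega> \<inter> annulus p q) > 0"
  then have zero: "(\<integral>\<^sup>+\<zeta>. radial_weight a p q * indicator \<Omega> \<zeta> * ennreal (Q \<zeta>) \<partial>sphere_measure) = 0"
    unfolding emeasure_annulus by simp
  have "radial_weight a p q < \<infinity>"
    by (rule order_le_less_trans[OF radial_weight_le[OF a_pos]]) (use assms in auto)
  then obtain j where j: "j > 0" "radial_weight a p q = ennreal j"
    using radial_weight_pos[OF assms(2,3), of a] by (cases "radial_weight a p q") auto
  have ball0: "emeasure \<mu> (\<Omega> \<inter> ball 0 (real n)) = 0" for n
  proof -
    have "radial_weight a 0 (real n) < \<infinity>"
      by (rule order_le_less_trans[OF radial_weight_le[OF a_pos]]) auto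
    then obtain J where J: "J \<ge> 0" "radial_weight a 0 (real n) = ennreal J"
      by (cases "radial_weight a 0 (real n)") auto
    have "emeasure \<mu> (\<Omega> \<inter> annulus 0 (real n))
      = (\<integral>\<^sup>+\<zeta>. ennreal (J / j) * (radial_weight a p q * indicator \<Omega> \<zeta> * ennreal (Q \<zeta>)) \<partial>sphere_measure)"
      unfolding emeasure_annulus J j using j(1) J(1)
      by (intro nn_integral_cong) (simp add: mult.assoc[symmetric] ennreal_mult[symmetric])
    also have "\<dots> = 0"
      by (rule nn_integral_scale_eq_0[OF zero])
    finally show ?thesis by (simp only: annulus_0)
  qed
  have "\<Omega> = (\<Union>n. \<Omega> \<inter> ball 0 (real n))"
    using reals_Archimedean2 by auto
  moreover have "(\<Union>n. \<Omega> \<inter> ball 0 (real n)) \<in> null_sets \<mu>"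
    using ball0 by (intro null_sets_UN) (auto simp: null_sets_def borel_trace_sets)
  ultimately show False
    using assms(1) by auto
qed

text \<open>The weight |x|^s vanishes only at the origin; since that point is null, weighting cannot
  annihilate a nonzero function.\<close>

lemma singleton_0_null: "emeasure \<mu> (\<Omega> \<inter> {0}) = 0"
proof -
  have id: "(\<lambda>x. x) \<in> measurable \<mu> borel"
    by (rule trace_measurable) simp
  have "{0::'a} \<in> null_sets lborel"
    by (intro finite_imp_null_set_lborel) simp
  then have "emeasure (distr \<mu> borel (\<lambda>x. x)) {0} = 0"
    using abs_continuous unfolding absolutely_continuous_def null_sets_def by blast
  then show ?thesis
    by (simp add: emeasure_distr[OF id] space_\<mu> Int_commute)
qed

end

section \<open>The transform on square-integrable functions\<close>

lemma schwartz_continuous: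
  assumes "schwartz f"
  shows "continuous_on UNIV f"
proof -
  have "\<forall>bs\<in>lists Basis. iterated_partial bs f differentiable_on UNIV"
    using assms unfolding schwartz_def by blast
  from bspec[OF this, of "[]"] show ?thesis
    by (simp add: differentiable_imp_continuous_on)
qed

context cone_transform
begin

definition kernel_const :: real where
  "kernel_const = (SOME c. c > 0 \<and> (\<forall>x\<in>\<Omega>. \<forall>\<xi>\<in>\<Omega>. cmod (K x \<xi>) \<le> c))"

lemma kernel_const_pos: "kernel_const > 0"
  and kernel_le: "x \<in> \<Omega> \<Longrightarrow> \<xi> \<in> \<Omega> \<Longrightarrow> cmod (K x \<xi>) \<le> kernel_const"
proof -
  obtain c where c: "\<forall>x\<in>\<Omega>. \<forall>\<xi>\<in>\<Omega>. cmod (K x \<xi>) \<le> c"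
    using K_bounded by blast
  then have "max c 1 > 0 \<and> (\<forall>x\<in>\<Omega>. \<forall>\<xi>\<in>\<Omega>. cmod (K x \<xi>) \<le> max c 1)"
    by (auto simp: le_max_iff_disj)
  then have "kernel_const > 0 \<and> (\<forall>x\<in>\<Omega>. \<forall>\<xi>\<in>\<Omega>. cmod (K x \<xi>) \<le> kernel_const)"
    unfolding kernel_const_def by (rule someI)
  then show "kernel_const > 0" "x \<in> \<Omega> \<Longrightarrow> \<xi> \<in> \<Omega> \<Longrightarrow> cmod (K x \<xi>) \<le> kernel_const"
    by auto
qed

abbreviation ball_measure :: "real \<Rightarrow> real" where
  "ball_measure r \<equiv> measure \<mu> (\<Omega> \<inter> ball 0 r)"

text \<open>The bounded kernel need not be square-integrable until it is cut off. The conjugate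
  undoes the one in \<open>inner2\<close>, so that pairing a function supported in the ball with
  \<open>local_kernel\<close> gives its transform.\<close>

definition local_kernel :: "real \<Rightarrow> 'a \<Rightarrow> 'a \<Rightarrow> complex" where
  "local_kernel r \<xi> x = indicator (ball 0 r) x * cnj (K x \<xi>)"

lemma ball_indicator_measurable [measurable]:
  "(indicator (ball 0 r) :: 'a \<Rightarrow> complex) \<in> borel_measurable \<mu>"
  by (intro trace_measurable borel_measurable_indicator) simp

lemma ball_indicator_mult_L2:
  assumes "f \<in> L2 \<mu>"
  shows "(\<lambda>x. indicator (ball 0 r) x * f x) \<in> L2 \<mu>"
proof (rule L2_bound[OF assms])
  show "(\<lambda>x. indicator (ball 0 r) x * f x) \<in> borel_measurable \<mu>"
    using L2_measurable[OF assms] by measurable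
qed (auto split: split_indicator)

lemma L2_bounded_on_ball:
  assumes [measurable]: "h \<in> borel_measurable \<mu>"
    and "b \<ge> 0" and h: "\<And>x. x \<in> \<Omega> \<Longrightarrow> cmod (h x) \<le> b * indicator (ball 0 r) x"
  shows "h \<in> L2 \<mu>" "l2norm \<mu> h \<le> b * sqrt (ball_measure r)"
proof -
  have ind: "(\<lambda>x. of_real b * indicator (ball 0 r) x) \<in> L2 \<mu>"
    by (intro L2_cmult bounded_indicator_L2) auto
  have le: "cmod (h x) \<le> cmod (of_real b * indicator (ball 0 r) x)" if "x \<in> space \<mu>" for x
    using h[of x] that \<open>b \<ge> 0\<close> by (auto simp: space_\<mu> norm_mult split: split_indicator split_indicator_asm)
  show "h \<in> L2 \<mu>"
    by (rule L2_bound[OF ind assms(1) le])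
  have "l2norm \<mu> h \<le> l2norm \<mu> (\<lambda>x. of_real b * indicator (ball 0 r) x)"
    by (rule l2norm_mono[OF ind assms(1) le])
  also have "\<dots> = b * l2norm \<mu> (indicator (ball 0 r))"
    using \<open>b \<ge> 0\<close> by (simp add: l2norm_cmult)
  also have "l2norm \<mu> (indicator (ball 0 r)) = sqrt (ball_measure r)"
  proof -
    have "(\<integral>x. (cmod (indicator (ball 0 r) x))\<^sup>2 \<partial>\<mu>) = (\<integral>x. indicator (\<Omega> \<inter> ball 0 r) x \<partial>\<mu>)"
      by (intro Bochner_Integration.integral_cong) (auto simp: space_\<mu> split: split_indicator)
    then show ?thesis
      using trace_sets[of "ball 0 r"] by (simp add: l2norm_def space_\<mu> Int_absorb2 Int_absorb1)
  qed
  finally show "l2norm \<mu> h \<le> b * sqrt (ball_measure r)" .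
qed

lemma local_kernel_L2:
  assumes "\<xi> \<in> \<Omega>"
  shows "local_kernel r \<xi> \<in> L2 \<mu>" "l2norm \<mu> (local_kernel r \<xi>) \<le> kernel_const * sqrt (ball_measure r)"
proof -
  have "continuous_on \<Omega> (\<lambda>x. case (x, \<xi>) of (x, \<xi>) \<Rightarrow> K x \<xi>)"
    by (rule continuous_on_compose2[OF K_continuous]) (use assms in \<open>auto intro!: continuous_intros\<close>)
  then have "continuous_on \<Omega> (\<lambda>x. K x \<xi>)" by simp
  then have [measurable]: "(\<lambda>x. K x \<xi>) \<in> borel_measurable \<mu>"
    using borel_measurable_continuous_on_restrict measurable_cong_sets[OF sets_\<mu> refl] by blast
  have "local_kernel r \<xi> \<in> borel_measurable \<mu>"
    unfolding local_kernel_def[abs_def] by measurable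
  moreover have "cmod (local_kernel r \<xi> x) \<le> kernel_const * indicator (ball 0 r) x" if "x \<in> \<Omega>" for x
    using kernel_le[OF that assms] by (auto simp: local_kernel_def norm_mult split: split_indicator)
  ultimately show "local_kernel r \<xi> \<in> L2 \<mu>" "l2norm \<mu> (local_kernel r \<xi>) \<le> kernel_const * sqrt (ball_measure r)"
    using L2_bounded_on_ball[OF _ less_imp_le[OF kernel_const_pos]] by blast+
qed

lemma kernel_op_eq_inner2:
  assumes "\<And>x. x \<in> \<Omega> \<Longrightarrow> x \<notin> ball 0 r \<Longrightarrow> h x = 0"
  shows "kernel_op \<mu> K h \<xi> = inner2 \<mu> h (local_kernel r \<xi>)"
  unfolding kernel_op_def inner2_def using assms
  by (intro Bochner_Integration.integral_cong) (auto simp: local_kernel_def space_\<mu> split: split_indicator)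

text \<open>Cauchy-Schwarz against \<open>local_kernel\<close>. The bound is uniform in \<xi>:
  convergence in norm within a fixed ball becomes uniform convergence of the transforms, and
  \<open>h' = 0\<close> gives a supremum bound for one transform.\<close>

lemma kernel_op_diff_le:
  assumes "h \<in> L2 \<mu>" "\<And>x. x \<in> \<Omega> \<Longrightarrow> x \<notin> ball 0 r \<Longrightarrow> h x = 0"
    and "h' \<in> L2 \<mu>" "\<And>x. x \<in> \<Omega> \<Longrightarrow> x \<notin> ball 0 r \<Longrightarrow> h' x = 0" and "\<xi> \<in> \<Omega>"
  shows "cmod (kernel_op \<mu> K h \<xi> - kernel_op \<mu> K h' \<xi>)
    \<le> kernel_const * sqrt (ball_measure r) * l2norm \<mu> (\<lambda>x. h x - h' x)"
proof -
  note k = local_kernel_L2[OF assms(5), of r]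
  have "kernel_op \<mu> K h \<xi> - kernel_op \<mu> K h' \<xi> = inner2 \<mu> (\<lambda>x. h x - h' x) (local_kernel r \<xi>)"
    using kernel_op_eq_inner2[of r h \<xi>, OF assms(2)] kernel_op_eq_inner2[of r h' \<xi>, OF assms(4)]
      inner2_diff_left[OF assms(1,3) k(1)] by simp
  then have "cmod (kernel_op \<mu> K h \<xi> - kernel_op \<mu> K h' \<xi>)
    \<le> l2norm \<mu> (\<lambda>x. h x - h' x) * l2norm \<mu> (local_kernel r \<xi>)"
    using cauchy_schwarz_L2[OF L2_diff[OF assms(1,3)] k(1)] by simp
  also have "\<dots> \<le> l2norm \<mu> (\<lambda>x. h x - h' x) * (kernel_const * sqrt (ball_measure r))"
    by (intro mult_left_mono k) simp
  finally show ?thesis by (simp add: mult.commute)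
qed

text \<open>The extension as a relation: results proved for it do not depend on which representative
  \<open>kernel_op_L2\<close> selects. Requiring the approximants to lie in \<open>L2\<close> makes
  \<open>l2norm\<close> meaningful for them.\<close>

definition transform_pair :: "('a \<Rightarrow> complex) \<Rightarrow> ('a \<Rightarrow> complex) \<Rightarrow> bool" where
  "transform_pair f g \<longleftrightarrow> f \<in> L2 \<mu> \<and> g \<in> L2 \<mu> \<and>
     (\<exists>\<phi>. (\<forall>k::nat. schwartz (\<phi> k) \<and> \<phi> k \<in> L2 \<mu>) \<and>
        (\<lambda>k. l2norm \<mu> (\<lambda>x. \<phi> k x - f x)) \<longlonglongrightarrow> 0 \<and>
        (\<lambda>k. l2norm \<mu> (\<lambda>\<xi>. kernel_op \<mu> K (\<phi> k) \<xi> - g \<xi>)) \<longlonglongrightarrow> 0)"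

lemma kernel_op_schwartz_L2: "schwartz \<phi> \<Longrightarrow> kernel_op \<mu> K \<phi> \<in> L2 \<mu>"
  using parseval by blast

text \<open>Expanding the squared norm of the difference reduces the claim to Parseval for the pairs
  formed from \<phi> and \<psi>, so the transform of \<open>\<phi> - \<psi>\<close> never has to be
  split.\<close>

lemma kernel_op_isometry:
  assumes "schwartz \<phi>" "\<phi> \<in> L2 \<mu>" "schwartz \<psi>" "\<psi> \<in> L2 \<mu>"
  shows "l2norm \<mu> (\<lambda>\<xi>. kernel_op \<mu> K \<phi> \<xi> - kernel_op \<mu> K \<psi> \<xi>) = l2norm \<mu> (\<lambda>x. \<phi> x - \<psi> x)"
proof -
  have norm_eq: "(l2norm \<mu> (kernel_op \<mu> K \<eta>))\<^sup>2 = (l2norm \<mu> \<eta>)\<^sup>2" if "schwartz \<eta>" for \<eta>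
    using parseval[OF that that] unfolding inner2_self of_real_eq_iff by blast
  have "(l2norm \<mu> (\<lambda>\<xi>. kernel_op \<mu> K \<phi> \<xi> - kernel_op \<mu> K \<psi> \<xi>))\<^sup>2 = (l2norm \<mu> (\<lambda>x. \<phi> x - \<psi> x))\<^sup>2"
    using assms parseval[OF assms(1,3)] norm_eq[OF assms(1)] norm_eq[OF assms(3)]
    by (simp add: l2norm_diff_power2)
  then show ?thesis
    by (simp add: power2_eq_iff_nonneg)
qed

text \<open>A finite distance to \<open>f\<close> already forces membership, so it is enough to drop
  finitely many terms; the decay of Schwartz functions against \<mu> is not estimated.\<close>

lemma schwartz_eventually_L2:
  assumes "\<And>k::nat. schwartz (\<phi> k)" "f \<in> L2 \<mu>" "(\<lambda>k. norm2 \<mu> (\<lambda>x. \<phi> k x - f x)) \<longlonglongrightarrow> 0"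
  shows "\<exists>k0. \<forall>k\<ge>k0. \<phi> k \<in> L2 \<mu>"
proof -
  have "eventually (\<lambda>k. norm2 \<mu> (\<lambda>x. \<phi> k x - f x) < 1) sequentially"
    by (rule order_tendstoD(2)[OF assms(3)]) simp
  then obtain k0 where k0: "\<And>k. k \<ge> k0 \<Longrightarrow> norm2 \<mu> (\<lambda>x. \<phi> k x - f x) < 1"
    unfolding eventually_sequentially by blast
  have "\<phi> k \<in> L2 \<mu>" if "k \<ge> k0" for k
  proof -
    have "\<phi> k \<in> borel_measurable \<mu>"
      by (intro trace_measurable borel_measurable_continuous_onI schwartz_continuous assms)
    then have "(\<lambda>x. \<phi> k x - f x) \<in> borel_measurable \<mu>"
      using L2_measurable[OF assms(2)] by measurable
    moreover have "norm2 \<mu> (\<lambda>x. \<phi> k x - f x) < \<infinity>"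
      using k0[OF that] by (rule order_less_trans) simp
    ultimately have "(\<lambda>x. \<phi> k x - f x) \<in> L2 \<mu>"
      using norm2_less_top_iff by blast
    from L2_add[OF this assms(2)] show ?thesis by simp
  qed
  then show ?thesis by blast
qed

lemma norm2_tendsto_0_iff:
  assumes "\<And>k. u k \<in> L2 \<mu>"
  shows "(\<lambda>k. norm2 \<mu> (u k)) \<longlonglongrightarrow> 0 \<longleftrightarrow> (\<lambda>k. l2norm \<mu> (u k)) \<longlonglongrightarrow> 0"
  unfolding norm2_eq_l2norm[OF assms]
  using tendsto_ennreal_iff[of "\<lambda>k. l2norm \<mu> (u k)" sequentially 0] by simp

lemma transform_pair_exists:
  assumes f: "f \<in> L2 \<mu>"
  shows "\<exists>g. g \<in> L2 \<mu> \<and> (\<exists>\<phi>. (\<forall>k::nat. schwartz (\<phi> k)) \<and>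
             (\<lambda>k. norm2 \<mu> (\<lambda>x. \<phi> k x - f x)) \<longlonglongrightarrow> 0 \<and>
             (\<lambda>k. norm2 \<mu> (\<lambda>\<xi>. kernel_op \<mu> K (\<phi> k) \<xi> - g \<xi>)) \<longlonglongrightarrow> 0)"
proof -
  \<comment> \<open>The rate is the one that \<open>L2_complete_geometric\<close> expects;
    consecutive approximants then differ by at most \<open>2 * (1/4) ^ k\<close>.\<close>
  have "\<exists>\<phi>. schwartz \<phi> \<and> \<phi> \<in> L2 \<mu> \<and> l2norm \<mu> (\<lambda>x. \<phi> x - f x) < (1/4) ^ k" for k :: nat
    by (rule schwartz_dense_L2[OF f]) simp
  then obtain \<phi> where \<phi>: "\<And>k::nat. schwartz (\<phi> k)" "\<And>k. \<phi> k \<in> L2 \<mu>"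
    "\<And>k. l2norm \<mu> (\<lambda>x. \<phi> k x - f x) < (1/4) ^ k"
    by metis
  have T: "kernel_op \<mu> K (\<phi> k) \<in> L2 \<mu>" for k
    by (rule kernel_op_schwartz_L2[OF \<phi>(1)])
  have step: "l2norm \<mu> (\<lambda>\<xi>. kernel_op \<mu> K (\<phi> (Suc k)) \<xi> - kernel_op \<mu> K (\<phi> k) \<xi>) \<le> 2 * (1/4) ^ k" for k
  proof -
    have "l2norm \<mu> (\<lambda>x. \<phi> (Suc k) x - \<phi> k x) \<le> l2norm \<mu> (\<lambda>x. \<phi> (Suc k) x - f x) + l2norm \<mu> (\<lambda>x. f x - \<phi> k x)"
      by (intro l2norm_dist_triangle \<phi> f)
    also have "\<dots> \<le> (1/4) ^ Suc k + (1/4) ^ k"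
      using \<phi>(3)[of "Suc k"] \<phi>(3)[of k] l2norm_minus_commute[of \<mu> f "\<phi> k"] by linarith
    also have "\<dots> \<le> 2 * (1/4) ^ k" by simp
    finally show ?thesis
      by (simp add: kernel_op_isometry \<phi>)
  qed
  obtain g where g: "g \<in> L2 \<mu>" "(\<lambda>k. l2norm \<mu> (\<lambda>\<xi>. kernel_op \<mu> K (\<phi> k) \<xi> - g \<xi>)) \<longlonglongrightarrow> 0"
    using L2_complete_geometric[of "\<lambda>k. kernel_op \<mu> K (\<phi> k)", OF T step] by blast
  have "(\<lambda>k. l2norm \<mu> (\<lambda>x. \<phi> k x - f x)) \<longlonglongrightarrow> 0"
    by (rule Lim_null_comparison[OF always_eventually[OF allI] LIMSEQ_power_zero[of "1/4::real"]])
       (use \<phi>(3) in \<open>auto intro: less_imp_le\<close>)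
  with g \<phi> T f show ?thesis
    by (intro exI[of _ g] conjI exI[of _ \<phi>] allI) (simp_all add: norm2_tendsto_0_iff L2_diff)
qed

lemma transform_pair_kernel_op_L2:
  assumes f: "f \<in> L2 \<mu>"
  shows "transform_pair f (kernel_op_L2 \<mu> K f)"
proof -
  define g where "g = kernel_op_L2 \<mu> K f"
  have "g \<in> L2 \<mu> \<and> (\<exists>\<phi>. (\<forall>k::nat. schwartz (\<phi> k)) \<and>
             (\<lambda>k. norm2 \<mu> (\<lambda>x. \<phi> k x - f x)) \<longlonglongrightarrow> 0 \<and>
             (\<lambda>k. norm2 \<mu> (\<lambda>\<xi>. kernel_op \<mu> K (\<phi> k) \<xi> - g \<xi>)) \<longlonglongrightarrow> 0)"
    unfolding g_def kernel_op_L2_def by (rule someI_ex[OF transform_pair_exists[OF f]])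
  then obtain \<phi> where g: "g \<in> L2 \<mu>" and \<phi>: "\<And>k::nat. schwartz (\<phi> k)"
    "(\<lambda>k. norm2 \<mu> (\<lambda>x. \<phi> k x - f x)) \<longlonglongrightarrow> 0"
    "(\<lambda>k. norm2 \<mu> (\<lambda>\<xi>. kernel_op \<mu> K (\<phi> k) \<xi> - g \<xi>)) \<longlonglongrightarrow> 0"
    by blast
  obtain k0 where k0: "\<And>k. k \<ge> k0 \<Longrightarrow> \<phi> k \<in> L2 \<mu>"
    using schwartz_eventually_L2[OF \<phi>(1) f \<phi>(2)] by blast
  have L2: "\<phi> (k + k0) \<in> L2 \<mu>" "kernel_op \<mu> K (\<phi> (k + k0)) \<in> L2 \<mu>" for k
    using k0[of "k + k0"] kernel_op_schwartz_L2[OF \<phi>(1)] by auto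
  have "(\<lambda>k. l2norm \<mu> (\<lambda>x. \<phi> (k + k0) x - f x)) \<longlonglongrightarrow> 0"
    using LIMSEQ_ignore_initial_segment[OF \<phi>(2), of k0] L2 f
    by (simp add: norm2_tendsto_0_iff L2_diff)
  moreover have "(\<lambda>k. l2norm \<mu> (\<lambda>\<xi>. kernel_op \<mu> K (\<phi> (k + k0)) \<xi> - g \<xi>)) \<longlonglongrightarrow> 0"
    using LIMSEQ_ignore_initial_segment[OF \<phi>(3), of k0] L2 g
    by (simp add: norm2_tendsto_0_iff L2_diff)
  ultimately show ?thesis
    unfolding g_def[symmetric] transform_pair_def using f g L2 \<phi>(1)
    by (intro conjI exI[of _ "\<lambda>k. \<phi> (k + k0)"] allI)
qed

lemma transform_pair_L2: "transform_pair f g \<Longrightarrow> f \<in> L2 \<mu>" "transform_pair f g \<Longrightarrow> g \<in> L2 \<mu>"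
  by (auto simp: transform_pair_def)

lemma transform_pair_inner2:
  assumes "transform_pair f g" "transform_pair f' g'"
  shows "inner2 \<mu> g g' = inner2 \<mu> f f'"
proof -
  note L2 = transform_pair_L2[OF assms(1)] transform_pair_L2[OF assms(2)]
  obtain \<phi> where \<phi>: "\<And>k::nat. schwartz (\<phi> k)" "\<And>k. \<phi> k \<in> L2 \<mu>"
    "(\<lambda>k. l2norm \<mu> (\<lambda>x. \<phi> k x - f x)) \<longlonglongrightarrow> 0"
    "(\<lambda>k. l2norm \<mu> (\<lambda>\<xi>. kernel_op \<mu> K (\<phi> k) \<xi> - g \<xi>)) \<longlonglongrightarrow> 0"
    using assms(1) unfolding transform_pair_def by blast
  obtain \<psi> where \<psi>: "\<And>k::nat. schwartz (\<psi> k)" "\<And>k. \<psi> k \<in> L2 \<mu>"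
    "(\<lambda>k. l2norm \<mu> (\<lambda>x. \<psi> k x - f' x)) \<longlonglongrightarrow> 0"
    "(\<lambda>k. l2norm \<mu> (\<lambda>\<xi>. kernel_op \<mu> K (\<psi> k) \<xi> - g' \<xi>)) \<longlonglongrightarrow> 0"
    using assms(2) unfolding transform_pair_def by blast
  have "inner2 \<mu> (kernel_op \<mu> K (\<phi> k)) (kernel_op \<mu> K (\<psi> k)) = inner2 \<mu> (\<phi> k) (\<psi> k)" for k
    using parseval[OF \<phi>(1) \<psi>(1)] by blast
  then have "(\<lambda>k. inner2 \<mu> (\<phi> k) (\<psi> k)) \<longlonglongrightarrow> inner2 \<mu> g g'"
    using tendsto_inner2[OF kernel_op_schwartz_L2[OF \<phi>(1)] L2(2) \<phi>(4) kernel_op_schwartz_L2[OF \<psi>(1)] L2(4) \<psi>(4)]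
    by simp
  moreover have "(\<lambda>k. inner2 \<mu> (\<phi> k) (\<psi> k)) \<longlonglongrightarrow> inner2 \<mu> f f'"
    by (rule tendsto_inner2[OF \<phi>(2) L2(1) \<phi>(3) \<psi>(2) L2(3) \<psi>(3)])
  ultimately show ?thesis
    by (rule LIMSEQ_unique)
qed

lemma transform_pair_l2norm:
  assumes "transform_pair f g"
  shows "l2norm \<mu> g = l2norm \<mu> f"
proof -
  have "(l2norm \<mu> g)\<^sup>2 = (l2norm \<mu> f)\<^sup>2"
    using transform_pair_inner2[OF assms assms] unfolding inner2_self of_real_eq_iff .
  then show ?thesis by (simp add: power2_eq_iff_nonneg)
qed

text \<open>Approximation is available inside boxes, so the ball is enclosed in a box and the box in
  a larger ball. The point is that \<open>r'\<close> does not depend on \<open>k\<close>.\<close>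

lemma L2_ball_approximation:
  assumes h: "h \<in> L2 \<mu>" and out: "\<And>x. x \<in> \<Omega> \<Longrightarrow> x \<notin> ball 0 r \<Longrightarrow> h x = 0"
  obtains r' \<psi> where "r \<le> r'" "\<And>k::nat. schwartz (\<psi> k)" "\<And>k. \<psi> k \<in> L2 \<mu>"
    "\<And>k x. x \<notin> ball 0 r' \<Longrightarrow> \<psi> k x = 0" "(\<lambda>k. l2norm \<mu> (\<lambda>x. \<psi> k x - h x)) \<longlonglongrightarrow> 0"
proof -
  obtain u :: 'a where u: "ball 0 r \<subseteq> box (- u) u"
    using bounded_subset_box_symmetric[OF bounded_ball] by blast
  obtain r0 where r0: "box (- u) u \<subseteq> ball 0 r0"
    using bounded_subset_ballD[of "box (- u) u" 0] by auto
  have "approximable (box (- u) u) h"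
    using out u by (intro L2_approximable h) blast
  then have "\<exists>\<psi>. flat_fun \<psi> \<and> (\<forall>x. x \<notin> box (- u) u \<longrightarrow> \<psi> x = 0) \<and> l2norm \<mu> (\<lambda>x. \<psi> x - h x) < inverse (real (Suc k))" for k
    unfolding approximable_def by (metis inverse_positive_iff_positive of_nat_0_less_iff zero_less_Suc)
  then obtain \<psi> where \<psi>: "\<And>k. flat_fun (\<psi> k)" "\<And>k x. x \<notin> box (- u) u \<Longrightarrow> \<psi> k x = 0"
    "\<And>k. l2norm \<mu> (\<lambda>x. \<psi> k x - h x) < inverse (real (Suc k))"
    by metis
  show thesis
  proof (rule that[of "max r r0" \<psi>])
    show "schwartz (\<psi> k)" for k
    proof (rule flat_fun_schwartz[OF \<psi>(1)])
      show "compact (closure (box (- u) u))" by simp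
      show "\<psi> k x = 0" if "x \<notin> closure (box (- u) u)" for x
        using \<psi>(2) that closure_subset by blast
    qed
    show "\<psi> k \<in> L2 \<mu>" for k
      by (rule flat_fun_L2[OF \<psi>(1) bounded_box \<psi>(2)])
    show "\<psi> k x = 0" if "x \<notin> ball 0 (max r r0)" for k x
    proof -
      have "x \<notin> ball 0 r0" using that by auto
      then show ?thesis using r0 \<psi>(2) by blast
    qed
    show "(\<lambda>k. l2norm \<mu> (\<lambda>x. \<psi> k x - h x)) \<longlonglongrightarrow> 0"
      by (rule Lim_null_comparison[OF always_eventually[OF allI] LIMSEQ_inverse_real_of_nat])
         (use \<psi>(3) in \<open>auto intro: less_imp_le\<close>)
  qed simp
qed

text \<open>Compares the integral formula for \<open>h\<close> with the abstract transform of
  \<open>f\<close>. Approximants of \<open>h\<close> supported in one ball have transforms that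
  converge uniformly, hence in norm over the finite-measure ball of radius \<open>R\<close>; on
  Schwartz functions the transform is an isometry, so passing from \<open>h\<close> to
  \<open>f\<close> costs no more than their distance. For \<open>h = f\<close> both transforms agree
  almost everywhere in the ball.\<close>

lemma transform_pair_local:
  assumes pair: "transform_pair f g" and h: "h \<in> L2 \<mu>"
    and out: "\<And>x. x \<in> \<Omega> \<Longrightarrow> x \<notin> ball 0 r \<Longrightarrow> h x = 0"
  shows "(\<lambda>\<xi>. indicator (ball 0 R) \<xi> * kernel_op \<mu> K h \<xi>) \<in> L2 \<mu>"
    and "l2norm \<mu> (\<lambda>\<xi>. indicator (ball 0 R) \<xi> * kernel_op \<mu> K h \<xi> - indicator (ball 0 R) \<xi> * g \<xi>)
      \<le> l2norm \<mu> (\<lambda>x. h x - f x)"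
proof -
  note f = transform_pair_L2(1)[OF pair] and g = transform_pair_L2(2)[OF pair]
  let ?I = "\<lambda>\<xi>. indicator (ball 0 R) \<xi> :: complex"
  let ?T = "kernel_op \<mu> K"
  obtain r' \<psi> where r': "r \<le> r'" and \<psi>: "\<And>k::nat. schwartz (\<psi> k)" "\<And>k. \<psi> k \<in> L2 \<mu>"
    "\<And>k x. x \<notin> ball 0 r' \<Longrightarrow> \<psi> k x = 0" "(\<lambda>k. l2norm \<mu> (\<lambda>x. \<psi> k x - h x)) \<longlonglongrightarrow> 0"
    using L2_ball_approximation[OF h out] by blast
  have out': "h x = 0" if "x \<in> \<Omega>" "x \<notin> ball 0 r'" for x
    using out[OF that(1)] that(2) r' by auto
  define e where "e k = kernel_const * sqrt (ball_measure r') * l2norm \<mu> (\<lambda>x. \<psi> k x - h x)" for k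
  have e: "cmod (?T (\<psi> k) \<xi> - ?T h \<xi>) \<le> e k" if "\<xi> \<in> \<Omega>" for k \<xi>
    unfolding e_def using kernel_op_diff_le[OF \<psi>(2) \<psi>(3) h out' that] by blast
  have e0: "0 \<le> e k" for k
    using kernel_const_pos by (simp add: e_def)
  have elim: "e \<longlonglongrightarrow> 0"
    unfolding e_def using tendsto_mult_right_zero[OF \<psi>(4)] by blast
  have Tm: "?T (\<psi> k) \<in> borel_measurable \<mu>" for k
    by (intro L2_measurable kernel_op_schwartz_L2 \<psi>)
  have Tlim: "(\<lambda>k. ?T (\<psi> k) \<xi>) \<longlonglongrightarrow> ?T h \<xi>" if "\<xi> \<in> space \<mu>" for \<xi>
  proof (rule LIM_zero_cancel)
    show "(\<lambda>k. ?T (\<psi> k) \<xi> - ?T h \<xi>) \<longlonglongrightarrow> 0"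
      by (rule Lim_null_comparison[OF always_eventually[OF allI] elim])
         (use e that in \<open>simp add: space_\<mu>\<close>)
  qed
  \<comment> \<open>Measurability of the integral in \<xi> is inherited from the approximants, whose
    transforms lie in \<open>L2\<close> by the Parseval assumption.\<close>
  have [measurable]: "?T h \<in> borel_measurable \<mu>"
    by (rule borel_measurable_LIMSEQ_metric[OF Tm Tlim])
  note [measurable] = Tm
  have diff: "(\<lambda>\<xi>. ?I \<xi> * ?T (\<psi> k) \<xi> - ?I \<xi> * ?T h \<xi>) \<in> L2 \<mu>"
    "l2norm \<mu> (\<lambda>\<xi>. ?I \<xi> * ?T (\<psi> k) \<xi> - ?I \<xi> * ?T h \<xi>) \<le> e k * sqrt (ball_measure R)" for k
  proof -
    have "(\<lambda>\<xi>. ?I \<xi> * ?T (\<psi> k) \<xi> - ?I \<xi> * ?T h \<xi>) \<in> borel_measurable \<mu>" by measurable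
    moreover have "cmod (?I \<xi> * ?T (\<psi> k) \<xi> - ?I \<xi> * ?T h \<xi>) \<le> e k * indicator (ball 0 R) \<xi>" if "\<xi> \<in> \<Omega>" for \<xi>
      using e[OF that, of k] by (auto split: split_indicator)
    ultimately show "(\<lambda>\<xi>. ?I \<xi> * ?T (\<psi> k) \<xi> - ?I \<xi> * ?T h \<xi>) \<in> L2 \<mu>"
      "l2norm \<mu> (\<lambda>\<xi>. ?I \<xi> * ?T (\<psi> k) \<xi> - ?I \<xi> * ?T h \<xi>) \<le> e k * sqrt (ball_measure R)"
      using L2_bounded_on_ball[OF _ e0] by blast+
  qed
  have IT: "(\<lambda>\<xi>. ?I \<xi> * ?T (\<psi> k) \<xi>) \<in> L2 \<mu>" for k
    by (intro ball_indicator_mult_L2 kernel_op_schwartz_L2 \<psi>)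
  show IL2: "(\<lambda>\<xi>. ?I \<xi> * ?T h \<xi>) \<in> L2 \<mu>"
    using L2_diff[OF IT[of 0] diff(1)[of 0]] by simp
  obtain \<phi> where \<phi>: "\<And>k::nat. schwartz (\<phi> k)" "\<And>k. \<phi> k \<in> L2 \<mu>"
    "(\<lambda>k. l2norm \<mu> (\<lambda>x. \<phi> k x - f x)) \<longlonglongrightarrow> 0"
    "(\<lambda>k. l2norm \<mu> (\<lambda>\<xi>. ?T (\<phi> k) \<xi> - g \<xi>)) \<longlonglongrightarrow> 0"
    using pair unfolding transform_pair_def by blast
  have I\<phi>: "(\<lambda>\<xi>. ?I \<xi> * ?T (\<phi> k) \<xi>) \<in> L2 \<mu>" for k
    by (intro ball_indicator_mult_L2 kernel_op_schwartz_L2 \<phi>)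
  have Ig: "(\<lambda>\<xi>. ?I \<xi> * g \<xi>) \<in> L2 \<mu>"
    by (intro ball_indicator_mult_L2 g)
  have drop: "l2norm \<mu> (\<lambda>\<xi>. ?I \<xi> * u \<xi> - ?I \<xi> * v \<xi>) \<le> l2norm \<mu> (\<lambda>\<xi>. u \<xi> - v \<xi>)"
    if "u \<in> L2 \<mu>" "v \<in> L2 \<mu>" for u v
    by (rule l2norm_mono[OF L2_diff[OF that]])
       (use L2_measurable[OF L2_diff[OF ball_indicator_mult_L2[OF that(1)] ball_indicator_mult_L2[OF that(2)]]]
         in \<open>auto split: split_indicator\<close>)
  \<comment> \<open>The chain goes from the transform of \<open>h\<close> to that of
    \<open>\<psi> k\<close> (uniform estimate), on to that of \<open>\<phi> k\<close> (isometry) and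
    to \<open>g\<close> (choice of \<phi>); in the limit only the distance from \<open>h\<close> to
    \<open>f\<close> survives.\<close>
  have bound: "l2norm \<mu> (\<lambda>\<xi>. ?I \<xi> * ?T h \<xi> - ?I \<xi> * g \<xi>) \<le>
    e k * sqrt (ball_measure R) + (l2norm \<mu> (\<lambda>x. \<psi> k x - h x) + l2norm \<mu> (\<lambda>x. h x - f x)
      + l2norm \<mu> (\<lambda>x. \<phi> k x - f x)) + l2norm \<mu> (\<lambda>\<xi>. ?T (\<phi> k) \<xi> - g \<xi>)" for k
  proof -
    have 1: "l2norm \<mu> (\<lambda>\<xi>. ?I \<xi> * ?T h \<xi> - ?I \<xi> * g \<xi>) \<le>
      l2norm \<mu> (\<lambda>\<xi>. ?I \<xi> * ?T h \<xi> - ?I \<xi> * ?T (\<psi> k) \<xi>) + l2norm \<mu> (\<lambda>\<xi>. ?I \<xi> * ?T (\<psi> k) \<xi> - ?I \<xi> * g \<xi>)"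
      by (rule l2norm_dist_triangle[OF IL2 IT Ig])
    have 2: "l2norm \<mu> (\<lambda>\<xi>. ?I \<xi> * ?T (\<psi> k) \<xi> - ?I \<xi> * g \<xi>) \<le>
      l2norm \<mu> (\<lambda>\<xi>. ?I \<xi> * ?T (\<psi> k) \<xi> - ?I \<xi> * ?T (\<phi> k) \<xi>) + l2norm \<mu> (\<lambda>\<xi>. ?I \<xi> * ?T (\<phi> k) \<xi> - ?I \<xi> * g \<xi>)"
      by (rule l2norm_dist_triangle[OF IT I\<phi> Ig])
    have 3: "l2norm \<mu> (\<lambda>\<xi>. ?I \<xi> * ?T (\<psi> k) \<xi> - ?I \<xi> * ?T (\<phi> k) \<xi>) \<le> l2norm \<mu> (\<lambda>x. \<psi> k x - \<phi> k x)"
      using drop[OF kernel_op_schwartz_L2[OF \<psi>(1)] kernel_op_schwartz_L2[OF \<phi>(1)], of k k]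
        kernel_op_isometry[OF \<psi>(1,2) \<phi>(1,2), of k k] by simp
    have 4: "l2norm \<mu> (\<lambda>\<xi>. ?I \<xi> * ?T (\<phi> k) \<xi> - ?I \<xi> * g \<xi>) \<le> l2norm \<mu> (\<lambda>\<xi>. ?T (\<phi> k) \<xi> - g \<xi>)"
      by (rule drop[OF kernel_op_schwartz_L2[OF \<phi>(1)] g])
    have 5: "l2norm \<mu> (\<lambda>x. \<psi> k x - \<phi> k x) \<le> l2norm \<mu> (\<lambda>x. \<psi> k x - h x) + l2norm \<mu> (\<lambda>x. h x - \<phi> k x)"
      by (rule l2norm_dist_triangle[OF \<psi>(2) h \<phi>(2)])
    have 6: "l2norm \<mu> (\<lambda>x. h x - \<phi> k x) \<le> l2norm \<mu> (\<lambda>x. h x - f x) + l2norm \<mu> (\<lambda>x. f x - \<phi> k x)"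
      by (rule l2norm_dist_triangle[OF h f \<phi>(2)])
    show ?thesis
      using 1 2 3 4 5 6 diff(2)[of k] l2norm_minus_commute[of \<mu> f "\<phi> k"]
        l2norm_minus_commute[of \<mu> "\<lambda>\<xi>. ?I \<xi> * ?T h \<xi>" "\<lambda>\<xi>. ?I \<xi> * ?T (\<psi> k) \<xi>"] by linarith
  qed
  have "(\<lambda>k. e k * sqrt (ball_measure R) + (l2norm \<mu> (\<lambda>x. \<psi> k x - h x) + l2norm \<mu> (\<lambda>x. h x - f x)
      + l2norm \<mu> (\<lambda>x. \<phi> k x - f x)) + l2norm \<mu> (\<lambda>\<xi>. ?T (\<phi> k) \<xi> - g \<xi>))
    \<longlonglongrightarrow> 0 * sqrt (ball_measure R) + (0 + l2norm \<mu> (\<lambda>x. h x - f x) + 0) + 0"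
    by (intro tendsto_add tendsto_mult tendsto_const elim \<psi>(4) \<phi>(3,4))
  then have "l2norm \<mu> (\<lambda>\<xi>. ?I \<xi> * ?T h \<xi> - ?I \<xi> * g \<xi>)
    \<le> 0 * sqrt (ball_measure R) + (0 + l2norm \<mu> (\<lambda>x. h x - f x) + 0) + 0"
    by (rule LIMSEQ_le_const) (use bound in blast)
  then show "l2norm \<mu> (\<lambda>\<xi>. ?I \<xi> * ?T h \<xi> - ?I \<xi> * g \<xi>) \<le> l2norm \<mu> (\<lambda>x. h x - f x)"
    by simp
qed

end

section \<open>Counting and dispersion\<close>

context cone_transform
begin

text \<open>Chebyshev's inequality: off the ball the weight is at least
  \<open>r powr s\<close>.\<close>

lemma weighted_tail_bound:
  assumes f: "f \<in> L2 \<mu>" and "r > 0" "s > 0" "\<alpha> \<ge> 0"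
    and weight: "norm2 \<mu> (\<lambda>x. of_real (norm x powr s) * f x) \<le> ennreal \<alpha>"
  shows "l2norm \<mu> (\<lambda>x. f x - indicator (ball 0 r) x * f x) \<le> \<alpha> / r powr s"
proof -
  let ?t = "\<lambda>x. f x - indicator (ball 0 r) x * f x"
  have t: "?t \<in> L2 \<mu>"
    by (intro L2_diff f ball_indicator_mult_L2)
  have wm: "(\<lambda>x. complex_of_real (norm x powr s) * f x) \<in> borel_measurable \<mu>"
  proof -
    have "(\<lambda>x::'a. complex_of_real (norm x powr s)) \<in> borel_measurable \<mu>"
      by (intro trace_measurable) measurable
    then show ?thesis using L2_measurable[OF f] by measurable
  qed
  have pt: "cmod (?t x) \<le> (1 / r powr s) * cmod (of_real (norm x powr s) * f x)" for x
  proof (cases "x \<in> ball 0 r")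
    case False
    then have "r powr s \<le> norm x powr s"
      using assms by (intro powr_mono2) auto
    then have "1 * cmod (f x) \<le> (norm x powr s / r powr s) * cmod (f x)"
      using \<open>r > 0\<close> by (intro mult_right_mono) auto
    then show ?thesis using False by (simp add: norm_mult)
  qed simp
  have "ennreal ((l2norm \<mu> ?t)\<^sup>2) = (\<integral>\<^sup>+x. ennreal ((cmod (?t x))\<^sup>2) \<partial>\<mu>)"
    by (rule L2_nn_integral[OF t, symmetric])
  also have "\<dots> \<le> (\<integral>\<^sup>+x. ennreal ((1 / r powr s)\<^sup>2) * ennreal ((cmod (of_real (norm x powr s) * f x))\<^sup>2) \<partial>\<mu>)"
  proof (rule nn_integral_mono)
    fix x
    have "(cmod (?t x))\<^sup>2 \<le> ((1 / r powr s) * cmod (of_real (norm x powr s) * f x))\<^sup>2"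
      by (intro power_mono pt) simp
    then show "ennreal ((cmod (?t x))\<^sup>2) \<le> ennreal ((1 / r powr s)\<^sup>2) * ennreal ((cmod (of_real (norm x powr s) * f x))\<^sup>2)"
      by (simp only: ennreal_mult[symmetric] zero_le_power2 power_mult_distrib ennreal_leI)
  qed
  also have "\<dots> = ennreal ((1 / r powr s)\<^sup>2) * (norm2 \<mu> (\<lambda>x. of_real (norm x powr s) * f x))\<^sup>2"
    unfolding norm2_power2 by (rule nn_integral_cmult) (use wm in measurable)
  also have "\<dots> \<le> ennreal ((1 / r powr s)\<^sup>2) * (ennreal \<alpha>)\<^sup>2"
    by (intro mult_left_mono power_mono weight) auto
  also have "\<dots> = ennreal ((\<alpha> / r powr s)\<^sup>2)"
    using \<open>\<alpha> \<ge> 0\<close> by (simp add: ennreal_power ennreal_mult[symmetric] power_divide)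
  finally have "(l2norm \<mu> ?t)\<^sup>2 \<le> (\<alpha> / r powr s)\<^sup>2"
    by simp
  then show ?thesis
    by (rule power2_le_imp_le) (use \<open>\<alpha> \<ge> 0\<close> in simp)
qed

text \<open>Cutting \<open>g n\<close> at \<open>R\<close> costs at most 1/4 of the unit norm, and
  replacing it by the transform of the truncated \<open>f n\<close> at most another 1/4. So
  \<open>?u n\<close> keeps norm at least 1/2, and the square of this is the source of the factor
  4.\<close>

lemma localized_count:
  assumes F: "finite F" and pair: "\<And>n. n \<in> F \<Longrightarrow> transform_pair (f n) (g n)"
    and on: "\<And>m n. m \<in> F \<Longrightarrow> n \<in> F \<Longrightarrow> inner2 \<mu> (f m) (f n) = (if m = n then 1 else 0)"
    and ftail: "\<And>n. n \<in> F \<Longrightarrow> l2norm \<mu> (\<lambda>x. f n x - indicator (ball 0 r) x * f n x) \<le> 1 / 4"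
    and gtail: "\<And>n. n \<in> F \<Longrightarrow> l2norm \<mu> (\<lambda>\<xi>. g n \<xi> - indicator (ball 0 R) \<xi> * g n \<xi>) \<le> 1 / 4"
  shows "real (card F) \<le> 4 * kernel_const\<^sup>2 * ball_measure r * ball_measure R"
proof -
  let ?h = "\<lambda>n x. indicator (ball 0 r) x * f n x"
  let ?u = "\<lambda>n \<xi>. indicator (ball 0 R) \<xi> * kernel_op \<mu> K (?h n) \<xi>"
  have f: "f n \<in> L2 \<mu>" and g: "g n \<in> L2 \<mu>" if "n \<in> F" for n
    using transform_pair_L2[OF pair[OF that]] by auto
  have h: "?h n \<in> L2 \<mu>" if "n \<in> F" for n
    by (intro ball_indicator_mult_L2 f that)
  have u: "?u n \<in> L2 \<mu>" if "n \<in> F" for n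
    by (rule transform_pair_local(1)[OF pair[OF that] h[OF that], of r]) simp
  have lower: "1 / 4 \<le> (l2norm \<mu> (?u n))\<^sup>2" if n: "n \<in> F" for n
  proof -
    let ?Ig = "\<lambda>\<xi>. indicator (ball 0 R) \<xi> * g n \<xi>"
    have Ig: "?Ig \<in> L2 \<mu>"
      by (intro ball_indicator_mult_L2 g n)
    have "l2norm \<mu> (f n) = 1"
      using on[OF n n] by (intro l2norm_eq_1) simp
    then have "l2norm \<mu> (g n) = 1"
      using transform_pair_l2norm[OF pair[OF n]] by simp
    moreover have "l2norm \<mu> (g n) - l2norm \<mu> ?Ig \<le> 1 / 4"
      using l2norm_diff_ge[OF g[OF n] Ig] gtail[OF n] by linarith
    moreover have "l2norm \<mu> (\<lambda>\<xi>. ?u n \<xi> - ?Ig \<xi>) \<le> l2norm \<mu> (\<lambda>x. ?h n x - f n x)"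
      by (rule transform_pair_local(2)[OF pair[OF n] h[OF n], of r]) simp
    moreover have "l2norm \<mu> (\<lambda>x. ?h n x - f n x) \<le> 1 / 4"
      using ftail[OF n] l2norm_minus_commute[of \<mu> "f n" "?h n"] by simp
    ultimately have "1 / 2 \<le> l2norm \<mu> (?u n)"
      using l2norm_diff_ge[OF u[OF n] Ig] by linarith
    then have "(1 / 2)\<^sup>2 \<le> (l2norm \<mu> (?u n))\<^sup>2"
      by (intro power_mono) auto
    then show ?thesis by (simp add: power2_eq_square)
  qed
  have upper: "(\<Sum>n\<in>F. (cmod (?u n \<xi>))\<^sup>2) \<le> kernel_const\<^sup>2 * ball_measure r * indicator (\<Omega> \<inter> ball 0 R) \<xi>"
    if \<xi>: "\<xi> \<in> \<Omega>" for \<xi>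
  proof (cases "\<xi> \<in> ball 0 R")
    case True
    note k = local_kernel_L2[OF \<xi>, of r]
    \<comment> \<open>The cutoff moves from the function to the kernel: the truncated functions are
      no longer orthonormal, but the \<open>f n\<close> are, and Bessel's inequality can be used
      with them.\<close>
    have "kernel_op \<mu> K (?h n) \<xi> = inner2 \<mu> (f n) (local_kernel r \<xi>)" for n
      unfolding kernel_op_def inner2_def local_kernel_def
      by (intro Bochner_Integration.integral_cong) (auto split: split_indicator)
    then have "cmod (?u n \<xi>) = cmod (inner2 \<mu> (local_kernel r \<xi>) (f n))" for n
      using True inner2_cnj[of \<mu> "f n" "local_kernel r \<xi>"] by (metis complex_mod_cnj indicator_simps(1) mult_1)
    then have "(\<Sum>n\<in>F. (cmod (?u n \<xi>))\<^sup>2) \<le> (l2norm \<mu> (local_kernel r \<xi>))\<^sup>2"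
      using bessel_inequality[of F f \<mu>, OF F f k(1) on] by simp
    also have "\<dots> \<le> (kernel_const * sqrt (ball_measure r))\<^sup>2"
      by (intro power_mono k) simp
    finally show ?thesis
      using True \<xi> by (simp add: power_mult_distrib)
  qed simp
  have "real (card F) * (1 / 4) \<le> (\<Sum>n\<in>F. (l2norm \<mu> (?u n))\<^sup>2)"
    by (rule sum_bounded_below) (use lower in blast)
  also have "\<dots> = (\<integral>\<xi>. (\<Sum>n\<in>F. (cmod (?u n \<xi>))\<^sup>2) \<partial>\<mu>)"
    unfolding l2norm_power2 by (rule Bochner_Integration.integral_sum[symmetric]) (rule L2_integrable[OF u])
  also have "\<dots> \<le> (\<integral>\<xi>. kernel_const\<^sup>2 * ball_measure r * indicator (\<Omega> \<inter> ball 0 R) \<xi> \<partial>\<mu>)"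
  proof (rule integral_mono)
    show "integrable \<mu> (\<lambda>\<xi>. \<Sum>n\<in>F. (cmod (?u n \<xi>))\<^sup>2)"
      by (rule Bochner_Integration.integrable_sum) (rule L2_integrable[OF u])
    have "integrable \<mu> (indicator (\<Omega> \<inter> ball 0 R) :: 'a \<Rightarrow> real)"
      using emeasure_ball_finite[of R] trace_sets[of "ball 0 R"] by (simp add: integrable_indicator_iff)
    then show "integrable \<mu> (\<lambda>\<xi>. kernel_const\<^sup>2 * ball_measure r * indicator (\<Omega> \<inter> ball 0 R) \<xi>)"
      by (rule integrable_mult_right)
  qed (use upper space_\<mu> in blast)
  also have "\<dots> = kernel_const\<^sup>2 * ball_measure r * ball_measure R"
    using trace_sets[of "ball 0 R"] by (simp add: space_\<mu> Int_absorb2 Int_absorb1)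
  finally show ?thesis by simp
qed

text \<open>The 16 collects the factors 4 of the two squared-off radii
  \<open>(4 * \<alpha>) powr (1 / s)\<close> and \<open>(4 * \<beta>) powr (1 / s)\<close>; the
  added 1 gives positivity at once, the rest being merely nonnegative by construction.\<close>

definition count_const :: "real \<Rightarrow> real" where
  "count_const s = 4 * kernel_const\<^sup>2 * ball_const\<^sup>2 * 16 powr (2 * a / s) + 1"

lemma count_const_pos: "count_const s > 0"
  unfolding count_const_def by (intro add_nonneg_pos) auto

lemma dispersion_count:
  assumes on: "orthonormal_seq \<mu> f" and F: "finite F" and "s > 0" "\<alpha> > 0" "\<beta> > 0"
    and \<alpha>: "\<And>n. n \<in> F \<Longrightarrow> norm2 \<mu> (\<lambda>x. of_real (norm x powr s) * f n x) \<le> ennreal \<alpha>"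
    and \<beta>: "\<And>n. n \<in> F \<Longrightarrow> norm2 \<mu> (\<lambda>\<xi>. of_real (norm \<xi> powr s) * kernel_op_L2 \<mu> K (f n) \<xi>) \<le> ennreal \<beta>"
  shows "real (card F) \<le> count_const s * (\<alpha> * \<beta>) powr (2 * a / s)"
proof -
  have f: "f n \<in> L2 \<mu>" for n
    using on by (simp add: orthonormal_seq_def)
  \<comment> \<open>With \<open>r powr s = 4 * \<alpha>\<close> the tail bound
    \<open>\<alpha> / r powr s\<close> is exactly 1/4; likewise for \<open>R\<close> and
    \<beta>.\<close>
  define r where "r = (4 * \<alpha>) powr (1 / s)"
  define R where "R = (4 * \<beta>) powr (1 / s)"
  have pos: "r > 0" "R > 0"
    using assms by (auto simp: r_def R_def)
  have rs: "r powr s = 4 * \<alpha>" "R powr s = 4 * \<beta>"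
    using assms by (auto simp: r_def R_def powr_powr)
  have "real (card F) \<le> 4 * kernel_const\<^sup>2 * ball_measure r * ball_measure R"
  proof (rule localized_count[OF F])
    fix n assume n: "n \<in> F"
    show pair: "transform_pair (f n) (kernel_op_L2 \<mu> K (f n))"
      by (rule transform_pair_kernel_op_L2[OF f])
    show "l2norm \<mu> (\<lambda>x. f n x - indicator (ball 0 r) x * f n x) \<le> 1 / 4"
      using weighted_tail_bound[OF f pos(1) \<open>s > 0\<close> less_imp_le[OF \<open>\<alpha> > 0\<close>] \<alpha>[OF n]] \<open>\<alpha> > 0\<close> rs by simp
    show "l2norm \<mu> (\<lambda>\<xi>. kernel_op_L2 \<mu> K (f n) \<xi> - indicator (ball 0 R) \<xi> * kernel_op_L2 \<mu> K (f n) \<xi>) \<le> 1 / 4"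
      using weighted_tail_bound[OF transform_pair_L2(2)[OF pair] pos(2) \<open>s > 0\<close> less_imp_le[OF \<open>\<beta> > 0\<close>] \<beta>[OF n]]
        \<open>\<beta> > 0\<close> rs by simp
  qed (use on in \<open>simp add: orthonormal_seq_def\<close>)
  also have "\<dots> \<le> 4 * kernel_const\<^sup>2 * (ball_const * r powr (2 * a)) * (ball_const * R powr (2 * a))"
    using ball_const_nonneg pos by (intro mult_mono mult_left_mono measure_ball_le mult_nonneg_nonneg) auto
  also have "\<dots> = 4 * kernel_const\<^sup>2 * ball_const\<^sup>2 * (r powr (2 * a) * R powr (2 * a))"
    by (simp add: power2_eq_square)
  also have "r powr (2 * a) * R powr (2 * a) = 16 powr (2 * a / s) * (\<alpha> * \<beta>) powr (2 * a / s)"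
  proof -
    have "r powr (2 * a) * R powr (2 * a) = (4 * \<alpha>) powr (2 * a / s) * (4 * \<beta>) powr (2 * a / s)"
      by (simp add: r_def R_def powr_powr)
    also have "\<dots> = (16 * (\<alpha> * \<beta>)) powr (2 * a / s)"
      using assms by (subst powr_mult[symmetric]) (auto simp: mult_ac)
    finally show ?thesis
      using assms by (subst (asm) powr_mult) auto
  qed
  also have "4 * kernel_const\<^sup>2 * ball_const\<^sup>2 * (16 powr (2 * a / s) * (\<alpha> * \<beta>) powr (2 * a / s))
    \<le> count_const s * (\<alpha> * \<beta>) powr (2 * a / s)"
    unfolding count_const_def by (simp add: algebra_simps)
  finally show ?thesis .
qed

lemma dispersion_sum_lower_bound:
  assumes on: "orthonormal_seq \<mu> f" and s: "s > 0"
  shows "\<exists>C::real. C > 0 \<and> (\<forall>N::nat. N \<ge> 1 \<longrightarrow>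
            (\<Sum>n<N. (norm2 \<mu> (\<lambda>x. of_real (norm x powr s) * f n x))\<^sup>2
                  + (norm2 \<mu> (\<lambda>\<xi>. of_real (norm \<xi> powr s) * kernel_op_L2 \<mu> K (f n) \<xi>))\<^sup>2)
              \<ge> ennreal (C * real N powr (1 + s / (2 * a))))"
proof (intro exI conjI allI impI)
  let ?c = "count_const s"
  \<comment> \<open>At least half of the terms contribute
    \<open>(N / (2 * ?c)) powr (s / (2 * a))\<close> or more; \<open>?C\<close> is what remains
    after the powers of \<open>N\<close> are split off.\<close>
  let ?C = "(1 / 2) * (1 / (2 * ?c)) powr (s / (2 * a))"
  show "?C > 0"
    using count_const_pos[of s] by simp
  fix N :: nat assume N: "N \<ge> 1"
  let ?A = "\<lambda>n. norm2 \<mu> (\<lambda>x. of_real (norm x powr s) * f n x)"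
  let ?B = "\<lambda>n. norm2 \<mu> (\<lambda>\<xi>. of_real (norm \<xi> powr s) * kernel_op_L2 \<mu> K (f n) \<xi>)"
  \<comment> \<open>Solves \<open>?c * (\<tau> * \<tau>) powr (2 * a / s) = N / 2\<close>, so that
    at most half of the functions have both dispersions below \<tau>.\<close>
  define \<tau> where "\<tau> = (real N / (2 * ?c)) powr (s / (4 * a))"
  have base: "real N / (2 * ?c) > 0"
    using N count_const_pos[of s] by simp
  then have \<tau>: "\<tau> > 0"
    unfolding \<tau>_def using N count_const_pos[of s] by simp
  define F where "F = {n\<in>{..<N}. ?A n \<le> ennreal \<tau> \<and> ?B n \<le> ennreal \<tau>}"
  have "real (card F) \<le> ?c * (\<tau> * \<tau>) powr (2 * a / s)"
    by (rule dispersion_count[OF on _ s \<tau> \<tau>]) (auto simp: F_def)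
  also have "(\<tau> * \<tau>) powr (2 * a / s) = real N / (2 * ?c)"
    using base s a_pos count_const_pos[of s] by (simp add: \<tau>_def powr_powr powr_add[symmetric])
  also have "?c * (real N / (2 * ?c)) = real N / 2"
    using count_const_pos[of s] by simp
  finally have "real (card F) \<le> real N / 2" .
  moreover have "card ({..<N} - F) = N - card F"
    by (subst card_Diff_subset) (auto simp: F_def)
  moreover have "card F \<le> N"
    using card_mono[of "{..<N}" F] by (auto simp: F_def)
  ultimately have card: "real N / 2 \<le> real (card ({..<N} - F))"
    by (simp add: of_nat_diff)
  have large: "ennreal (\<tau>\<^sup>2) \<le> (?A n)\<^sup>2 + (?B n)\<^sup>2" if n: "n \<in> {..<N} - F" for n
  proof -
    have "ennreal \<tau> \<le> ?A n \<or> ennreal \<tau> \<le> ?B n"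
      using n by (auto simp: F_def)
    then have "(ennreal \<tau>)\<^sup>2 \<le> (?A n)\<^sup>2 \<or> (ennreal \<tau>)\<^sup>2 \<le> (?B n)\<^sup>2"
      by (meson power_mono zero_le)
    then have "(ennreal \<tau>)\<^sup>2 \<le> (?A n)\<^sup>2 + (?B n)\<^sup>2"
      by (meson add_increasing add_increasing2 zero_le)
    then show ?thesis using \<tau> by (simp add: ennreal_power)
  qed
  have "\<tau>\<^sup>2 = (real N / (2 * ?c)) powr (s / (2 * a))"
    using base a_pos by (simp add: \<tau>_def power2_eq_square powr_add[symmetric])
  also have "\<dots> = (1 / (2 * ?c)) powr (s / (2 * a)) * real N powr (s / (2 * a))"
    using powr_mult[of "1 / (2 * ?c)" "real N"] count_const_pos[of s] by simp
  finally have "?C * real N powr (1 + s / (2 * a)) = real N / 2 * \<tau>\<^sup>2"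
    using N by (simp add: powr_add)
  also have "\<dots> \<le> real (card ({..<N} - F)) * \<tau>\<^sup>2"
    by (intro mult_right_mono card) simp
  finally have "ennreal (?C * real N powr (1 + s / (2 * a))) \<le> ennreal (real (card ({..<N} - F)) * \<tau>\<^sup>2)"
    by (rule ennreal_leI)
  also have "\<dots> = of_nat (card ({..<N} - F)) * ennreal (\<tau>\<^sup>2)"
    by (simp add: ennreal_mult ennreal_of_nat_eq_real_of_nat)
  also have "\<dots> \<le> (\<Sum>n\<in>{..<N} - F. (?A n)\<^sup>2 + (?B n)\<^sup>2)"
    by (rule sum_bounded_below) (rule large)
  also have "\<dots> \<le> (\<Sum>n<N. (?A n)\<^sup>2 + (?B n)\<^sup>2)"
    by (rule sum_mono2) auto
  finally show "ennreal (?C * real N powr (1 + s / (2 * a))) \<le> (\<Sum>n<N. (?A n)\<^sup>2 + (?B n)\<^sup>2)" .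
qed

end

text \<open>Each level of the absolute value is the union of the fibres over i and -i, hence the
  factor 2 in front of the geometric series.\<close>

lemma sum_geometric_fibres_le:
  fixes k :: "nat \<Rightarrow> int" and D \<rho> :: real
  assumes F: "finite F" and \<rho>: "0 < \<rho>" "\<rho> < 1"
    and fibre: "\<And>j. real (card {n\<in>F. k n = j}) \<le> D"
  shows "(\<Sum>n\<in>F. \<rho> ^ nat \<bar>k n\<bar>) \<le> 2 * D / (1 - \<rho>)"
proof -
  let ?m = "\<lambda>n. nat \<bar>k n\<bar>"
  have D: "0 \<le> D" using fibre[of 0] by linarith
  have "(\<Sum>n\<in>F. \<rho> ^ ?m n) = (\<Sum>i\<in>?m ` F. \<Sum>n\<in>{n\<in>F. ?m n = i}. \<rho> ^ ?m n)"
    by (rule sum.image_gen[OF F])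
  also have "\<dots> = (\<Sum>i\<in>?m ` F. real (card {n\<in>F. ?m n = i}) * \<rho> ^ i)"
    by (intro sum.cong) auto
  also have "\<dots> \<le> (\<Sum>i\<in>?m ` F. 2 * D * \<rho> ^ i)"
  proof (intro sum_mono mult_right_mono)
    fix i
    have "card {n\<in>F. ?m n = i} \<le> card ({n\<in>F. k n = int i} \<union> {n\<in>F. k n = - int i})"
      using F by (intro card_mono) auto
    also have "\<dots> \<le> card {n\<in>F. k n = int i} + card {n\<in>F. k n = - int i}"
      by (rule card_Un_le)
    finally show "real (card {n\<in>F. ?m n = i}) \<le> 2 * D"
      using fibre[of "int i"] fibre[of "- int i"] by linarith
  qed (use \<rho> in simp)
  also have "\<dots> = 2 * D * (\<Sum>i\<in>?m ` F. \<rho> ^ i)"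
    by (simp add: sum_distrib_left)
  also have "\<dots> \<le> 2 * D * (\<Sum>i. \<rho> ^ i)"
    using F \<rho> D by (intro mult_left_mono sum_le_suminf summable_geometric) auto
  also have "\<dots> = 2 * D / (1 - \<rho>)"
    using \<rho> by (simp add: suminf_geometric)
  finally show ?thesis .
qed

lemma orthonormal_seq_l2norm: "orthonormal_seq M f \<Longrightarrow> l2norm M (f n) = 1"
  by (rule l2norm_eq_1) (simp add: orthonormal_seq_def)

section \<open>Dispersion products of an orthonormal basis\<close>

context cone_transform
begin

text \<open>Needed because zero times infinity is 0 in \<open>ennreal\<close>: without positive
  factors, a bounded product would not make both dispersions finite.\<close>

lemma weighted_norm2_pos:
  assumes f: "f \<in> L2 \<mu>" "l2norm \<mu> f \<noteq> 0"
  shows "norm2 \<mu> (\<lambda>x. of_real (norm x powr s) * f x) > 0"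
proof (rule ccontr)
  assume "\<not> ?thesis"
  then have zero: "(\<integral>\<^sup>+x. ennreal ((cmod (of_real (norm x powr s) * f x))\<^sup>2) \<partial>\<mu>) = 0"
    unfolding norm2_power2[symmetric] by simp
  have "(\<lambda>x::'a. complex_of_real (norm x powr s)) \<in> borel_measurable \<mu>"
    by (intro trace_measurable) measurable
  then have [measurable]: "(\<lambda>x. complex_of_real (norm x powr s) * f x) \<in> borel_measurable \<mu>"
    using L2_measurable[OF f(1)] by measurable
  have "AE x in \<mu>. ennreal ((cmod (of_real (norm x powr s) * f x))\<^sup>2) = 0"
    using zero by (subst (asm) nn_integral_0_iff_AE) auto
  moreover have "\<Omega> \<inter> {0} \<in> null_sets \<mu>"
    using singleton_0_null trace_sets[of "{0}"] by (simp add: null_sets_def)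
  then have "AE x in \<mu>. x \<notin> \<Omega> \<inter> {0}"
    by (rule AE_not_in)
  ultimately have "AE x in \<mu>. (cmod (f x))\<^sup>2 = 0"
    using AE_space by eventually_elim (auto simp: space_\<mu> norm_mult)
  then have "(\<integral>x. (cmod (f x))\<^sup>2 \<partial>\<mu>) = (\<integral>x. 0 \<partial>\<mu>)"
    using L2_measurable[OF f(1)] by (intro integral_cong_AE) auto
  then show False
    using f(2) by (simp add: l2norm_def)
qed

lemma annulus_functions:
  assumes "emeasure \<mu> \<Omega> \<noteq> 0"
  obtains h :: "nat \<Rightarrow> 'a \<Rightarrow> complex" where "\<And>j. h j \<in> L2 \<mu>"
    "\<And>j x. x \<notin> ball 0 2 - ball 0 1 \<Longrightarrow> h j x = 0"
    "\<And>i j. inner2 \<mu> (h i) (h j) = (if i = j then 1 else 0)"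
proof -
  \<comment> \<open>These radii increase from 1 towards 2, which fits infinitely many disjoint
    shells into one annulus.\<close>
  define p where "p j = 2 - inverse (real (Suc j))" for j
  define S where "S j = {x::'a. norm x \<in> {p j..<p (Suc j)}}" for j
  have p_mono: "p i \<le> p j" if "i \<le> j" for i j
    using that by (simp add: p_def le_imp_inverse_le)
  have p_step: "p j < p (Suc j)" for j
    unfolding p_def by (simp add: field_simps)
  have p_range: "1 \<le> p j" "p j < 2" for j
    using p_mono[of 0 j] by (simp_all add: p_def)
  have [measurable]: "S j \<in> sets borel" for j
    unfolding S_def by measurable
  have S_ball: "S j \<subseteq> ball 0 2 - ball 0 1" for j
    using p_range(1)[of j] p_range(2)[of "Suc j"] by (auto simp: S_def)
  have disj: "S i \<inter> S j = {}" if "i < j" for i j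
    using p_mono[of "Suc i" j] that by (auto simp: S_def)
  have ind: "indicator (S j) \<in> L2 \<mu>" for j
    by (rule bounded_indicator_L2[OF bounded_subset[OF bounded_ball[of 0 2]]]) (use S_ball[of j] in auto)
  define c where "c j = l2norm \<mu> (indicator (S j))" for j
  have c: "c j > 0" for j
  proof -
    have "ennreal ((c j)\<^sup>2) = (\<integral>\<^sup>+x. ennreal ((cmod (indicator (S j) x))\<^sup>2) \<partial>\<mu>)"
      unfolding c_def by (rule L2_nn_integral[OF ind, symmetric])
    also have "\<dots> = (\<integral>\<^sup>+x. indicator (\<Omega> \<inter> S j) x \<partial>\<mu>)"
      by (intro nn_integral_cong) (auto simp: space_\<mu> split: split_indicator)
    also have "\<dots> = emeasure \<mu> (\<Omega> \<inter> S j)"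
      by (intro nn_integral_indicator trace_sets) measurable
    also have "\<dots> > 0"
      unfolding S_def using p_range(1)[of j] p_step[of j] by (intro emeasure_annulus_pos[OF assms]) auto
    finally have "c j \<noteq> 0" by auto
    then show ?thesis by (simp add: c_def less_le)
  qed
  define h :: "nat \<Rightarrow> 'a \<Rightarrow> complex" where "h j x = of_real (1 / c j) * indicator (S j) x" for j :: nat and x :: 'a
  have hL2: "h j \<in> L2 \<mu>" for j
    unfolding h_def[abs_def] by (intro L2_cmult ind)
  have on: "inner2 \<mu> (h i) (h j) = (if i = j then 1 else 0)" for i j
  proof (cases "i = j")
    case True
    have "l2norm \<mu> (h j) = 1"
      unfolding h_def[abs_def] l2norm_cmult using c[of j] by (simp add: c_def norm_divide)
    then show ?thesis
      using True inner2_self[of \<mu> "h j"] by simp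
  next
    case False
    then have "S i \<inter> S j = {}"
      using disj[of i j] disj[of j i] by (cases "i < j") auto
    then have "(\<lambda>x. h i x * cnj (h j x)) = (\<lambda>x. 0)"
      by (auto simp: h_def fun_eq_iff split: split_indicator)
    then show ?thesis
      using False unfolding inner2_def by simp
  qed
  show thesis
  proof (rule that[of h, OF hL2 _ on])
    fix j x assume "x \<notin> ball 0 2 - ball (0::'a) 1"
    then have "x \<notin> S j" using S_ball[of j] by blast
    then show "h j x = 0" by (simp add: h_def)
  qed
qed

text \<open>As \<open>h\<close> vanishes in the unit ball, only the tail of \<open>f\<close> beyond
  radius 1 is seen, and there the weight is at least 1.\<close>

lemma coefficient_le_dispersion:
  assumes h: "h \<in> L2 \<mu>" "l2norm \<mu> h = 1" "\<And>x. x \<notin> ball 0 2 - ball 0 1 \<Longrightarrow> h x = 0"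
    and f: "f \<in> L2 \<mu>" and "s > 0" "\<alpha> \<ge> 0"
    and "norm2 \<mu> (\<lambda>x. of_real (norm x powr s) * f x) \<le> ennreal \<alpha>"
  shows "cmod (inner2 \<mu> h f) \<le> \<alpha>"
proof -
  let ?t = "\<lambda>x. f x - indicator (ball 0 1) x * f x"
  have "inner2 \<mu> h f = inner2 \<mu> h ?t"
    unfolding inner2_def by (intro Bochner_Integration.integral_cong) (use h(3) in \<open>auto split: split_indicator\<close>)
  then have "cmod (inner2 \<mu> h f) \<le> l2norm \<mu> h * l2norm \<mu> ?t"
    using cauchy_schwarz_L2[OF h(1) L2_diff[OF f ball_indicator_mult_L2[OF f]]] by simp
  also have "\<dots> \<le> \<alpha>"
    using weighted_tail_bound[OF f, of 1 s \<alpha>] assms by simp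
  finally show ?thesis .
qed

text \<open>The first two factors bound the transform of a unit vector supported in the ball of
  radius 2; the third is the norm of the indicator of a ball of radius \<delta>, up to
  \<delta>^a.\<close>

definition low_frequency_const :: real where
  "low_frequency_const = kernel_const * sqrt (ball_measure 2) * sqrt ball_const"

lemma low_frequency_const_nonneg: "0 \<le> low_frequency_const"
  unfolding low_frequency_const_def using kernel_const_pos by (intro mult_nonneg_nonneg) (auto simp: ball_const_nonneg)

text \<open>Parseval moves the coefficient to the transform side, where it is split at radius
  \<delta>: inside, the transform of \<open>h\<close> is bounded on a set of small measure; outside,
  the transform of \<open>f\<close> has little mass. The free parameter \<delta> balances the
  two.\<close>

lemma coefficient_le_frequency_dispersion:
  assumes h: "h \<in> L2 \<mu>" "l2norm \<mu> h = 1" "\<And>x. x \<notin> ball 0 2 \<Longrightarrow> h x = 0"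
    and f: "f \<in> L2 \<mu>" "l2norm \<mu> f = 1" and "s > 0" "\<beta> \<ge> 0" "\<delta> > 0"
    and weight: "norm2 \<mu> (\<lambda>\<xi>. of_real (norm \<xi> powr s) * kernel_op_L2 \<mu> K f \<xi>) \<le> ennreal \<beta>"
  shows "cmod (inner2 \<mu> h f) \<le> low_frequency_const * \<delta> powr a + \<beta> / \<delta> powr s"
proof -
  define g where "g = kernel_op_L2 \<mu> K f"
  define G where "G = kernel_op_L2 \<mu> K h"
  have pf: "transform_pair f g" and ph: "transform_pair h G"
    unfolding g_def G_def by (intro transform_pair_kernel_op_L2 f h)+
  note L2 = transform_pair_L2[OF pf] transform_pair_L2[OF ph]
  let ?I = "\<lambda>\<xi>. indicator (ball 0 \<delta>) \<xi> :: complex"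
  let ?IT = "\<lambda>\<xi>. ?I \<xi> * kernel_op \<mu> K h \<xi>"
  let ?t = "\<lambda>\<xi>. g \<xi> - ?I \<xi> * g \<xi>"
  have IG: "(\<lambda>\<xi>. ?I \<xi> * G \<xi>) \<in> L2 \<mu>" and Ig: "(\<lambda>\<xi>. ?I \<xi> * g \<xi>) \<in> L2 \<mu>"
    by (intro ball_indicator_mult_L2 L2)+
  have t: "?t \<in> L2 \<mu>"
    by (intro L2_diff L2 Ig)
  have out: "h x = 0" if "x \<in> \<Omega>" "x \<notin> ball 0 2" for x
    using h(3) that by blast
  \<comment> \<open>Localisation with \<open>h\<close> in both roles: the right side is 0, so
    \<open>G\<close> may be replaced by the integral formula within the ball.\<close>
  have loc: "?IT \<in> L2 \<mu>"
    "l2norm \<mu> (\<lambda>\<xi>. ?IT \<xi> - ?I \<xi> * G \<xi>) \<le> l2norm \<mu> (\<lambda>x. h x - h x)"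
    by (rule transform_pair_local[OF ph h(1), of 2]; use out in blast)+
  have small: "l2norm \<mu> (\<lambda>\<xi>. ?I \<xi> * G \<xi>) \<le> low_frequency_const * \<delta> powr a"
  proof -
    have b0: "0 \<le> kernel_const * sqrt (ball_measure 2)"
      using kernel_const_pos by simp
    have pt: "cmod (?IT \<xi>) \<le> kernel_const * sqrt (ball_measure 2) * indicator (ball 0 \<delta>) \<xi>" if "\<xi> \<in> \<Omega>" for \<xi>
      using kernel_op_diff_le[OF h(1) out L2_zero _ that] h(2) by (auto simp: kernel_op_def norm_mult split: split_indicator)
    have "l2norm \<mu> (\<lambda>x. h x - h x) = 0"
      by (simp add: l2norm_def)
    then have "l2norm \<mu> (\<lambda>\<xi>. ?I \<xi> * G \<xi>) \<le> l2norm \<mu> ?IT"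
      using loc(2) l2norm_diff_ge[OF loc(1) IG] by linarith
    also have "\<dots> \<le> kernel_const * sqrt (ball_measure 2) * sqrt (ball_measure \<delta>)"
      by (rule L2_bounded_on_ball(2)[OF L2_measurable[OF loc(1)] b0 pt])
    also have "\<dots> \<le> kernel_const * sqrt (ball_measure 2) * sqrt (ball_const * \<delta> powr (2 * a))"
      using b0 \<open>\<delta> > 0\<close> by (intro mult_left_mono real_sqrt_le_mono measure_ball_le) auto
    also have "\<dots> = low_frequency_const * \<delta> powr a"
    proof -
      have "\<delta> powr (2 * a) = (\<delta> powr a)\<^sup>2"
        by (simp add: power2_eq_square powr_add[symmetric])
      then show ?thesis
        by (simp add: low_frequency_const_def real_sqrt_mult)
    qed
    finally show ?thesis .
  qed
  have "inner2 \<mu> h f = inner2 \<mu> G g"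
    by (rule transform_pair_inner2[OF ph pf, symmetric])
  also have "\<dots> = inner2 \<mu> (\<lambda>\<xi>. ?I \<xi> * G \<xi>) g + inner2 \<mu> G ?t"
  proof -
    have "inner2 \<mu> (\<lambda>\<xi>. ?I \<xi> * G \<xi>) g = inner2 \<mu> G (\<lambda>\<xi>. ?I \<xi> * g \<xi>)"
      unfolding inner2_def by (intro Bochner_Integration.integral_cong) (auto split: split_indicator)
    then show ?thesis
      using inner2_diff_right[OF L2(2) Ig L2(4)] by simp
  qed
  also have "cmod \<dots> \<le> cmod (inner2 \<mu> (\<lambda>\<xi>. ?I \<xi> * G \<xi>) g) + cmod (inner2 \<mu> G ?t)"
    by (rule norm_triangle_ineq)
  also have "\<dots> \<le> l2norm \<mu> (\<lambda>\<xi>. ?I \<xi> * G \<xi>) * l2norm \<mu> g + l2norm \<mu> G * l2norm \<mu> ?t"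
    by (intro add_mono cauchy_schwarz_L2 IG L2 t)
  also have "l2norm \<mu> g = 1"
    using transform_pair_l2norm[OF pf] f(2) by simp
  also have "l2norm \<mu> G = 1"
    using transform_pair_l2norm[OF ph] h(2) by simp
  also have "l2norm \<mu> (\<lambda>\<xi>. ?I \<xi> * G \<xi>) * 1 + 1 * l2norm \<mu> ?t \<le> low_frequency_const * \<delta> powr a + \<beta> / \<delta> powr s"
    using small weighted_tail_bound[OF L2(2) \<open>\<delta> > 0\<close> \<open>s > 0\<close> \<open>\<beta> \<ge> 0\<close> weight[folded g_def]] by simp
  finally show ?thesis .
qed

lemma emeasure_space_nonzero:
  assumes "f \<in> L2 \<mu>" "l2norm \<mu> f \<noteq> 0"
  shows "emeasure \<mu> \<Omega> \<noteq> 0"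
proof
  assume "emeasure \<mu> \<Omega> = 0"
  then have "space \<mu> \<in> null_sets \<mu>"
    using space_\<mu> by (simp add: null_sets_def sets.top[of \<mu>, unfolded space_\<mu>])
  then have "AE x in \<mu>. x \<notin> space \<mu>"
    by (rule AE_not_in)
  then have "AE x in \<mu>. (cmod (f x))\<^sup>2 = 0"
    using AE_space by eventually_elim simp
  then have "(\<integral>x. (cmod (f x))\<^sup>2 \<partial>\<mu>) = (\<integral>x. 0 \<partial>\<mu>)"
    using L2_measurable[OF assms(1)] by (intro integral_cong_AE) auto
  then show False
    using assms(2) by (simp add: l2norm_def)
qed

text \<open>
  The coefficients of all normalised functions supported in the same annulus are dominated by one
  summable sequence, so up to half of its mass each of them lives on finitely many basis functions;
  but the annulus carries infinitely many orthonormal functions.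
\<close>

lemma basis_coefficients_not_dominated:
  assumes basis: "orthonormal_basis \<mu> f" and w: "summable w"
  shows "\<not> (\<forall>h n. h \<in> L2 \<mu> \<longrightarrow> l2norm \<mu> h = 1 \<longrightarrow> (\<forall>x. x \<notin> ball 0 2 - ball 0 1 \<longrightarrow> h x = 0) \<longrightarrow>
    (cmod (inner2 \<mu> h (f n)))\<^sup>2 \<le> w n)"
proof
  assume dom: "\<forall>h n. h \<in> L2 \<mu> \<longrightarrow> l2norm \<mu> h = 1 \<longrightarrow> (\<forall>x. x \<notin> ball 0 2 - ball 0 1 \<longrightarrow> h x = 0) \<longrightarrow>
    (cmod (inner2 \<mu> h (f n)))\<^sup>2 \<le> w n"
  have on: "orthonormal_seq \<mu> f"
    using basis by (simp add: orthonormal_basis_def)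
  have f: "f n \<in> L2 \<mu>" "l2norm \<mu> (f n) = 1" for n
    using on orthonormal_seq_l2norm[OF on] by (simp_all add: orthonormal_seq_def)
  obtain h where h: "\<And>j::nat. h j \<in> L2 \<mu>" "\<And>j x. x \<notin> ball 0 2 - ball 0 1 \<Longrightarrow> h j x = 0"
    "\<And>i j. inner2 \<mu> (h i) (h j) = (if i = j then 1 else 0)"
    using annulus_functions[OF emeasure_space_nonzero[OF f(1)[of 0]]] f(2)[of 0]
    by (metis zero_neq_one)
  have h1: "l2norm \<mu> (h j) = 1" for j
    by (rule orthonormal_seq_l2norm) (use h in \<open>simp add: orthonormal_seq_def\<close>)
  obtain N where "\<forall>n\<ge>N. norm (\<Sum>i. w (i + n)) < 1 / 2"
    using suminf_exist_split[OF _ w, of "1 / 2"] by auto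
  then have N: "(\<Sum>i. w (i + N)) < 1 / 2"
    by force
  have half: "1 / 2 \<le> (\<Sum>n<N. (cmod (inner2 \<mu> (h j) (f n)))\<^sup>2)" for j
  proof -
    let ?c = "\<lambda>n. (cmod (inner2 \<mu> (h j) (f n)))\<^sup>2"
    have sums: "?c sums 1"
      using orthonormal_basis_parseval[OF basis h(1)[of j]] h1 by simp
    have "(\<Sum>i. ?c (i + N)) \<le> (\<Sum>i. w (i + N))"
    proof (rule suminf_le)
      show "?c (i + N) \<le> w (i + N)" for i
        using dom h(1,2) h1 by blast
      show "summable (\<lambda>i. ?c (i + N))" "summable (\<lambda>i. w (i + N))"
        by (intro summable_ignore_initial_segment sums_summable[OF sums] w)+
    qed
    moreover have "1 = (\<Sum>i. ?c (i + N)) + (\<Sum>n<N. ?c n)"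
      using suminf_split_initial_segment[OF sums_summable[OF sums], of N] sums_unique[OF sums] by linarith
    ultimately show ?thesis using N by linarith
  qed
  have sym: "cmod (inner2 \<mu> (h j) (f n)) = cmod (inner2 \<mu> (f n) (h j))" for j n
    using arg_cong[OF inner2_cnj[of \<mu> "f n" "h j"], of cmod] by simp
  \<comment> \<open>The same coefficients are summed the other way, now by Bessel's inequality for
    \<open>f n\<close> against the \<open>h j\<close>. With \<open>2 * N + 1\<close> functions the
    left side is N + 1/2, just above the right side N.\<close>
  have "(\<Sum>j<2 * N + 1. 1 / 2) \<le> (\<Sum>j<2 * N + 1. \<Sum>n<N. (cmod (inner2 \<mu> (h j) (f n)))\<^sup>2)"
    by (intro sum_mono half)
  also have "\<dots> = (\<Sum>n<N. \<Sum>j<2 * N + 1. (cmod (inner2 \<mu> (f n) (h j)))\<^sup>2)"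
    unfolding sym by (rule sum.swap)
  also have "\<dots> \<le> (\<Sum>n<N. (l2norm \<mu> (f n))\<^sup>2)"
    by (intro sum_mono bessel_inequality[OF _ h(1) f(1) h(3)]) simp
  also have "\<dots> = real N"
    by (simp add: f)
  finally show False by simp
qed

lemma basis_dispersion_product_unbounded:
  assumes basis: "orthonormal_basis \<mu> f" and s: "s > 0"
  shows "(SUP n. norm2 \<mu> (\<lambda>x. of_real (norm x powr s) * f n x)
                  * norm2 \<mu> (\<lambda>\<xi>. of_real (norm \<xi> powr s) * kernel_op_L2 \<mu> K (f n) \<xi>)) = \<infinity>"
proof (rule ccontr)
  assume bounded: "\<not> ?thesis"
  have on: "orthonormal_seq \<mu> f"
    using basis by (simp add: orthonormal_basis_def)
  have f: "f n \<in> L2 \<mu>" "l2norm \<mu> (f n) = 1" for n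
    using on orthonormal_seq_l2norm[OF on] by (simp_all add: orthonormal_seq_def)
  note pair = transform_pair_kernel_op_L2[OF f(1)]
  define X where "X n = norm2 \<mu> (\<lambda>x. of_real (norm x powr s) * f n x)" for n
  define Y where "Y n = norm2 \<mu> (\<lambda>\<xi>. of_real (norm \<xi> powr s) * kernel_op_L2 \<mu> K (f n) \<xi>)" for n
  have pos: "X n > 0" "Y n > 0" for n
    unfolding X_def Y_def using f transform_pair_L2(2)[OF pair] transform_pair_l2norm[OF pair]
    by (intro weighted_norm2_pos; simp)+
  obtain A where A: "A \<ge> 0" "(SUP n. X n * Y n) = ennreal A"
    using bounded unfolding X_def[symmetric] Y_def[symmetric] by (cases "SUP n. X n * Y n") auto
  have XY: "X n * Y n \<le> ennreal A" for n
    unfolding A(2)[symmetric] by (rule SUP_upper) simp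
  have fin: "X n \<noteq> \<infinity>" "Y n \<noteq> \<infinity>" for n
    using XY[of n] pos[of n, unfolded zero_less_iff_neq_zero] by (auto simp: ennreal_top_mult ennreal_mult_top top_unique)
  define x where "x n = enn2real (X n)" for n
  define y where "y n = enn2real (Y n)" for n
  have X: "X n = ennreal (x n)" and Y: "Y n = ennreal (y n)" for n
    using fin[of n] by (simp_all add: x_def y_def less_top)
  have xy_pos: "x n > 0" "y n > 0" for n
    using pos[of n] by (simp_all add: X Y)
  define B where "B = A + 1"
  have B: "B > 0" using A by (simp add: B_def)
  have xy: "x n * y n \<le> B" for n
  proof -
    have "ennreal (x n * y n) \<le> ennreal A"
      using XY[of n] xy_pos[of n] by (simp add: X Y ennreal_mult)
    then show ?thesis using A by (simp add: B_def)
  qed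
  \<comment> \<open>The dyadic scale of the dispersion of \<open>f n\<close>; the bounded product
    then forces \<open>y n\<close> to be at most of order 2^(-k).\<close>
  define k where "k n = \<lfloor>log 2 (x n)\<rfloor>" for n
  have k: "2 powr k n \<le> x n" "x n \<le> 2 powr (k n + 1)" for n
  proof -
    have "real_of_int (k n) \<le> log 2 (x n)" "log 2 (x n) \<le> real_of_int (k n) + 1"
      unfolding k_def by linarith+
    then show "2 powr k n \<le> x n" "x n \<le> 2 powr (k n + 1)"
      using xy_pos[of n] by (simp_all add: le_log_iff log_le_iff)
  qed
  have yk: "y n \<le> B / 2 powr k n" for n
  proof -
    have "2 powr k n * y n \<le> x n * y n"
      using k(1)[of n] xy_pos[of n] by (intro mult_right_mono) auto
    then have "2 powr k n * y n \<le> B"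
      using xy[of n] by linarith
    then show ?thesis by (simp add: field_simps)
  qed
  \<comment> \<open>The smallest decay rate that occurs: a/(2s) from the bounded transform, 1/2 from
    the frequency tail, and 1 at negative scales.\<close>
  define \<theta> where "\<theta> = min (a / (2 * s)) (1 / 2)"
  have \<theta>: "0 < \<theta>" "\<theta> \<le> a / (2 * s)" "\<theta> \<le> 1 / 2"
    using a_pos s by (auto simp: \<theta>_def)
  \<comment> \<open>Coefficients decay like 2 to the power -\<theta>|k|, so their squares decay like
    \<rho> to the power |k|.\<close>
  define \<rho> where "\<rho> = 4 powr (- \<theta>)"
  have \<rho>: "0 < \<rho>" "\<rho> < 1"
    using \<theta> powr_less_mono[of "- \<theta>" 0 4] by (auto simp: \<rho>_def)
  \<comment> \<open>The summand 2 covers negative scales, where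
    \<open>x n \<le> 2 * 2 powr k n\<close>; the others are the two terms of the frequency
    bound.\<close>
  define E where "E = low_frequency_const + B + 2"
  have E: "low_frequency_const + B \<le> E" "2 \<le> E" "0 \<le> E"
    using B low_frequency_const_nonneg by (auto simp: E_def)
  define w where "w n = E\<^sup>2 * \<rho> ^ nat \<bar>k n\<bar>" for n
  have coeff: "(cmod (inner2 \<mu> h (f n)))\<^sup>2 \<le> w n"
    if h: "h \<in> L2 \<mu>" "l2norm \<mu> h = 1" "\<forall>x. x \<notin> ball 0 2 - ball 0 1 \<longrightarrow> h x = 0" for h n
  proof -
    have "cmod (inner2 \<mu> h (f n)) \<le> E * 2 powr (- \<theta> * \<bar>k n\<bar>)"
    proof (cases "k n < 0")
      case True
      have "cmod (inner2 \<mu> h (f n)) \<le> x n"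
        using coefficient_le_dispersion[OF h(1,2) _ f(1) s, of "x n" n] h(3) X xy_pos[of n]
        unfolding X_def by (simp add: less_imp_le)
      also have "\<dots> \<le> 2 * 2 powr k n"
        using k(2)[of n] by (simp add: powr_add)
      also have "\<dots> \<le> 2 * 2 powr (- \<theta> * \<bar>k n\<bar>)"
      proof (intro mult_left_mono powr_mono)
        have "\<theta> * \<bar>real_of_int (k n)\<bar> \<le> 1 * \<bar>real_of_int (k n)\<bar>"
          using \<theta> by (intro mult_right_mono) auto
        then show "real_of_int (k n) \<le> - \<theta> * real_of_int \<bar>k n\<bar>"
          using True by simp
      qed auto
      also have "\<dots> \<le> E * 2 powr (- \<theta> * \<bar>k n\<bar>)"
        by (intro mult_right_mono E) auto
      finally show ?thesis .
    next
      case False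
      \<comment> \<open>Chosen so that \<open>\<delta> powr s\<close> is 2^(-k/2). The decay 2^(-k)
        of \<open>y n\<close> is shared equally: half is spent in the quotient
        \<open>y n / \<delta> powr s\<close>, and half is left over.\<close>
      define \<delta> where "\<delta> = 2 powr (- k n / (2 * s))"
      have \<delta>: "\<delta> > 0" by (simp add: \<delta>_def)
      have le_\<theta>: "2 powr (- (c * k n)) \<le> 2 powr (- \<theta> * \<bar>k n\<bar>)" if "\<theta> \<le> c" for c
        using that False mult_right_mono[OF that, of "real_of_int (k n)"] by (intro powr_mono) auto
      have "cmod (inner2 \<mu> h (f n)) \<le> low_frequency_const * \<delta> powr a + y n / \<delta> powr s"
        by (rule coefficient_le_frequency_dispersion[OF h(1,2) _ f(1,2) s _ \<delta>])
           (use h(3) Y xy_pos[of n] in \<open>auto simp: Y_def less_imp_le\<close>)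
      also have "\<dots> \<le> low_frequency_const * 2 powr (- \<theta> * \<bar>k n\<bar>) + B * 2 powr (- \<theta> * \<bar>k n\<bar>)"
      proof (rule add_mono)
        have "\<delta> powr a = 2 powr (- (a / (2 * s) * k n))"
          by (simp add: \<delta>_def powr_powr mult.commute)
        then show "low_frequency_const * \<delta> powr a \<le> low_frequency_const * 2 powr (- \<theta> * \<bar>k n\<bar>)"
          using le_\<theta>[OF \<theta>(2)] low_frequency_const_nonneg by (intro mult_left_mono) auto
        have ds: "\<delta> powr s = 2 powr (- (1 / 2 * k n))"
          using s by (simp add: \<delta>_def powr_powr)
        have "y n / \<delta> powr s \<le> B / 2 powr k n / \<delta> powr s"
          by (intro divide_right_mono yk) simp
        also have "\<dots> = B * (2 powr (- k n) / 2 powr (- (1 / 2 * k n)))"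
          unfolding ds by (simp add: powr_minus_divide)
        also have "2 powr (- k n) / 2 powr (- (1 / 2 * k n)) = 2 powr (- (1 / 2 * k n))"
          by (simp add: powr_diff[symmetric])
        also have "B * 2 powr (- (1 / 2 * k n)) \<le> B * 2 powr (- \<theta> * \<bar>k n\<bar>)"
          using B by (intro mult_left_mono le_\<theta> \<theta>) auto
        finally show "y n / \<delta> powr s \<le> B * 2 powr (- \<theta> * \<bar>k n\<bar>)" .
      qed
      also have "\<dots> = (low_frequency_const + B) * 2 powr (- \<theta> * \<bar>k n\<bar>)"
        by (simp add: distrib_right)
      also have "\<dots> \<le> E * 2 powr (- \<theta> * \<bar>k n\<bar>)"
        by (intro mult_right_mono E) auto
      finally show ?thesis .
    qed
    then have "(cmod (inner2 \<mu> h (f n)))\<^sup>2 \<le> (E * 2 powr (- \<theta> * \<bar>k n\<bar>))\<^sup>2"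
      by (intro power_mono) auto
    also have "\<dots> = E\<^sup>2 * (2 powr (- \<theta> * \<bar>k n\<bar>) * 2 powr (- \<theta> * \<bar>k n\<bar>))"
      by (simp add: power_mult_distrib power2_eq_square)
    also have "2 powr (- \<theta> * \<bar>k n\<bar>) * 2 powr (- \<theta> * \<bar>k n\<bar>) = 4 powr (- \<theta> * \<bar>k n\<bar>)"
      by (subst powr_mult[symmetric]) auto
    also have "\<dots> = \<rho> powr real (nat \<bar>k n\<bar>)"
      by (simp add: \<rho>_def powr_powr)
    also have "\<dots> = \<rho> ^ nat \<bar>k n\<bar>"
      by (rule powr_realpow[OF \<rho>(1)])
    finally show ?thesis unfolding w_def .
  qed
  \<comment> \<open>On scale j the dispersions are at most 2^(j+1) and B / 2^j, whose product 2 B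
    does not involve j.\<close>
  define D where "D = count_const s * (2 * B) powr (2 * a / s)"
  have fibre: "real (card {n\<in>F. k n = j}) \<le> D" if F: "finite F" for F j
  proof -
    have "real (card {n\<in>F. k n = j}) \<le> count_const s * (2 powr (j + 1) * (B / 2 powr j)) powr (2 * a / s)"
    proof (rule dispersion_count[OF on _ s])
      fix n assume "n \<in> {n\<in>F. k n = j}"
      then have j: "k n = j" by simp
      show "norm2 \<mu> (\<lambda>x. of_real (norm x powr s) * f n x) \<le> ennreal (2 powr (j + 1))"
        using k(2)[of n] unfolding X_def[symmetric] X j by (intro ennreal_leI) simp
      show "norm2 \<mu> (\<lambda>\<xi>. of_real (norm \<xi> powr s) * kernel_op_L2 \<mu> K (f n) \<xi>) \<le> ennreal (B / 2 powr j)"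
        using yk[of n] unfolding Y_def[symmetric] Y j by (intro ennreal_leI) simp
    qed (use F B in auto)
    also have "2 powr (j + 1) * (B / 2 powr j) = 2 * B"
      by (simp add: powr_add)
    finally show ?thesis unfolding D_def .
  qed
  have "summable w"
  proof (rule summableI_nonneg_bounded)
    show "0 \<le> w n" for n using \<rho> by (simp add: w_def)
    show "(\<Sum>n<N. w n) \<le> E\<^sup>2 * (2 * D / (1 - \<rho>))" for N
      unfolding w_def sum_distrib_left[symmetric]
      by (intro mult_left_mono sum_geometric_fibres_le \<rho> fibre) auto
  qed
  then show False
    using basis_coefficients_not_dominated[OF basis] coeff by blast
qed

end

theorem theoremA:
  fixes \<Omega> :: "'a::euclidean_space set"
    and \<mu> :: "'a measure"
    and a s :: real
    and Q :: "'a \<Rightarrow> real"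
    and K :: "'a \<Rightarrow> 'a \<Rightarrow> complex"
    and f :: "nat \<Rightarrow> 'a \<Rightarrow> complex"
  assumes "cone_transform \<Omega> \<mu> a Q K"
    and "s > 0"
    and "orthonormal_seq \<mu> f"
  shows "(\<exists>C::real. C > 0 \<and> (\<forall>N::nat. N \<ge> 1 \<longrightarrow>
            (\<Sum>n<N. (norm2 \<mu> (\<lambda>x. of_real (norm x powr s) * f n x))\<^sup>2
                  + (norm2 \<mu> (\<lambda>\<xi>. of_real (norm \<xi> powr s) * kernel_op_L2 \<mu> K (f n) \<xi>))\<^sup>2)
              \<ge> ennreal (C * real N powr (1 + s / (2 * a)))))
       \<and> (orthonormal_basis \<mu> f \<longrightarrow>
            (SUP n. norm2 \<mu> (\<lambda>x. of_real (norm x powr s) * f n x)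
                  * norm2 \<mu> (\<lambda>\<xi>. of_real (norm \<xi> powr s) * kernel_op_L2 \<mu> K (f n) \<xi>)) = \<infinity>)"
  using cone_transform.dispersion_sum_lower_bound[OF assms(1,3,2)]
    cone_transform.basis_dispersion_product_unbounded[OF assms(1) _ assms(2)] by blast

end
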